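(* Let $(M^n,\phi,\xi,\eta,g)$ be an $n$-dimensional para-Sasakian manifold, equipped with the quarter-symmetric metric connection $\tilde\nabla_X Y=\nabla_X Y+\eta(Y)\phi X-g(\phi X,Y)\xi$, where $\nabla$ is the Levi-Civita connection of $g$. Let $\tilde R$ and $\tilde S$ be the curvature tensor and Ricci tensor of $\tilde\nabla$. Suppose that $M^n$ is Ricci-pseudosymmetric with respect to $\tilde\nabla$, i.e. there is a function $L_{\tilde S}$ on $U_{\tilde S}=\{x\in M^n:\tilde S\neq 0\text{ at }x\}$ such that $$\tilde R(X,Y)\cdot\tilde S=L_{\tilde S}\,[(X\wedge_g Y)\cdot\tilde S]$$ holds on $U_{\tilde S}$ for all vector fields $X,Y$. Then $M^n$ is an Einstein manifold with respect to $\tilde\nabla$, or $L_{\tilde S}=-2$.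
   Context: Para-Sasakian manifold: a differentiable manifold $M^n$ with a $(1,1)$-tensor field $\phi$, a vector field $\xi$, a 1-form $\eta$ and a Riemannian metric $g$ such that, for all vector fields $X,Y$: $\phi^2X=X-\eta(X)\xi$, $\eta(\xi)=1$, $\phi\xi=0$, $\eta(\phi X)=0$, $g(X,\xi)=\eta(X)$, $g(\phi X,\phi Y)=g(X,Y)-\eta(X)\eta(Y)$, and moreover $(\nabla_X\phi)Y=-g(X,Y)\xi-\eta(Y)X+2\eta(X)\eta(Y)\xi$, $d\eta=0$, $\nabla_X\xi=\phi X$, with $\nabla$ the Levi-Civita connection of $g$. Curvature: $\tilde R(X,Y)Z=\tilde\nabla_X\tilde\nabla_YZ-\tilde\nabla_Y\tilde\nabla_XZ-\tilde\nabla_{[X,Y]}Z$. Ricci tensor: $\tilde S(Y,Z)=\mathrm{trace}\{X\mapsto\tilde R(X,Y)Z\}$. $(X\wedge_gY)$ is the endomorphism $(X\wedge_gY)Z=g(Y,Z)X-g(X,Z)Y$. For an endomorphism $A$ (here $A=\tilde R(X,Y)$ or $A=X\wedge_gY$) acting as a derivation on a $(0,2)$-tensor $T$: $(A\cdot T)(Z,W)=-T(AZ,W)-T(Z,AW)$. Thus the condition reads $\tilde S(\tilde R(X,Y)Z,W)+\tilde S(Z,\tilde R(X,Y)W)=L_{\tilde S}[\tilde S((X\wedge_gY)Z,W)+\tilde S(Z,(X\wedge_gY)W)]$ for all $X,Y,Z,W$. $M^n$ is Einstein with respect to $\tilde\nabla$ if $\tilde S$ is a constant multiple of $g$.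
   Formalization: The function L on U is assumed to be continuous; for an arbitrary function the claim fails, e.g. on R × S² with metric dt²+e^{2t}h (h of curvature 2), where L may take any value at t=0 although M is not Einstein. *)

theory Defs
  imports "HOL-Analysis.Analysis" "HOL-Library.Function_Algebras"
begin

section \<open>Smooth manifolds\<close>

text \<open>The next two notions are meant for open \<open>S\<close> only.\<close>

primrec Ck_on :: "nat \<Rightarrow> 'a::euclidean_space set \<Rightarrow> ('a \<Rightarrow> 'b::real_normed_vector) \<Rightarrow> bool" where
  "Ck_on 0 S f \<longleftrightarrow> continuous_on S f"
| "Ck_on (Suc k) S f \<longleftrightarrow>
     f differentiable_on S \<and> (\<forall>v. Ck_on k S (\<lambda>x. frechet_derivative f (at x) v))"

definition smooth_on :: "'a::euclidean_space set \<Rightarrow> ('a \<Rightarrow> 'b::real_normed_vector) \<Rightarrow> bool" where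
  "smooth_on S f \<longleftrightarrow> (\<forall>k. Ck_on k S f)"

text \<open>A chart is a pair of its domain and its coordinate map; only the values of the coordinate map
  on the domain matter. The manifold is the whole type \<open>'m\<close>, its dimension is \<open>CARD('n)\<close>, and its
  smooth structure is the one generated by a (not necessarily maximal) atlas.\<close>

type_synonym ('m, 'n) chart = "'m set \<times> ('m \<Rightarrow> real ^ 'n)"

definition chart_inv :: "('m, 'n) chart \<Rightarrow> real ^ 'n \<Rightarrow> 'm" where
  "chart_inv \<kappa> = inv_into (fst \<kappa>) (snd \<kappa>)"

locale smooth_manifold =
  fixes A :: "('m::{t2_space, second_countable_topology}, 'n::finite) chart set"
  assumes charts_cover: "(\<Union>\<kappa>\<in>A. fst \<kappa>) = UNIV"
    and chart_open: "\<And>\<kappa>. \<kappa> \<in> A \<Longrightarrow> open (fst \<kappa>)"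
    and chart_image_open: "\<And>\<kappa>. \<kappa> \<in> A \<Longrightarrow> open (snd \<kappa> ` fst \<kappa>)"
    and chart_homeomorphism:
      "\<And>\<kappa>. \<kappa> \<in> A \<Longrightarrow> homeomorphism (fst \<kappa>) (snd \<kappa> ` fst \<kappa>) (snd \<kappa>) (chart_inv \<kappa>)"
    and chart_transition_smooth:
      "\<And>\<kappa> \<mu>. \<kappa> \<in> A \<Longrightarrow> \<mu> \<in> A \<Longrightarrow> smooth_on (snd \<kappa> ` (fst \<kappa> \<inter> fst \<mu>)) (snd \<mu> \<circ> chart_inv \<kappa>)"

definition smooth_fun :: "('m::topological_space, 'n::finite) chart set \<Rightarrow> 'm set \<Rightarrow> ('m \<Rightarrow> real) \<Rightarrow> bool" where
  "smooth_fun A W f \<longleftrightarrow> (\<forall>\<kappa>\<in>A. smooth_on (snd \<kappa> ` (fst \<kappa> \<inter> W)) (f \<circ> chart_inv \<kappa>))"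

definition smooth_near :: "('m::topological_space, 'n::finite) chart set \<Rightarrow> 'm \<Rightarrow> ('m \<Rightarrow> real) \<Rightarrow> bool" where
  "smooth_near A p f \<longleftrightarrow> (\<exists>W. open W \<and> p \<in> W \<and> smooth_fun A W f)"

section \<open>Tangent vectors and vector fields\<close>

text \<open>A tangent vector at \<open>p\<close> is identified with the directional derivative it induces on the functions
  that are smooth near \<open>p\<close>; by convention it sends every other function to \<open>0\<close>. The sum of tangent
  vectors and of vector fields is the pointwise sum.\<close>

type_synonym 'm tvec = "('m \<Rightarrow> real) \<Rightarrow> real"
type_synonym 'm field = "'m \<Rightarrow> 'm tvec"

definition scale_tvec :: "real \<Rightarrow> 'm tvec \<Rightarrow> 'm tvec" (infixr "*\<^sub>T" 75) where
  "a *\<^sub>T v = (\<lambda>f. a * v f)"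

definition coord_vec ::
  "('m::topological_space, 'n::finite) chart set \<Rightarrow> ('m, 'n) chart \<Rightarrow> 'm \<Rightarrow> real ^ 'n \<Rightarrow> 'm tvec" where
  "coord_vec A \<kappa> p w =
     (\<lambda>f. if smooth_near A p f then frechet_derivative (f \<circ> chart_inv \<kappa>) (at (snd \<kappa> p)) w else 0)"

definition tangent_space :: "('m::topological_space, 'n::finite) chart set \<Rightarrow> 'm \<Rightarrow> 'm tvec set" where
  "tangent_space A p = {coord_vec A \<kappa> p w | \<kappa> w. \<kappa> \<in> A \<and> p \<in> fst \<kappa>}"

text \<open>Smooth vector fields on an open set \<open>W\<close>; values outside \<open>W\<close> are irrelevant.\<close>

definition vector_fields :: "('m::topological_space, 'n::finite) chart set \<Rightarrow> 'm set \<Rightarrow> 'm field set" where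
  "vector_fields A W = {X. (\<forall>p\<in>W. X p \<in> tangent_space A p) \<and>
     (\<forall>V f. open V \<longrightarrow> V \<subseteq> W \<longrightarrow> smooth_fun A V f \<longrightarrow> smooth_fun A V (\<lambda>p. X p f))}"

definition lie_bracket ::
  "('m::topological_space, 'n::finite) chart set \<Rightarrow> 'm field \<Rightarrow> 'm field \<Rightarrow> 'm field" where
  "lie_bracket A X Y = (\<lambda>p f. if smooth_near A p f
     then X p (\<lambda>q. Y q f) - Y p (\<lambda>q. X q f) else 0)"

section \<open>Tensor fields\<close>

locale one_form = smooth_manifold A
  for A :: "('m::{t2_space, second_countable_topology}, 'n::finite) chart set" +
  fixes \<eta> :: "'m \<Rightarrow> 'm tvec \<Rightarrow> real"
  assumes one_form_add: "\<And>p u v. u \<in> tangent_space A p \<Longrightarrow> v \<in> tangent_space A p \<Longrightarrow>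
      \<eta> p (u + v) = \<eta> p u + \<eta> p v"
    and one_form_scale: "\<And>p a v. v \<in> tangent_space A p \<Longrightarrow> \<eta> p (a *\<^sub>T v) = a * \<eta> p v"
    and one_form_smooth: "\<And>W X. open W \<Longrightarrow> X \<in> vector_fields A W \<Longrightarrow> smooth_fun A W (\<lambda>p. \<eta> p (X p))"

locale tensor_field_1_1 = smooth_manifold A
  for A :: "('m::{t2_space, second_countable_topology}, 'n::finite) chart set" +
  fixes \<phi> :: "'m \<Rightarrow> 'm tvec \<Rightarrow> 'm tvec"
  assumes endo_tangent: "\<And>p v. v \<in> tangent_space A p \<Longrightarrow> \<phi> p v \<in> tangent_space A p"
    and endo_add: "\<And>p u v. u \<in> tangent_space A p \<Longrightarrow> v \<in> tangent_space A p \<Longrightarrow>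
      \<phi> p (u + v) = \<phi> p u + \<phi> p v"
    and endo_scale: "\<And>p a v. v \<in> tangent_space A p \<Longrightarrow> \<phi> p (a *\<^sub>T v) = a *\<^sub>T \<phi> p v"
    and endo_smooth: "\<And>W X. open W \<Longrightarrow> X \<in> vector_fields A W \<Longrightarrow>
      (\<lambda>p. \<phi> p (X p)) \<in> vector_fields A W"

locale riemannian_metric = smooth_manifold A
  for A :: "('m::{t2_space, second_countable_topology}, 'n::finite) chart set" +
  fixes g :: "'m \<Rightarrow> 'm tvec \<Rightarrow> 'm tvec \<Rightarrow> real"
  assumes metric_add: "\<And>p u v w. u \<in> tangent_space A p \<Longrightarrow> v \<in> tangent_space A p \<Longrightarrow>
      w \<in> tangent_space A p \<Longrightarrow> g p (u + v) w = g p u w + g p v w"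
    and metric_scale: "\<And>p a u v. u \<in> tangent_space A p \<Longrightarrow> v \<in> tangent_space A p \<Longrightarrow>
      g p (a *\<^sub>T u) v = a * g p u v"
    and metric_sym: "\<And>p u v. u \<in> tangent_space A p \<Longrightarrow> v \<in> tangent_space A p \<Longrightarrow> g p u v = g p v u"
    and metric_pos: "\<And>p v. v \<in> tangent_space A p \<Longrightarrow> v \<noteq> 0 \<Longrightarrow> g p v v > 0"
    and metric_smooth: "\<And>W X Y. open W \<Longrightarrow> X \<in> vector_fields A W \<Longrightarrow> Y \<in> vector_fields A W \<Longrightarrow>
      smooth_fun A W (\<lambda>p. g p (X p) (Y p))"

section \<open>Affine connections\<close>

text \<open>A connection acts on vector fields defined on arbitrary open sets, compatibly with restriction.
  The connection on globally defined fields determines this local operator uniquely.\<close>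

locale affine_connection = smooth_manifold A
  for A :: "('m::{t2_space, second_countable_topology}, 'n::finite) chart set" +
  fixes D :: "'m field \<Rightarrow> 'm field \<Rightarrow> 'm field"
  assumes conn_field: "\<And>W X Y. open W \<Longrightarrow> X \<in> vector_fields A W \<Longrightarrow> Y \<in> vector_fields A W \<Longrightarrow>
      D X Y \<in> vector_fields A W"
    and conn_local: "\<And>W X Y X' Y' p. open W \<Longrightarrow> X \<in> vector_fields A W \<Longrightarrow> Y \<in> vector_fields A W \<Longrightarrow>
      X' \<in> vector_fields A W \<Longrightarrow> Y' \<in> vector_fields A W \<Longrightarrow>
      (\<And>q. q \<in> W \<Longrightarrow> X q = X' q \<and> Y q = Y' q) \<Longrightarrow> p \<in> W \<Longrightarrow> D X Y p = D X' Y' p"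
    and conn_add_left: "\<And>W X X' Y p. open W \<Longrightarrow> X \<in> vector_fields A W \<Longrightarrow> X' \<in> vector_fields A W \<Longrightarrow>
      Y \<in> vector_fields A W \<Longrightarrow> p \<in> W \<Longrightarrow> D (X + X') Y p = D X Y p + D X' Y p"
    and conn_scale_left: "\<And>W h X Y p. open W \<Longrightarrow> smooth_fun A W h \<Longrightarrow> X \<in> vector_fields A W \<Longrightarrow>
      Y \<in> vector_fields A W \<Longrightarrow> p \<in> W \<Longrightarrow> D (\<lambda>q. h q *\<^sub>T X q) Y p = h p *\<^sub>T D X Y p"
    and conn_add_right: "\<And>W X Y Y' p. open W \<Longrightarrow> X \<in> vector_fields A W \<Longrightarrow> Y \<in> vector_fields A W \<Longrightarrow>
      Y' \<in> vector_fields A W \<Longrightarrow> p \<in> W \<Longrightarrow> D X (Y + Y') p = D X Y p + D X Y' p"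
    and conn_leibniz: "\<And>W h X Y p. open W \<Longrightarrow> smooth_fun A W h \<Longrightarrow> X \<in> vector_fields A W \<Longrightarrow>
      Y \<in> vector_fields A W \<Longrightarrow> p \<in> W \<Longrightarrow>
      D X (\<lambda>q. h q *\<^sub>T Y q) p = X p h *\<^sub>T Y p + h p *\<^sub>T D X Y p"

locale levi_civita = riemannian_metric A g + affine_connection A D
  for A :: "('m::{t2_space, second_countable_topology}, 'n::finite) chart set" and g D +
  assumes torsion_free: "\<And>W X Y p. open W \<Longrightarrow> X \<in> vector_fields A W \<Longrightarrow> Y \<in> vector_fields A W \<Longrightarrow>
      p \<in> W \<Longrightarrow> D X Y p - D Y X p = lie_bracket A X Y p"
    and metric_compatible: "\<And>W X Y Z p. open W \<Longrightarrow> X \<in> vector_fields A W \<Longrightarrow> Y \<in> vector_fields A W \<Longrightarrow>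
      Z \<in> vector_fields A W \<Longrightarrow> p \<in> W \<Longrightarrow>
      X p (\<lambda>q. g q (Y q) (Z q)) = g p (D X Y p) (Z p) + g p (Y p) (D X Z p)"

section \<open>Curvature\<close>

definition curvature ::
  "('m::topological_space, 'n::finite) chart set \<Rightarrow> ('m field \<Rightarrow> 'm field \<Rightarrow> 'm field) \<Rightarrow>
    'm field \<Rightarrow> 'm field \<Rightarrow> 'm field \<Rightarrow> 'm field" where
  "curvature A D X Y Z = D X (D Y Z) - D Y (D X Z) - D (lie_bracket A X Y) Z"

definition chart_at :: "('m::topological_space, 'n::finite) chart set \<Rightarrow> 'm \<Rightarrow> ('m, 'n) chart" where
  "chart_at A p = (SOME \<kappa>. \<kappa> \<in> A \<and> p \<in> fst \<kappa>)"

text \<open>The components of a tangent vector are its values on the coordinate functions; \<open>coord_ext A p v\<close>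
  is the local field around \<open>p\<close> with constant components that extends \<open>v\<close>.\<close>

definition coord_fun :: "('m, 'n::finite) chart \<Rightarrow> 'n \<Rightarrow> 'm \<Rightarrow> real" where
  "coord_fun \<kappa> i = (\<lambda>q. snd \<kappa> q $ i)"

definition coord_ext :: "('m::topological_space, 'n::finite) chart set \<Rightarrow> 'm \<Rightarrow> 'm tvec \<Rightarrow> 'm field" where
  "coord_ext A p v =
     (\<lambda>q. coord_vec A (chart_at A p) q (\<chi> i. v (coord_fun (chart_at A p) i)))"

text \<open>As the curvature is tensorial, its value at \<open>p\<close> on tangent vectors does not depend on the
  vector fields used to extend them; similarly, the trace does not depend on the chart.\<close>

definition curvature_at ::
  "('m::topological_space, 'n::finite) chart set \<Rightarrow> ('m field \<Rightarrow> 'm field \<Rightarrow> 'm field) \<Rightarrow>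
    'm \<Rightarrow> 'm tvec \<Rightarrow> 'm tvec \<Rightarrow> 'm tvec \<Rightarrow> 'm tvec" where
  "curvature_at A D p u v w =
     curvature A D (coord_ext A p u) (coord_ext A p v) (coord_ext A p w) p"

definition trace_at ::
  "('m::topological_space, 'n::finite) chart set \<Rightarrow> 'm \<Rightarrow> ('m tvec \<Rightarrow> 'm tvec) \<Rightarrow> real" where
  "trace_at A p F =
     trace (\<chi> i j. F (coord_vec A (chart_at A p) p (axis j 1)) (coord_fun (chart_at A p) i))"

definition ricci ::
  "('m::topological_space, 'n::finite) chart set \<Rightarrow> ('m field \<Rightarrow> 'm field \<Rightarrow> 'm field) \<Rightarrow>
    'm \<Rightarrow> 'm tvec \<Rightarrow> 'm tvec \<Rightarrow> real" where
  "ricci A D p v w = trace_at A p (\<lambda>u. curvature_at A D p u v w)"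

definition einstein ::
  "('m::topological_space, 'n::finite) chart set \<Rightarrow> ('m \<Rightarrow> 'm tvec \<Rightarrow> 'm tvec \<Rightarrow> real) \<Rightarrow>
    ('m field \<Rightarrow> 'm field \<Rightarrow> 'm field) \<Rightarrow> bool" where
  "einstein A g D \<longleftrightarrow>
     (\<exists>c. \<forall>p. \<forall>v\<in>tangent_space A p. \<forall>w\<in>tangent_space A p. ricci A D p v w = c * g p v w)"

section \<open>Ricci-pseudosymmetry\<close>

definition derivation_action ::
  "('m tvec \<Rightarrow> 'm tvec) \<Rightarrow> ('m tvec \<Rightarrow> 'm tvec \<Rightarrow> real) \<Rightarrow> 'm tvec \<Rightarrow> 'm tvec \<Rightarrow> real" where
  "derivation_action F T z w = - T (F z) w - T z (F w)"

definition wedge :: "('m tvec \<Rightarrow> 'm tvec \<Rightarrow> real) \<Rightarrow> 'm tvec \<Rightarrow> 'm tvec \<Rightarrow> 'm tvec \<Rightarrow> 'm tvec" where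
  "wedge h x y z = h y z *\<^sub>T x - h x z *\<^sub>T y"

definition ricci_support ::
  "('m::topological_space, 'n::finite) chart set \<Rightarrow> ('m field \<Rightarrow> 'm field \<Rightarrow> 'm field) \<Rightarrow> 'm set" where
  "ricci_support A D =
     {p. \<exists>v\<in>tangent_space A p. \<exists>w\<in>tangent_space A p. ricci A D p v w \<noteq> 0}"

definition ricci_pseudosymmetric ::
  "('m::topological_space, 'n::finite) chart set \<Rightarrow> ('m \<Rightarrow> 'm tvec \<Rightarrow> 'm tvec \<Rightarrow> real) \<Rightarrow>
    ('m field \<Rightarrow> 'm field \<Rightarrow> 'm field) \<Rightarrow> ('m \<Rightarrow> real) \<Rightarrow> bool" where
  "ricci_pseudosymmetric A g D L \<longleftrightarrow>
     (\<forall>p\<in>ricci_support A D. \<forall>x\<in>tangent_space A p. \<forall>y\<in>tangent_space A p.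
       \<forall>z\<in>tangent_space A p. \<forall>w\<in>tangent_space A p.
         derivation_action (curvature_at A D p x y) (ricci A D p) z w =
         L p * derivation_action (wedge (g p) x y) (ricci A D p) z w)"

section \<open>Para-Sasakian manifolds\<close>

locale para_sasakian = tensor_field_1_1 A \<phi> + one_form A \<eta> + levi_civita A g D
  for A :: "('m::{t2_space, second_countable_topology}, 'n::finite) chart set" and \<phi> and \<xi> :: "'m field" and \<eta> g D +
  assumes xi_field: "\<xi> \<in> vector_fields A UNIV"
    and phi_phi: "\<And>p x. x \<in> tangent_space A p \<Longrightarrow> \<phi> p (\<phi> p x) = x - \<eta> p x *\<^sub>T \<xi> p"
    and eta_xi: "\<And>p. \<eta> p (\<xi> p) = 1"
    and phi_xi: "\<And>p. \<phi> p (\<xi> p) = 0"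
    and eta_phi: "\<And>p x. x \<in> tangent_space A p \<Longrightarrow> \<eta> p (\<phi> p x) = 0"
    and metric_xi: "\<And>p x. x \<in> tangent_space A p \<Longrightarrow> g p x (\<xi> p) = \<eta> p x"
    and metric_phi_phi: "\<And>p x y. x \<in> tangent_space A p \<Longrightarrow> y \<in> tangent_space A p \<Longrightarrow>
      g p (\<phi> p x) (\<phi> p y) = g p x y - \<eta> p x * \<eta> p y"
    and nabla_phi: "\<And>W X Y p. open W \<Longrightarrow> X \<in> vector_fields A W \<Longrightarrow> Y \<in> vector_fields A W \<Longrightarrow> p \<in> W \<Longrightarrow>
      D X (\<lambda>q. \<phi> q (Y q)) p - \<phi> p (D X Y p) =
        (- g p (X p) (Y p)) *\<^sub>T \<xi> p - \<eta> p (Y p) *\<^sub>T X p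
        + (2 * \<eta> p (X p) * \<eta> p (Y p)) *\<^sub>T \<xi> p"
    and eta_closed: "\<And>W X Y p. open W \<Longrightarrow> X \<in> vector_fields A W \<Longrightarrow> Y \<in> vector_fields A W \<Longrightarrow> p \<in> W \<Longrightarrow>
      X p (\<lambda>q. \<eta> q (Y q)) - Y p (\<lambda>q. \<eta> q (X q)) - \<eta> p (lie_bracket A X Y p) = 0"
    and nabla_xi: "\<And>W X p. open W \<Longrightarrow> X \<in> vector_fields A W \<Longrightarrow> p \<in> W \<Longrightarrow> D X \<xi> p = \<phi> p (X p)"

definition quarter_symmetric_connection ::
  "('m \<Rightarrow> 'm tvec \<Rightarrow> 'm tvec) \<Rightarrow> 'm field \<Rightarrow> ('m \<Rightarrow> 'm tvec \<Rightarrow> real) \<Rightarrow>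
    ('m \<Rightarrow> 'm tvec \<Rightarrow> 'm tvec \<Rightarrow> real) \<Rightarrow> ('m field \<Rightarrow> 'm field \<Rightarrow> 'm field) \<Rightarrow>
    'm field \<Rightarrow> 'm field \<Rightarrow> 'm field" where
  "quarter_symmetric_connection \<phi> \<xi> \<eta> g D X Y =
     (\<lambda>p. D X Y p + \<eta> p (Y p) *\<^sub>T \<phi> p (X p) - g p (\<phi> p (X p)) (Y p) *\<^sub>T \<xi> p)"

end

theory Submission
  imports Defs
begin

text \<open>Taking \<open>X = W = \<xi>\<close> in the pseudosymmetry condition gives \<open>S~ = -2 (n - 1) g\<close> at every point
  with \<open>L \<noteq> -2\<close>, where \<open>S~\<close> is the Ricci tensor of the quarter-symmetric connection. The manifold need
  not be connected, so this pointwise dichotomy must be made global. For \<open>n \<le> 2\<close> the equation holds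
  everywhere. For \<open>n \<ge> 3\<close> it cannot hold on a nonempty open set: there it determines the Ricci tensor \<open>S\<close>
  of \<open>g\<close>, and comparing this with the general formula
  \<open>Lie\<^sub>\<xi> S = -2 tr \<phi> (g - \<eta> \<otimes> \<eta>)\<close>, a consequence of
  \<open>[\<xi>, D X Y] = D [\<xi>, X] Y + D X [\<xi>, Y] - 2 (g - \<eta> \<otimes> \<eta>)(X, Y) \<xi>\<close> and the Jacobi identity,
  yields \<open>\<phi> = 0\<close>. By continuity of \<open>L\<close>, the set where \<open>L \<noteq> -2\<close> is open, hence empty.\<close>

section \<open>Differentiable functions of class \<open>C\<^sup>k\<close>\<close>

text \<open>With h = g - \<eta> \<otimes> \<eta>, the structure equations give Lie_\<xi> g = 2
  g(\<phi> ., .), while \<eta>, \<phi> and tr \<phi> are invariant along \<xi>. The equation for S~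
  on an open set therefore yields Lie_\<xi> S = -4 n g(\<phi> ., .) + 6 tr \<phi> h, against the
  general value -2 tr \<phi> h. This comparison differentiates the equation, so it needs a
  neighbourhood and not just a point. In dimension 2 its trace is void; there the curvature is
  already fixed by its values on \<xi>. Two features of the setting shape the rest. Values at a
  point are read off from extensions and traces in \<open>chart_at A p\<close>, a choice that may
  jump with \<open>p\<close>, so the curvature has to be shown tensorial and traces
  chart-independent before they can be differentiated. And the quarter-symmetric connection has
  torsion \<eta>(Y) \<phi> X - \<eta>(X) \<phi> Y, so the Bianchi identity and skewness are proved
  for the Levi-Civita connection and its curvature is compared with the other one by an explicit
  formula.\<close>

lemma frechet_derivative_eq_on_open:
  assumes "open S" "\<And>x. x \<in> S \<Longrightarrow> f x = g x" "x \<in> S"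
  shows "frechet_derivative f (at x) = frechet_derivative g (at x)"
proof -
  \<comment> \<open>\<open>frechet_derivative\<close> is a choice among all derivatives, so equal
    sets of candidates give equal values, even where neither function is differentiable.\<close>
  have "(f has_derivative F) (at x) \<longleftrightarrow> (g has_derivative F) (at x)" for F
    using assms has_derivative_transform_within_open[of f F x UNIV S g]
      has_derivative_transform_within_open[of g F x UNIV S f] by auto
  then show ?thesis by (simp add: frechet_derivative_def)
qed

lemma differentiable_on_eq_on_open:
  assumes "open S" "\<And>x. x \<in> S \<Longrightarrow> f x = g x" "f differentiable_on S"
  shows "g differentiable_on S"
  using assms(2,3) has_derivative_transform[of _ S g f]
  unfolding differentiable_on_def differentiable_def by metis

lemma Ck_on_cong:
  assumes "open S" "\<And>x. x \<in> S \<Longrightarrow> f x = g x" "Ck_on k S f"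
  shows "Ck_on k S g"
  using assms
proof (induction k arbitrary: f g)
  case 0
  then show ?case using continuous_on_eq by auto
next
  case (Suc k)
  have "Ck_on k S (\<lambda>x. frechet_derivative g (at x) v)" for v
    using Suc.IH[of "\<lambda>x. frechet_derivative f (at x) v"] Suc.prems
      frechet_derivative_eq_on_open[OF Suc.prems(1,2)] by auto
  then show ?case using Suc.prems differentiable_on_eq_on_open[OF Suc.prems(1,2)] by auto
qed

lemma Ck_on_subset: "Ck_on k S f \<Longrightarrow> T \<subseteq> S \<Longrightarrow> Ck_on k T f"
  by (induction k arbitrary: f) (auto intro: continuous_on_subset differentiable_on_subset)

lemma Ck_on_lower: "Ck_on (Suc k) S f \<Longrightarrow> Ck_on k S f"
proof (induction k arbitrary: f)
  case 0
  then show ?case by (auto intro: differentiable_imp_continuous_on)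
next
  case (Suc k)
  then show ?case using Ck_on.simps(2) by blast
qed

lemma Ck_on_const: "Ck_on k S (\<lambda>x. c)"
proof (induction k arbitrary: c)
  case (Suc k)
  then show ?case by (simp add: frechet_derivative_const)
qed simp

lemma Ck_on_differentiable:
  assumes "Ck_on (Suc k) S f" "open S" "x \<in> S"
  shows "f differentiable (at x)"
  using assms by (auto simp: differentiable_on_eq_differentiable_at)

lemma Ck_on_add:
  assumes "open S" "Ck_on k S f" "Ck_on k S g"
  shows "Ck_on k S (\<lambda>x. f x + g x)"
  using assms(2,3)
proof (induction k arbitrary: f g)
  case 0
  then show ?case by (auto intro: continuous_on_add)
next
  case (Suc k)
  have d: "f differentiable (at x)" "g differentiable (at x)" if "x \<in> S" for x
    using Suc.prems Ck_on_differentiable assms(1) that by blast+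
  have "frechet_derivative f (at x) v + frechet_derivative g (at x) v
      = frechet_derivative (\<lambda>x. f x + g x) (at x) v" if "x \<in> S" for x v
    using has_derivative_add[OF d[OF that, THEN frechet_derivative_works[THEN iffD1]],
        THEN frechet_derivative_at] by metis
  moreover have "Ck_on k S (\<lambda>x. frechet_derivative f (at x) v + frechet_derivative g (at x) v)" for v
    using Suc by auto
  ultimately have "Ck_on k S (\<lambda>x. frechet_derivative (\<lambda>x. f x + g x) (at x) v)" for v
    using Ck_on_cong[OF assms(1)] by (metis (no_types, lifting))
  then show ?case using Suc.prems by (auto intro: differentiable_on_add)
qed

lemma Ck_on_sum:
  assumes "open S" "finite I" "\<And>i. i \<in> I \<Longrightarrow> Ck_on k S (f i)"
  shows "Ck_on k S (\<lambda>x. \<Sum>i\<in>I. f i x)"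
  using assms(2,3) by (induction I) (auto intro: Ck_on_const Ck_on_add[OF assms(1)])

lemma frechet_derivative_mult_real:
  fixes f g :: "'a::euclidean_space \<Rightarrow> real"
  assumes "f differentiable (at x)" "g differentiable (at x)"
  shows "frechet_derivative (\<lambda>x. f x * g x) (at x) v
      = f x * frechet_derivative g (at x) v + frechet_derivative f (at x) v * g x"
proof -
  have "((\<lambda>x. f x * g x) has_derivative
      (\<lambda>h. f x * frechet_derivative g (at x) h + frechet_derivative f (at x) h * g x)) (at x)"
    using assms by (intro has_derivative_mult) (simp_all add: frechet_derivative_works[symmetric])
  from frechet_derivative_at[OF this] show ?thesis by metis
qed

lemma Ck_on_mult:
  fixes f g :: "'a::euclidean_space \<Rightarrow> real"
  assumes "open S" "Ck_on k S f" "Ck_on k S g"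
  shows "Ck_on k S (\<lambda>x. f x * g x)"
  using assms(2,3)
proof (induction k arbitrary: f g)
  case 0
  then show ?case by (auto intro: continuous_on_mult)
next
  case (Suc k)
  have d: "f differentiable (at x)" "g differentiable (at x)" if "x \<in> S" for x
    using Suc.prems Ck_on_differentiable assms(1) that by blast+
  \<comment> \<open>Each summand of the product rule keeps one factor undifferentiated;
    \<open>Ck_on_lower\<close> brings that factor down to order \<open>k\<close> for the induction
    hypothesis.\<close>
  have "Ck_on k S (\<lambda>x. f x * frechet_derivative g (at x) v + frechet_derivative f (at x) v * g x)" for v
    using Suc.prems Ck_on_lower[OF Suc.prems(1)] Ck_on_lower[OF Suc.prems(2)]
    by (intro Ck_on_add[OF assms(1)] Suc.IH) auto
  moreover have "f x * frechet_derivative g (at x) v + frechet_derivative f (at x) v * g x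
      = frechet_derivative (\<lambda>x. f x * g x) (at x) v" if "x \<in> S" for x v
    using frechet_derivative_mult_real d[OF that] by metis
  ultimately have "Ck_on k S (\<lambda>x. frechet_derivative (\<lambda>x. f x * g x) (at x) v)" for v
    using Ck_on_cong[OF assms(1)] by (metis (no_types, lifting))
  then show ?case using Suc.prems by (auto intro: differentiable_on_mult)
qed

lemma frechet_derivative_compose_at:
  assumes "f differentiable (at x)" "g differentiable (at (f x))"
  shows "frechet_derivative (\<lambda>y. g (f y)) (at x) v
      = frechet_derivative g (at (f x)) (frechet_derivative f (at x) v)"
  using frechet_derivative_compose[OF assms] by (simp add: o_def fun_eq_iff)

lemma Ck_on_bounded_linear:
  assumes "bounded_linear l" "open S" "Ck_on k S f"
  shows "Ck_on k S (\<lambda>x. l (f x))"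
  using assms(3)
proof (induction k arbitrary: f)
  case 0
  then show ?case using assms(1) by (auto intro: bounded_linear.continuous_on)
next
  case (Suc k)
  have dl: "l differentiable (at y)" for y
    using assms(1) bounded_linear_imp_differentiable by blast
  have lin: "frechet_derivative l (at y) = l" for y
    using frechet_derivative_at[OF bounded_linear_imp_has_derivative[OF assms(1)]] by simp
  have d: "f differentiable (at x)" if "x \<in> S" for x
    using Suc.prems Ck_on_differentiable assms(2) that by blast
  have "l (frechet_derivative f (at x) v) = frechet_derivative (\<lambda>x. l (f x)) (at x) v"
    if "x \<in> S" for x v
    using frechet_derivative_compose_at[OF d[OF that] dl] lin by simp
  moreover have "Ck_on k S (\<lambda>x. l (frechet_derivative f (at x) v))" for v
    using Suc by auto
  ultimately have "Ck_on k S (\<lambda>x. frechet_derivative (\<lambda>x. l (f x)) (at x) v)" for v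
    using Ck_on_cong[OF assms(2)] by (metis (no_types, lifting))
  moreover have "(\<lambda>x. l (f x)) differentiable_on S"
    using d dl differentiable_chain_at[of f _ l] assms(2)
    by (auto simp: differentiable_on_eq_differentiable_at o_def)
  ultimately show ?case by auto
qed

text \<open>In the chain rule the direction of the outer derivative moves with the point, while
  \<open>Ck_on\<close> speaks of fixed directions. Expanding in the axes turns the moving direction
  into scalar factors.\<close>

lemma linear_frechet_expand:
  fixes g :: "real ^ 'n \<Rightarrow> real"
  assumes "g differentiable (at y)"
  shows "frechet_derivative g (at y) w = (\<Sum>i\<in>UNIV. w $ i * frechet_derivative g (at y) (axis i 1))"
proof -
  have l: "linear (frechet_derivative g (at y))"
    using assms by (rule linear_frechet_derivative)
  have "frechet_derivative g (at y) w = frechet_derivative g (at y) (\<Sum>i\<in>UNIV. w $ i *\<^sub>R axis i 1)"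
    using basis_expansion[of w] by (simp add: scalar_mult_eq_scaleR)
  then show ?thesis by (simp add: linear_sum[OF l] linear_cmul[OF l])
qed

lemma Ck_on_compose:
  fixes g :: "real ^ 'n \<Rightarrow> real" and f :: "'a::euclidean_space \<Rightarrow> real ^ 'n"
  assumes "open S" "open T" "f ` S \<subseteq> T" "Ck_on k S f" "Ck_on k T g"
  shows "Ck_on k S (\<lambda>x. g (f x))"
  using assms(4,5)
proof (induction k arbitrary: g)
  case 0
  then show ?case using assms(3) continuous_on_compose2 by auto
next
  case (Suc k)
  have d: "f differentiable (at x)" "g differentiable (at (f x))" if "x \<in> S" for x
    using Suc.prems Ck_on_differentiable assms(1,2,3) that by blast+
  have "(\<Sum>i\<in>UNIV. frechet_derivative f (at x) v $ i * frechet_derivative g (at (f x)) (axis i 1))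
      = frechet_derivative (\<lambda>x. g (f x)) (at x) v" if "x \<in> S" for x v
    unfolding frechet_derivative_compose_at[OF d[OF that]]
    by (rule linear_frechet_expand[OF d(2)[OF that], symmetric])
  moreover have "Ck_on k S (\<lambda>x. \<Sum>i\<in>UNIV. frechet_derivative f (at x) v $ i
      * frechet_derivative g (at (f x)) (axis i 1))" for v
  proof (rule Ck_on_sum[OF assms(1) finite], rule Ck_on_mult[OF assms(1)])
    have "Ck_on k S (\<lambda>x. frechet_derivative f (at x) v)"
      using Suc.prems(1) by simp
    then show "Ck_on k S (\<lambda>x. frechet_derivative f (at x) v $ i)" for i
      by (rule Ck_on_bounded_linear[OF bounded_linear_vec_nth assms(1)])
    have "Ck_on k T (\<lambda>y. frechet_derivative g (at y) (axis i 1))" for i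
      using Suc.prems(2) by simp
    then show "Ck_on k S (\<lambda>x. frechet_derivative g (at (f x)) (axis i 1))" for i
      by (rule Suc.IH[OF Ck_on_lower[OF Suc.prems(1)]])
  qed
  ultimately have "Ck_on k S (\<lambda>x. frechet_derivative (\<lambda>x. g (f x)) (at x) v)" for v
    using Ck_on_cong[OF assms(1)] by (metis (no_types, lifting))
  moreover have "(\<lambda>x. g (f x)) differentiable_on S"
    using d differentiable_chain_at[of f _ g] assms(1)
    by (auto simp: differentiable_on_eq_differentiable_at o_def)
  ultimately show ?case by auto
qed

section \<open>Smooth functions and tangent vectors\<close>

lemma scale_tvec_apply [simp]: "(a *\<^sub>T v) f = a * v f"
  by (simp add: scale_tvec_def)

lemma scale_tvec_simps [simp]: "0 *\<^sub>T v = 0" "1 *\<^sub>T v = v" "a *\<^sub>T 0 = 0"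
  by (auto simp: fun_eq_iff)

lemma sum_fun_apply: "(\<Sum>i\<in>I. F i) x = (\<Sum>i\<in>I. F i x)" for F :: "'i \<Rightarrow> 'a \<Rightarrow> 'b::comm_monoid_add"
  by (induction I rule: infinite_finite_induct) auto

context smooth_manifold
begin

lemma chart_inv_chart: "\<kappa> \<in> A \<Longrightarrow> p \<in> fst \<kappa> \<Longrightarrow> chart_inv \<kappa> (snd \<kappa> p) = p"
  using chart_homeomorphism homeomorphism_apply1 by blast

lemma chart_image_inter_open:
  assumes "\<kappa> \<in> A" "open W"
  shows "open (snd \<kappa> ` (fst \<kappa> \<inter> W))"
proof -
  have "openin (top_of_set (snd \<kappa> ` fst \<kappa>)) (snd \<kappa> ` (fst \<kappa> \<inter> W))"
    by (rule homeomorphism_imp_open_map[OF chart_homeomorphism[OF assms(1)] openin_open_Int[OF assms(2)]])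
  then show ?thesis by (rule openin_open_trans[OF _ chart_image_open[OF assms(1)]])
qed

lemma chart_exists: obtains \<kappa> where "\<kappa> \<in> A" "p \<in> fst \<kappa>"
  using charts_cover by blast

lemma chart_at: "chart_at A p \<in> A" "p \<in> fst (chart_at A p)"
  using someI_ex[of "\<lambda>\<kappa>. \<kappa> \<in> A \<and> p \<in> fst \<kappa>"] chart_exists[of p]
  unfolding chart_at_def by metis+

lemma smooth_fun_Ck: "smooth_fun A W f \<longleftrightarrow>
    (\<forall>\<kappa>\<in>A. \<forall>k. Ck_on k (snd \<kappa> ` (fst \<kappa> \<inter> W)) (\<lambda>x. f (chart_inv \<kappa> x)))"
  by (simp add: smooth_fun_def smooth_on_def o_def)

lemma smooth_funD:
  "smooth_fun A W f \<Longrightarrow> \<kappa> \<in> A \<Longrightarrow> Ck_on k (snd \<kappa> ` (fst \<kappa> \<inter> W)) (\<lambda>x. f (chart_inv \<kappa> x))"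
  unfolding smooth_fun_Ck by blast

lemma smooth_fun_cong:
  assumes "open W" "\<And>p. p \<in> W \<Longrightarrow> f p = h p" "smooth_fun A W f"
  shows "smooth_fun A W h"
  unfolding smooth_fun_Ck
proof (intro ballI allI)
  fix \<kappa> k assume k: "\<kappa> \<in> A"
  show "Ck_on k (snd \<kappa> ` (fst \<kappa> \<inter> W)) (\<lambda>x. h (chart_inv \<kappa> x))"
    by (rule Ck_on_cong[OF chart_image_inter_open[OF k assms(1)] _ smooth_funD[OF assms(3) k]])
      (use assms(2) k in \<open>auto simp: chart_inv_chart\<close>)
qed

lemma smooth_fun_subset:
  assumes "smooth_fun A W f" "V \<subseteq> W"
  shows "smooth_fun A V f"
  using Ck_on_subset[OF smooth_funD[OF assms(1)] image_mono[OF Int_mono[OF order_refl assms(2)]]]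
  unfolding smooth_fun_Ck by blast

lemma smooth_fun_const: "smooth_fun A W (\<lambda>p. c)"
  by (simp add: smooth_fun_Ck Ck_on_const)

lemma smooth_fun_add:
  "open W \<Longrightarrow> smooth_fun A W f \<Longrightarrow> smooth_fun A W h \<Longrightarrow> smooth_fun A W (\<lambda>p. f p + h p)"
  by (simp add: smooth_fun_Ck Ck_on_add chart_image_inter_open)

lemma smooth_fun_mult:
  "open W \<Longrightarrow> smooth_fun A W f \<Longrightarrow> smooth_fun A W h \<Longrightarrow> smooth_fun A W (\<lambda>p. f p * h p)"
  by (simp add: smooth_fun_Ck Ck_on_mult chart_image_inter_open)

lemma smooth_fun_uminus: "open W \<Longrightarrow> smooth_fun A W f \<Longrightarrow> smooth_fun A W (\<lambda>p. - f p)"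
  using smooth_fun_mult[OF _ smooth_fun_const[of W "-1"]] by simp

lemma smooth_fun_diff:
  "open W \<Longrightarrow> smooth_fun A W f \<Longrightarrow> smooth_fun A W h \<Longrightarrow> smooth_fun A W (\<lambda>p. f p - h p)"
  using smooth_fun_add[OF _ _ smooth_fun_uminus, of W f h] by simp

lemma smooth_fun_sum:
  "open W \<Longrightarrow> finite I \<Longrightarrow> (\<And>i. i \<in> I \<Longrightarrow> smooth_fun A W (f i)) \<Longrightarrow>
    smooth_fun A W (\<lambda>p. \<Sum>i\<in>I. f i p)"
  by (simp add: smooth_fun_Ck Ck_on_sum chart_image_inter_open)

text \<open>Smoothness ranges over the whole atlas; inside one domain, composition with the smooth
  transition maps carries it from that chart to all others.\<close>

lemma smooth_fun_chart:
  assumes "\<kappa> \<in> A" "open W" "W \<subseteq> fst \<kappa>"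
    and "\<And>k. Ck_on k (snd \<kappa> ` W) (\<lambda>x. f (chart_inv \<kappa> x))"
  shows "smooth_fun A W f"
  unfolding smooth_fun_Ck
proof (intro ballI allI)
  fix \<mu> k assume m: "\<mu> \<in> A"
  let ?S = "snd \<mu> ` (fst \<mu> \<inter> W)"
  have o: "open ?S" using chart_image_inter_open m assms(2) by blast
  have oW: "open (snd \<kappa> ` W)"
    using chart_image_inter_open[OF assms(1,2)] assms(3) by (simp add: Int_absorb1)
  have t: "Ck_on k ?S (\<lambda>x. snd \<kappa> (chart_inv \<mu> x))"
    by (rule Ck_on_subset[OF _ image_mono[OF Int_mono[OF order_refl assms(3)]]])
      (use chart_transition_smooth[OF m assms(1)] in \<open>simp add: smooth_on_def o_def\<close>)
  have "Ck_on k ?S (\<lambda>x. f (chart_inv \<kappa> (snd \<kappa> (chart_inv \<mu> x))))"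
    by (rule Ck_on_compose[OF o oW _ t assms(4)]) (auto simp: chart_inv_chart[OF m])
  then show "Ck_on k ?S (\<lambda>x. f (chart_inv \<mu> x))"
    by (rule Ck_on_cong[OF o, rotated]) (use assms(3) in \<open>auto simp: chart_inv_chart[OF m] chart_inv_chart[OF assms(1)]\<close>)
qed

lemma smooth_fun_coord_fun:
  assumes "\<kappa> \<in> A"
  shows "smooth_fun A (fst \<kappa>) (coord_fun \<kappa> i)"
  unfolding smooth_fun_Ck
proof (intro ballI allI)
  fix \<mu> k assume m: "\<mu> \<in> A"
  show "Ck_on k (snd \<mu> ` (fst \<mu> \<inter> fst \<kappa>)) (\<lambda>x. coord_fun \<kappa> i (chart_inv \<mu> x))"
    unfolding coord_fun_def
    by (rule Ck_on_bounded_linear[OF bounded_linear_vec_nth chart_image_inter_open[OF m chart_open[OF assms]]])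
      (use chart_transition_smooth[OF m assms] in \<open>simp add: smooth_on_def o_def\<close>)
qed

lemma smooth_nearI: "open W \<Longrightarrow> p \<in> W \<Longrightarrow> smooth_fun A W f \<Longrightarrow> smooth_near A p f"
  unfolding smooth_near_def by blast

lemma smooth_near_coord_fun: "\<kappa> \<in> A \<Longrightarrow> p \<in> fst \<kappa> \<Longrightarrow> smooth_near A p (coord_fun \<kappa> i)"
  using smooth_fun_coord_fun chart_open smooth_nearI by blast

lemma smooth_near_common:
  assumes "smooth_near A p f" "smooth_near A p h"
  obtains V where "open V" "p \<in> V" "smooth_fun A V f" "smooth_fun A V h"
proof -
  obtain U V where "open U" "p \<in> U" "smooth_fun A U f" "open V" "p \<in> V" "smooth_fun A V h"
    using assms unfolding smooth_near_def by blast
  then show ?thesis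
    using that[of "U \<inter> V"] smooth_fun_subset[of U f "U \<inter> V"] smooth_fun_subset[of V h "U \<inter> V"] by blast
qed

lemma smooth_near_cong:
  assumes "smooth_near A p f" "open W" "p \<in> W" "\<And>q. q \<in> W \<Longrightarrow> f q = h q"
  shows "smooth_near A p h"
proof -
  obtain V where V: "open V" "p \<in> V" "smooth_fun A V f"
    using assms(1) unfolding smooth_near_def by blast
  have "smooth_fun A (V \<inter> W) h"
    by (rule smooth_fun_cong[OF open_Int[OF V(1) assms(2)] _ smooth_fun_subset[OF V(3)]])
      (use assms(4) in auto)
  then show ?thesis using V assms(2,3) smooth_nearI[of "V \<inter> W"] by blast
qed

lemma smooth_near_const: "smooth_near A p (\<lambda>q. c)"
  using smooth_nearI[OF open_UNIV] smooth_fun_const by blast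

lemma smooth_near_add: "smooth_near A p f \<Longrightarrow> smooth_near A p h \<Longrightarrow> smooth_near A p (\<lambda>q. f q + h q)"
  by (rule smooth_near_common[of p f h]) (auto intro: smooth_nearI smooth_fun_add)

lemma smooth_near_mult: "smooth_near A p f \<Longrightarrow> smooth_near A p h \<Longrightarrow> smooth_near A p (\<lambda>q. f q * h q)"
  by (rule smooth_near_common[of p f h]) (auto intro: smooth_nearI smooth_fun_mult)

lemma smooth_near_differentiable:
  assumes "\<kappa> \<in> A" "p \<in> fst \<kappa>" "smooth_near A p f"
  shows "(\<lambda>x. f (chart_inv \<kappa> x)) differentiable (at (snd \<kappa> p))"
proof -
  obtain V where V: "open V" "p \<in> V" "smooth_fun A V f"
    using assms(3) unfolding smooth_near_def by blast
  show ?thesis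
    using Ck_on_differentiable[OF smooth_funD[OF V(3) assms(1)] chart_image_inter_open[OF assms(1) V(1)]]
      assms(2) V(2) by blast
qed

section \<open>Coordinate vectors and tangent spaces\<close>

lemma coord_vec_apply:
  "smooth_near A p f \<Longrightarrow> coord_vec A \<kappa> p w f
    = frechet_derivative (\<lambda>x. f (chart_inv \<kappa> x)) (at (snd \<kappa> p)) w"
  by (simp add: coord_vec_def o_def)

lemma coord_vec_not_smooth: "\<not> smooth_near A p f \<Longrightarrow> coord_vec A \<kappa> p w f = 0"
  by (simp add: coord_vec_def)

lemma coord_vec_linear:
  assumes "\<kappa> \<in> A" "p \<in> fst \<kappa>"
  shows "coord_vec A \<kappa> p (u + v) = coord_vec A \<kappa> p u + coord_vec A \<kappa> p v"
    and "coord_vec A \<kappa> p (a *\<^sub>R u) = a *\<^sub>T coord_vec A \<kappa> p u"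
proof -
  have l: "linear (frechet_derivative (\<lambda>x. f (chart_inv \<kappa> x)) (at (snd \<kappa> p)))"
    if "smooth_near A p f" for f
    using linear_frechet_derivative smooth_near_differentiable assms that by blast
  show "coord_vec A \<kappa> p (u + v) = coord_vec A \<kappa> p u + coord_vec A \<kappa> p v"
  proof
    show "coord_vec A \<kappa> p (u + v) f = (coord_vec A \<kappa> p u + coord_vec A \<kappa> p v) f" for f
      by (cases "smooth_near A p f") (auto simp: coord_vec_apply coord_vec_not_smooth linear_add l)
  qed
  show "coord_vec A \<kappa> p (a *\<^sub>R u) = a *\<^sub>T coord_vec A \<kappa> p u"
  proof
    show "coord_vec A \<kappa> p (a *\<^sub>R u) f = (a *\<^sub>T coord_vec A \<kappa> p u) f" for f
      by (cases "smooth_near A p f") (auto simp: coord_vec_apply coord_vec_not_smooth linear_cmul l)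
  qed
qed

lemma coord_vec_change:
  assumes "\<kappa> \<in> A" "p \<in> fst \<kappa>" "\<mu> \<in> A" "p \<in> fst \<mu>"
  shows "\<exists>w'. coord_vec A \<kappa> p w = coord_vec A \<mu> p w'"
proof -
  let ?S = "snd \<kappa> ` (fst \<kappa> \<inter> fst \<mu>)"
  let ?t = "\<lambda>x. snd \<mu> (chart_inv \<kappa> x)"
  have o: "open ?S" using chart_image_inter_open chart_open assms by blast
  have p: "snd \<kappa> p \<in> ?S" using assms by auto
  have t: "?t differentiable (at (snd \<kappa> p))"
    using chart_transition_smooth[OF assms(1,3)] Ck_on_differentiable[OF _ o p]
    unfolding smooth_on_def o_def by blast
  have tp: "?t (snd \<kappa> p) = snd \<mu> p" using assms by (simp add: chart_inv_chart)
  \<comment> \<open>The witness is the image of \<open>w\<close> under the Jacobian of the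
    transition map at \<open>snd \<kappa> p\<close>.\<close>
  have "coord_vec A \<kappa> p w f = coord_vec A \<mu> p (frechet_derivative ?t (at (snd \<kappa> p)) w) f" for f
  proof (cases "smooth_near A p f")
    case True
    have "frechet_derivative (\<lambda>x. f (chart_inv \<kappa> x)) (at (snd \<kappa> p))
        = frechet_derivative (\<lambda>x. f (chart_inv \<mu> (?t x))) (at (snd \<kappa> p))"
      by (rule frechet_derivative_eq_on_open[OF o _ p]) (use assms in \<open>auto simp: chart_inv_chart\<close>)
    then show ?thesis
      using frechet_derivative_compose_at[OF t, of "\<lambda>x. f (chart_inv \<mu> x)" w]
        smooth_near_differentiable[OF assms(3,4) True] tp True by (simp add: coord_vec_apply)
  qed (simp add: coord_vec_not_smooth)
  then show ?thesis by blast
qed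

lemma coord_vec_tangent: "\<kappa> \<in> A \<Longrightarrow> p \<in> fst \<kappa> \<Longrightarrow> coord_vec A \<kappa> p w \<in> tangent_space A p"
  unfolding tangent_space_def by blast

lemma tangent_coord_vec:
  assumes "\<kappa> \<in> A" "p \<in> fst \<kappa>" "v \<in> tangent_space A p"
  obtains w where "v = coord_vec A \<kappa> p w"
  using assms coord_vec_change[OF _ _ assms(1,2)] unfolding tangent_space_def by blast

lemma tangent_add:
  assumes "u \<in> tangent_space A p" "v \<in> tangent_space A p"
  shows "u + v \<in> tangent_space A p"
proof -
  obtain a where a: "u = coord_vec A (chart_at A p) p a" by (rule tangent_coord_vec[OF chart_at assms(1)])
  obtain b where b: "v = coord_vec A (chart_at A p) p b" by (rule tangent_coord_vec[OF chart_at assms(2)])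
  from a b show ?thesis
    using coord_vec_tangent[OF chart_at, of p "a + b"] by (simp only: coord_vec_linear[OF chart_at])
qed

lemma tangent_scale:
  assumes "v \<in> tangent_space A p"
  shows "a *\<^sub>T v \<in> tangent_space A p"
proof -
  obtain b where "v = coord_vec A (chart_at A p) p b" by (rule tangent_coord_vec[OF chart_at assms])
  then show ?thesis
    using coord_vec_tangent[OF chart_at, of p "a *\<^sub>R b"] by (simp only: coord_vec_linear[OF chart_at])
qed

lemma tangent_zero: "0 \<in> tangent_space A p"
  using tangent_scale[OF coord_vec_tangent[OF chart_at, of p undefined], of 0] by simp

lemma uminus_scale_tvec: "- v = (-1) *\<^sub>T v"
  by (auto simp: fun_eq_iff)

lemma tangent_uminus: "v \<in> tangent_space A p \<Longrightarrow> - v \<in> tangent_space A p"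
  using tangent_scale[of v p "-1"] by (simp add: uminus_scale_tvec)

lemma tangent_diff: "u \<in> tangent_space A p \<Longrightarrow> v \<in> tangent_space A p \<Longrightarrow> u - v \<in> tangent_space A p"
  using tangent_add[of u p "- v"] tangent_uminus by simp

lemma tangent_sum: "(\<And>i. i \<in> I \<Longrightarrow> F i \<in> tangent_space A p) \<Longrightarrow> (\<Sum>i\<in>I. F i) \<in> tangent_space A p"
  by (induction I rule: infinite_finite_induct) (auto intro: tangent_add tangent_zero)

lemma tangent_not_smooth: "v \<in> tangent_space A p \<Longrightarrow> \<not> smooth_near A p f \<Longrightarrow> v f = 0"
  unfolding tangent_space_def using coord_vec_not_smooth by blast

section \<open>Tangent vectors as derivations of germs\<close>

lemma tangent_fun_add:
  assumes "v \<in> tangent_space A p" "smooth_near A p f" "smooth_near A p h"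
  shows "v (\<lambda>q. f q + h q) = v f + v h"
proof -
  obtain w where w: "v = coord_vec A (chart_at A p) p w" by (rule tangent_coord_vec[OF chart_at assms(1)])
  note d = smooth_near_differentiable[OF chart_at assms(2)] smooth_near_differentiable[OF chart_at assms(3)]
  show ?thesis
    using has_derivative_add[OF d[THEN frechet_derivative_works[THEN iffD1]], THEN frechet_derivative_at,
        symmetric]
    by (simp add: w coord_vec_apply smooth_near_add assms)
qed

lemma tangent_fun_mult:
  assumes "v \<in> tangent_space A p" "smooth_near A p f" "smooth_near A p h"
  shows "v (\<lambda>q. f q * h q) = f p * v h + v f * h p"
proof -
  obtain w where w: "v = coord_vec A (chart_at A p) p w" by (rule tangent_coord_vec[OF chart_at assms(1)])
  note d = smooth_near_differentiable[OF chart_at assms(2)] smooth_near_differentiable[OF chart_at assms(3)]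
  show ?thesis
    using frechet_derivative_mult_real[OF d] chart_at[of p]
    by (simp add: w coord_vec_apply smooth_near_mult assms chart_inv_chart)
qed

lemma tangent_fun_const: "v \<in> tangent_space A p \<Longrightarrow> v (\<lambda>q. c) = 0"
  by (rule tangent_coord_vec[OF chart_at, of v p]) (simp_all add: coord_vec_apply smooth_near_const)

text \<open>Smoothness near \<open>p\<close> depends only on the germ, and tangent vectors take the
  default value 0 on all other functions, so locality holds for arbitrary functions.\<close>

lemma tangent_fun_cong:
  assumes "v \<in> tangent_space A p" "open W" "p \<in> W" "\<And>q. q \<in> W \<Longrightarrow> f q = h q"
  shows "v f = v h"
proof (cases "smooth_near A p f")
  case True
  then have h: "smooth_near A p h" using smooth_near_cong assms by blast
  let ?\<kappa> = "chart_at A p"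
  obtain w where w: "v = coord_vec A ?\<kappa> p w" by (rule tangent_coord_vec[OF chart_at assms(1)])
  have "frechet_derivative (\<lambda>x. f (chart_inv ?\<kappa> x)) (at (snd ?\<kappa> p))
      = frechet_derivative (\<lambda>x. h (chart_inv ?\<kappa> x)) (at (snd ?\<kappa> p))"
    by (rule frechet_derivative_eq_on_open[OF chart_image_inter_open[OF chart_at(1) assms(2)]])
      (use assms chart_at[of p] in \<open>auto simp: chart_inv_chart\<close>)
  then show ?thesis by (simp add: w coord_vec_apply True h)
next
  case False
  then have "\<not> smooth_near A p h" using smooth_near_cong[of p h W f] assms by metis
  with False show ?thesis using assms(1) by (simp add: tangent_not_smooth)
qed

lemma tangent_fun_sum:
  assumes "v \<in> tangent_space A p" "\<And>i. i \<in> I \<Longrightarrow> smooth_near A p (f i)" "finite I"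
  shows "smooth_near A p (\<lambda>q. \<Sum>i\<in>I. f i q) \<and> v (\<lambda>q. \<Sum>i\<in>I. f i q) = (\<Sum>i\<in>I. v (f i))"
  using assms(3,2)
  by (induction I)
    (auto simp: tangent_fun_const[OF assms(1)] smooth_near_const tangent_fun_add[OF assms(1)]
      intro: smooth_near_add)

lemma tangent_fun_uminus:
  assumes "v \<in> tangent_space A p" "smooth_near A p f"
  shows "v (\<lambda>q. - f q) = - v f"
  using tangent_fun_mult[OF assms(1) smooth_near_const[of _ "-1"] assms(2)]
    tangent_fun_const[OF assms(1)] by simp

lemma tangent_fun_diff:
  assumes "v \<in> tangent_space A p" "smooth_near A p f" "smooth_near A p h"
  shows "v (\<lambda>q. f q - h q) = v f - v h"
proof -
  have "smooth_near A p (\<lambda>q. - h q)"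
    using smooth_near_mult[OF smooth_near_const[of _ "-1"] assms(3)] by simp
  then show ?thesis
    using tangent_fun_add[OF assms(1,2), of "\<lambda>q. - h q"] tangent_fun_uminus[OF assms(1,3)] by simp
qed

lemma coord_vec_coord_fun:
  assumes "\<kappa> \<in> A" "p \<in> fst \<kappa>"
  shows "coord_vec A \<kappa> p w (coord_fun \<kappa> i) = w $ i"
proof -
  have "frechet_derivative (\<lambda>x. coord_fun \<kappa> i (chart_inv \<kappa> x)) (at (snd \<kappa> p))
      = frechet_derivative (\<lambda>x. x $ i) (at (snd \<kappa> p))"
    by (rule frechet_derivative_eq_on_open[OF chart_image_open[OF assms(1)]])
      (use assms in \<open>auto simp: chart_inv_chart coord_fun_def\<close>)
  moreover have "frechet_derivative (\<lambda>x. x $ i) (at (snd \<kappa> p)) = (\<lambda>x::real^'n. x $ i)"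
    using frechet_derivative_at[OF bounded_linear_imp_has_derivative[OF bounded_linear_vec_nth]]
    by metis
  ultimately show ?thesis
    using smooth_near_coord_fun[OF assms] by (simp add: coord_vec_apply)
qed

lemma tangent_expand_coord_vec:
  assumes "\<kappa> \<in> A" "p \<in> fst \<kappa>" "v \<in> tangent_space A p"
  shows "v = coord_vec A \<kappa> p (\<chi> i. v (coord_fun \<kappa> i))"
proof -
  obtain w where w: "v = coord_vec A \<kappa> p w" by (rule tangent_coord_vec[OF assms])
  then have "(\<chi> i. v (coord_fun \<kappa> i)) = w"
    by (simp add: vec_eq_iff coord_vec_coord_fun[OF assms(1,2)])
  with w show ?thesis by simp
qed

lemma coord_vec_expand:
  assumes "\<kappa> \<in> A" "p \<in> fst \<kappa>"
  shows "coord_vec A \<kappa> p w = (\<Sum>i\<in>UNIV. w $ i *\<^sub>T coord_vec A \<kappa> p (axis i 1))"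
proof -
  have z: "coord_vec A \<kappa> p 0 = 0"
    using coord_vec_linear(2)[OF assms, of 0 0] by simp
  have s: "coord_vec A \<kappa> p (\<Sum>i\<in>I. F i) = (\<Sum>i\<in>I. coord_vec A \<kappa> p (F i))" for I :: "'n set" and F
    by (induction I rule: infinite_finite_induct) (auto simp: z coord_vec_linear[OF assms])
  have "w = (\<Sum>i\<in>UNIV. w $ i *\<^sub>R axis i 1)"
    using basis_expansion[of w] by (simp add: scalar_mult_eq_scaleR)
  then have "coord_vec A \<kappa> p w = coord_vec A \<kappa> p (\<Sum>i\<in>UNIV. w $ i *\<^sub>R axis i 1)" by simp
  then show ?thesis by (simp add: s coord_vec_linear[OF assms])
qed

lemma tangent_expand:
  assumes "\<kappa> \<in> A" "p \<in> fst \<kappa>" "v \<in> tangent_space A p"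
  shows "v = (\<Sum>i\<in>UNIV. v (coord_fun \<kappa> i) *\<^sub>T coord_vec A \<kappa> p (axis i 1))"
  using tangent_expand_coord_vec[OF assms] coord_vec_expand[OF assms(1,2), of "\<chi> i. v (coord_fun \<kappa> i)"]
  by simp

end

section \<open>Vector fields, tensoriality and traces\<close>

definition coord_field ::
  "('m::topological_space, 'n::finite) chart set \<Rightarrow> ('m, 'n) chart \<Rightarrow> 'n \<Rightarrow> 'm field" where
  "coord_field A \<kappa> i = (\<lambda>q. coord_vec A \<kappa> q (axis i 1))"

context smooth_manifold
begin

lemma field_tangent: "X \<in> vector_fields A W \<Longrightarrow> p \<in> W \<Longrightarrow> X p \<in> tangent_space A p"
  unfolding vector_fields_def by blast

lemma field_smooth:
  "X \<in> vector_fields A W \<Longrightarrow> open V \<Longrightarrow> V \<subseteq> W \<Longrightarrow> smooth_fun A V f \<Longrightarrow> smooth_fun A V (\<lambda>p. X p f)"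
  unfolding vector_fields_def by blast

lemma fieldI:
  assumes "\<And>p. p \<in> W \<Longrightarrow> X p \<in> tangent_space A p"
    and "\<And>V f. open V \<Longrightarrow> V \<subseteq> W \<Longrightarrow> smooth_fun A V f \<Longrightarrow> smooth_fun A V (\<lambda>p. X p f)"
  shows "X \<in> vector_fields A W"
  using assms unfolding vector_fields_def by blast

lemma field_smooth_near:
  assumes "X \<in> vector_fields A W" "open W" "p \<in> W" "smooth_near A p f"
  shows "smooth_near A p (\<lambda>q. X q f)"
proof -
  obtain V where V: "open V" "p \<in> V" "smooth_fun A V f"
    using assms(4) unfolding smooth_near_def by blast
  have "smooth_fun A (V \<inter> W) (\<lambda>q. X q f)"
    by (rule field_smooth[OF assms(1) open_Int[OF V(1) assms(2)] Int_lower2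
        smooth_fun_subset[OF V(3) Int_lower1]])
  then show ?thesis
    using V assms(2,3) smooth_nearI[of "V \<inter> W"] by blast
qed

lemma field_subset:
  assumes "X \<in> vector_fields A W" "V \<subseteq> W"
  shows "X \<in> vector_fields A V"
proof (rule fieldI)
  show "X p \<in> tangent_space A p" if "p \<in> V" for p
    by (rule field_tangent[OF assms(1)]) (use that assms(2) in blast)
  show "smooth_fun A U (\<lambda>p. X p f)" if "open U" "U \<subseteq> V" "smooth_fun A U f" for U f
    by (rule field_smooth[OF assms(1) that(1) _ that(3)]) (use that assms(2) in blast)
qed

lemma field_cong:
  assumes "X \<in> vector_fields A W" "\<And>q. q \<in> W \<Longrightarrow> X q = Y q"
  shows "Y \<in> vector_fields A W"
proof (rule fieldI)
  show "Y p \<in> tangent_space A p" if "p \<in> W" for p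
    using field_tangent[OF assms(1) that] assms(2)[OF that] by simp
  show "smooth_fun A V (\<lambda>p. Y p f)" if "open V" "V \<subseteq> W" "smooth_fun A V f" for V f
    by (rule smooth_fun_cong[OF that(1) _ field_smooth[OF assms(1) that]]) (use assms(2) that in auto)
qed

lemma field_add:
  assumes "X \<in> vector_fields A W" "Y \<in> vector_fields A W"
  shows "(\<lambda>q. X q + Y q) \<in> vector_fields A W"
  by (rule fieldI)
    (simp_all add: tangent_add field_tangent[OF assms(1)] field_tangent[OF assms(2)]
      smooth_fun_add field_smooth[OF assms(1)] field_smooth[OF assms(2)])

lemma field_plus: "X \<in> vector_fields A W \<Longrightarrow> Y \<in> vector_fields A W \<Longrightarrow> X + Y \<in> vector_fields A W"
  using field_add[of X W Y] by (simp add: plus_fun_def)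

lemma field_scale:
  assumes "X \<in> vector_fields A W" "smooth_fun A W h"
  shows "(\<lambda>q. h q *\<^sub>T X q) \<in> vector_fields A W"
  by (rule fieldI)
    (simp_all add: tangent_scale field_tangent[OF assms(1)] smooth_fun_mult field_smooth[OF assms(1)]
      smooth_fun_subset[OF assms(2)])

lemma field_uminus: "X \<in> vector_fields A W \<Longrightarrow> (\<lambda>q. - X q) \<in> vector_fields A W"
  using field_scale[OF _ smooth_fun_const[of W "-1"]] by (simp add: uminus_scale_tvec)

lemma field_diff:
  assumes "X \<in> vector_fields A W" "Y \<in> vector_fields A W"
  shows "(\<lambda>q. X q - Y q) \<in> vector_fields A W"
  using field_add[OF assms(1) field_uminus[OF assms(2)]] by simp

lemma field_zero: "(\<lambda>q. 0) \<in> vector_fields A W"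
  by (rule fieldI) (simp_all add: tangent_zero smooth_fun_const)

lemma field_sum:
  "(\<And>i. i \<in> I \<Longrightarrow> F i \<in> vector_fields A W) \<Longrightarrow> (\<lambda>q. \<Sum>i\<in>I. F i q) \<in> vector_fields A W"
  by (induction I rule: infinite_finite_induct) (auto intro: field_add field_zero)

lemma coord_vec_field:
  assumes "\<kappa> \<in> A"
  shows "(\<lambda>q. coord_vec A \<kappa> q w) \<in> vector_fields A (fst \<kappa>)"
proof (rule fieldI)
  show "coord_vec A \<kappa> p w \<in> tangent_space A p" if "p \<in> fst \<kappa>" for p
    using coord_vec_tangent assms that by blast
  fix V f assume V: "open V" "V \<subseteq> fst \<kappa>" "smooth_fun A V f"
  show "smooth_fun A V (\<lambda>p. coord_vec A \<kappa> p w f)"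
  proof (rule smooth_fun_chart[OF assms V(1,2)])
    fix k
    have eq: "fst \<kappa> \<inter> V = V" using V(2) by blast
    have o: "open (snd \<kappa> ` V)" using chart_image_inter_open[OF assms V(1)] by (simp add: eq)
    \<comment> \<open>Applying the field costs one derivative, so order \<open>k\<close> of the
      result comes from order \<open>Suc k\<close> of \<open>f\<close>.\<close>
    have "Ck_on (Suc k) (snd \<kappa> ` V) (\<lambda>x. f (chart_inv \<kappa> x))"
      using smooth_funD[OF V(3) assms] eq by metis
    then have c: "Ck_on k (snd \<kappa> ` V) (\<lambda>x. frechet_derivative (\<lambda>x. f (chart_inv \<kappa> x)) (at x) w)"
      by simp
    show "Ck_on k (snd \<kappa> ` V) (\<lambda>x. coord_vec A \<kappa> (chart_inv \<kappa> x) w f)"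
    proof (rule Ck_on_cong[OF o _ c])
      fix x assume "x \<in> snd \<kappa> ` V"
      then obtain p where p: "p \<in> V" "x = snd \<kappa> p" by blast
      have pk: "p \<in> fst \<kappa>" using p V by blast
      have "smooth_near A p f" by (rule smooth_nearI[OF V(1) p(1) V(3)])
      then show "frechet_derivative (\<lambda>x. f (chart_inv \<kappa> x)) (at x) w
          = coord_vec A \<kappa> (chart_inv \<kappa> x) w f"
        by (simp add: p(2) chart_inv_chart[OF assms pk] coord_vec_apply)
    qed
  qed
qed

lemma coord_field_field: "\<kappa> \<in> A \<Longrightarrow> coord_field A \<kappa> i \<in> vector_fields A (fst \<kappa>)"
  unfolding coord_field_def by (rule coord_vec_field)

lemma coord_field_tangent: "\<kappa> \<in> A \<Longrightarrow> p \<in> fst \<kappa> \<Longrightarrow> coord_field A \<kappa> i p \<in> tangent_space A p"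
  unfolding coord_field_def by (rule coord_vec_tangent)

lemma coord_field_coord_fun:
  "\<kappa> \<in> A \<Longrightarrow> p \<in> fst \<kappa> \<Longrightarrow> coord_field A \<kappa> i p (coord_fun \<kappa> j) = (if i = j then 1 else 0)"
  by (simp add: coord_field_def coord_vec_coord_fun axis_def)

lemma coord_ext_field: "coord_ext A p v \<in> vector_fields A (fst (chart_at A p))"
  unfolding coord_ext_def by (rule coord_vec_field[OF chart_at(1)])

lemma coord_ext_self: "v \<in> tangent_space A p \<Longrightarrow> coord_ext A p v p = v"
  unfolding coord_ext_def by (rule tangent_expand_coord_vec[OF chart_at, symmetric])

lemma tangent_expand_field:
  assumes "\<kappa> \<in> A" "p \<in> fst \<kappa>" "v \<in> tangent_space A p"
  shows "v = (\<Sum>i\<in>UNIV. v (coord_fun \<kappa> i) *\<^sub>T coord_field A \<kappa> i p)"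
  using tangent_expand[OF assms] by (simp add: coord_field_def)

lemma tangent_expand_apply:
  assumes "\<kappa> \<in> A" "p \<in> fst \<kappa>" "v \<in> tangent_space A p"
  shows "v f = (\<Sum>i\<in>UNIV. v (coord_fun \<kappa> i) * coord_field A \<kappa> i p f)"
proof -
  have "v f = (\<Sum>i\<in>UNIV. v (coord_fun \<kappa> i) *\<^sub>T coord_field A \<kappa> i p) f"
    by (rule fun_cong[OF tangent_expand_field[OF assms]])
  then show ?thesis by (simp add: sum_fun_apply)
qed

text \<open>Functionals linear over smooth functions see only the value at \<open>p\<close>: on
  \<open>W\<close> a field is a combination of coordinate fields with smooth components. The
  assumption \<open>cong\<close> permits this replacement although the two may differ outside
  \<open>W\<close>.\<close>

lemma tensorial_expand:
  fixes Q :: "'m field \<Rightarrow> real"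
  assumes k: "\<kappa> \<in> A" "open W" "W \<subseteq> fst \<kappa>" "p \<in> W"
    and add: "\<And>X Y. X \<in> vector_fields A W \<Longrightarrow> Y \<in> vector_fields A W \<Longrightarrow> Q (X + Y) = Q X + Q Y"
    and scale: "\<And>h X. smooth_fun A W h \<Longrightarrow> X \<in> vector_fields A W \<Longrightarrow>
      Q (\<lambda>q. h q *\<^sub>T X q) = h p * Q X"
    and cong: "\<And>X Y. X \<in> vector_fields A W \<Longrightarrow> Y \<in> vector_fields A W \<Longrightarrow>
      (\<And>q. q \<in> W \<Longrightarrow> X q = Y q) \<Longrightarrow> Q X = Q Y"
    and X: "X \<in> vector_fields A W"
  shows "Q X = (\<Sum>i\<in>UNIV. X p (coord_fun \<kappa> i) * Q (coord_field A \<kappa> i))"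
proof -
  let ?h = "\<lambda>i q. X q (coord_fun \<kappa> i)"
  have E: "coord_field A \<kappa> i \<in> vector_fields A W" for i
    by (rule field_subset[OF coord_field_field[OF k(1)] k(3)])
  have h: "smooth_fun A W (?h i)" for i
    by (rule field_smooth[OF X k(2) order_refl smooth_fun_subset[OF smooth_fun_coord_fun[OF k(1)] k(3)]])
  have hE: "(\<lambda>q. ?h i q *\<^sub>T coord_field A \<kappa> i q) \<in> vector_fields A W" for i
    by (rule field_scale[OF E h])
  have z: "Q (\<lambda>q. 0) = 0"
    using scale[OF smooth_fun_const[of W 0] field_zero] by simp
  have s: "Q (\<lambda>q. \<Sum>i\<in>I. ?h i q *\<^sub>T coord_field A \<kappa> i q) = (\<Sum>i\<in>I. ?h i p * Q (coord_field A \<kappa> i))"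
    if "finite I" for I
    using that
  proof (induction I)
    case empty
    show ?case by (simp only: sum.empty z)
  next
    case (insert j I)
    have "Q (\<lambda>q. \<Sum>i\<in>insert j I. ?h i q *\<^sub>T coord_field A \<kappa> i q)
        = Q ((\<lambda>q. ?h j q *\<^sub>T coord_field A \<kappa> j q) + (\<lambda>q. \<Sum>i\<in>I. ?h i q *\<^sub>T coord_field A \<kappa> i q))"
      by (rule arg_cong[of _ _ Q]) (use insert.hyps in \<open>simp add: fun_eq_iff\<close>)
    also have "\<dots> = Q (\<lambda>q. ?h j q *\<^sub>T coord_field A \<kappa> j q) + Q (\<lambda>q. \<Sum>i\<in>I. ?h i q *\<^sub>T coord_field A \<kappa> i q)"
      by (rule add[OF hE field_sum[OF hE]])
    also have "\<dots> = ?h j p * Q (coord_field A \<kappa> j) + (\<Sum>i\<in>I. ?h i p * Q (coord_field A \<kappa> i))"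
      by (simp only: scale[OF h E] insert.IH)
    finally show ?case by (simp only: sum.insert[OF insert.hyps])
  qed
  have "Q X = Q (\<lambda>q. \<Sum>i\<in>UNIV. ?h i q *\<^sub>T coord_field A \<kappa> i q)"
  proof (rule cong[OF X field_sum[OF hE]])
    show "X q = (\<Sum>i\<in>UNIV. ?h i q *\<^sub>T coord_field A \<kappa> i q)" if "q \<in> W" for q
      by (rule tangent_expand_field[OF k(1) _ field_tangent[OF X that]]) (use that k(3) in blast)
  qed
  then show ?thesis by (simp only: s[OF finite])
qed

text \<open>Linearity is asked on the tangent space only, since tensors are unconstrained on the
  other functionals of type \<open>'m tvec\<close>.\<close>

definition linear_form :: "'m \<Rightarrow> ('m tvec \<Rightarrow> real) \<Rightarrow> bool" where
  "linear_form p \<alpha> \<longleftrightarrow>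
    (\<forall>u\<in>tangent_space A p. \<forall>v\<in>tangent_space A p. \<alpha> (u + v) = \<alpha> u + \<alpha> v) \<and>
    (\<forall>a. \<forall>v\<in>tangent_space A p. \<alpha> (a *\<^sub>T v) = a * \<alpha> v)"

lemma linear_formI:
  assumes "\<And>u v. u \<in> tangent_space A p \<Longrightarrow> v \<in> tangent_space A p \<Longrightarrow> \<alpha> (u + v) = \<alpha> u + \<alpha> v"
    and "\<And>a v. v \<in> tangent_space A p \<Longrightarrow> \<alpha> (a *\<^sub>T v) = a * \<alpha> v"
  shows "linear_form p \<alpha>"
  using assms unfolding linear_form_def by blast

lemma linear_form_expand:
  assumes "linear_form p \<alpha>" "\<kappa> \<in> A" "p \<in> fst \<kappa>" "v \<in> tangent_space A p"
  shows "\<alpha> v = (\<Sum>i\<in>UNIV. v (coord_fun \<kappa> i) * \<alpha> (coord_field A \<kappa> i p))"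
proof -
  have add: "\<alpha> (u + w) = \<alpha> u + \<alpha> w" if "u \<in> tangent_space A p" "w \<in> tangent_space A p" for u w
    using assms(1) that unfolding linear_form_def by blast
  have sc: "\<alpha> (a *\<^sub>T w) = a * \<alpha> w" if "w \<in> tangent_space A p" for a w
    using assms(1) that unfolding linear_form_def by blast
  have E: "coord_field A \<kappa> i p \<in> tangent_space A p" for i
    by (rule coord_field_tangent[OF assms(2,3)])
  have z: "\<alpha> 0 = 0" using sc[OF tangent_zero, of 0] by simp
  have "\<alpha> (\<Sum>i\<in>I. v (coord_fun \<kappa> i) *\<^sub>T coord_field A \<kappa> i p)
      = (\<Sum>i\<in>I. v (coord_fun \<kappa> i) * \<alpha> (coord_field A \<kappa> i p))" if "finite I" for I
    using that
  proof (induction I)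
    case empty
    show ?case by (simp only: sum.empty z)
  next
    case (insert j I)
    show ?case
      by (simp only: sum.insert[OF insert.hyps] add[OF tangent_scale[OF E] tangent_sum[OF tangent_scale[OF E]]]
          sc[OF E] insert.IH)
  qed
  from this[OF finite] have "\<alpha> (\<Sum>i\<in>UNIV. v (coord_fun \<kappa> i) *\<^sub>T coord_field A \<kappa> i p)
      = (\<Sum>i\<in>UNIV. v (coord_fun \<kappa> i) * \<alpha> (coord_field A \<kappa> i p))" .
  then show ?thesis by (simp only: tangent_expand_field[OF assms(2-4), symmetric])
qed

section \<open>Traces of endomorphisms of a tangent space\<close>

lemma trace_at_eq: "trace_at A p F = (\<Sum>i\<in>UNIV.
    F (coord_field A (chart_at A p) i p) (coord_fun (chart_at A p) i))"
  by (simp add: trace_at_def trace_def coord_field_def)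

text \<open>A base change: the frame of \<open>chart_at A p\<close> is expanded in that of \<kappa>,
  the sums are swapped, and the components are contracted back. Differentiating a trace requires one
  chart for all nearby points.\<close>

lemma trace_at_chart:
  assumes lin: "\<And>f. linear_form p (\<lambda>u. F u f)"
    and F: "\<And>u. u \<in> tangent_space A p \<Longrightarrow> F u \<in> tangent_space A p"
    and k: "\<kappa> \<in> A" "p \<in> fst \<kappa>"
  shows "trace_at A p F = (\<Sum>i\<in>UNIV. F (coord_field A \<kappa> i p) (coord_fun \<kappa> i))"
proof -
  let ?E = "\<lambda>i. coord_field A (chart_at A p) i p" and ?x = "coord_fun (chart_at A p)"
  let ?E' = "\<lambda>i. coord_field A \<kappa> i p" and ?y = "coord_fun \<kappa>"
  have E: "?E i \<in> tangent_space A p" for i by (rule coord_field_tangent[OF chart_at])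
  have E': "?E' i \<in> tangent_space A p" for i by (rule coord_field_tangent[OF k])
  have "trace_at A p F = (\<Sum>i\<in>UNIV. \<Sum>j\<in>UNIV. ?E i (?y j) * F (?E' j) (?x i))"
    unfolding trace_at_eq by (intro sum.cong refl linear_form_expand[OF lin k E])
  also have "\<dots> = (\<Sum>j\<in>UNIV. \<Sum>i\<in>UNIV. F (?E' j) (?x i) * ?E i (?y j))"
    by (subst sum.swap) (simp add: mult.commute)
  also have "\<dots> = (\<Sum>j\<in>UNIV. F (?E' j) (?y j))"
    by (intro sum.cong refl tangent_expand_apply[OF chart_at F[OF E'], symmetric])
  finally show ?thesis .
qed

lemma trace_at_cong:
  assumes "\<And>u. u \<in> tangent_space A p \<Longrightarrow> F u = G u"
  shows "trace_at A p F = trace_at A p G"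
  unfolding trace_at_eq by (simp add: assms coord_field_tangent[OF chart_at])

lemma trace_at_add: "trace_at A p (\<lambda>u. F u + G u) = trace_at A p F + trace_at A p G"
  by (simp add: trace_at_eq sum.distrib)

lemma trace_at_diff: "trace_at A p (\<lambda>u. F u - G u) = trace_at A p F - trace_at A p G"
  by (simp add: trace_at_eq sum_subtractf)

lemma trace_at_scale: "trace_at A p (\<lambda>u. a *\<^sub>T F u) = a * trace_at A p F"
  by (simp add: trace_at_eq sum_distrib_left)

lemma trace_at_id: "trace_at A p (\<lambda>u. u) = real CARD('n)"
  by (simp add: trace_at_eq coord_field_coord_fun[OF chart_at])

lemma trace_at_rank_one:
  assumes "linear_form p \<alpha>" "v \<in> tangent_space A p"
  shows "trace_at A p (\<lambda>u. \<alpha> u *\<^sub>T v) = \<alpha> v"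
  using linear_form_expand[OF assms(1) chart_at assms(2)] by (simp add: trace_at_eq mult.commute)

text \<open>Lie derivatives commute with traces: the terms in which the coordinate frame and its dual
  are differentiated cancel.\<close>

lemma lie_derivative_trace:
  assumes k: "\<kappa> \<in> A" "open W" "W \<subseteq> fst \<kappa>" "p \<in> W"
    and X: "X \<in> vector_fields A W" and Q: "\<And>i. Q i \<in> vector_fields A W"
  shows "X p (\<lambda>q. \<Sum>i\<in>UNIV. Q i q (coord_fun \<kappa> i)) =
    (\<Sum>i\<in>UNIV. lie_bracket A X (Q i) p (coord_fun \<kappa> i)
      - (\<Sum>j\<in>UNIV. lie_bracket A X (coord_field A \<kappa> i) p (coord_fun \<kappa> j) * Q j p (coord_fun \<kappa> i)))"
proof -
  let ?x = "coord_fun \<kappa>" and ?E = "coord_field A \<kappa>"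
  have pk: "p \<in> fst \<kappa>" using k by blast
  have sn: "smooth_near A p (?x i)" for i by (rule smooth_near_coord_fun[OF k(1) pk])
  have Xp: "X p \<in> tangent_space A p" by (rule field_tangent[OF X k(4)])
  have br: "lie_bracket A X (Q i) p (?x i) = X p (\<lambda>q. Q i q (?x i)) - Q i p (\<lambda>q. X q (?x i))" for i
    by (simp add: lie_bracket_def sn)
  \<comment> \<open>The components of the frame in its own chart are constant, so only the second
    half of its bracket with \<open>X\<close> survives.\<close>
  have "X p (\<lambda>q. ?E i q (?x j)) = 0" for i j
  proof -
    have "X p (\<lambda>q. ?E i q (?x j)) = X p (\<lambda>q. if i = j then 1 else 0)"
      by (rule tangent_fun_cong[OF Xp k(2,4)]) (use k(3) in \<open>auto simp: coord_field_coord_fun[OF k(1)]\<close>)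
    then show ?thesis using tangent_fun_const[OF Xp] by simp
  qed
  then have brE: "lie_bracket A X (?E i) p (?x j) = - ?E i p (\<lambda>q. X q (?x j))" for i j
    by (simp add: lie_bracket_def sn)
  have QX: "Q i p (\<lambda>q. X q (?x i)) = (\<Sum>j\<in>UNIV. Q i p (?x j) * ?E j p (\<lambda>q. X q (?x i)))" for i
    by (rule tangent_expand_apply[OF k(1) pk field_tangent[OF Q k(4)]])
  have "X p (\<lambda>q. \<Sum>i\<in>UNIV. Q i q (?x i)) = (\<Sum>i\<in>UNIV. X p (\<lambda>q. Q i q (?x i)))"
    using tangent_fun_sum[OF Xp, of UNIV "\<lambda>i q. Q i q (?x i)"] field_smooth_near[OF Q k(2,4) sn] by simp
  also have "\<dots> = (\<Sum>i\<in>UNIV. lie_bracket A X (Q i) p (?x i))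
      + (\<Sum>i\<in>UNIV. \<Sum>j\<in>UNIV. Q i p (?x j) * ?E j p (\<lambda>q. X q (?x i)))"
    by (simp add: br QX[symmetric] sum.distrib[symmetric])
  also have "(\<Sum>i\<in>UNIV. \<Sum>j\<in>UNIV. Q i p (?x j) * ?E j p (\<lambda>q. X q (?x i)))
      = (\<Sum>j\<in>UNIV. \<Sum>i\<in>UNIV. Q i p (?x j) * ?E j p (\<lambda>q. X q (?x i)))"
    by (rule sum.swap)
  finally show ?thesis
    by (simp add: brE sum.distrib sum_negf mult.commute)
qed

end

section \<open>The curvature of a Levi-Civita connection\<close>

text \<open>The nested bracket as iterated derivatives of \<open>f\<close>, a form in which the
  Jacobi identity is mere cancellation.\<close>

lemma (in smooth_manifold) lie_bracket_lie_bracket: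
  assumes "open W" "p \<in> W" "X \<in> vector_fields A W" "Y \<in> vector_fields A W" "Z \<in> vector_fields A W"
    and f: "smooth_near A p f"
  shows "lie_bracket A X (lie_bracket A Y Z) p f =
    X p (\<lambda>q. Y q (\<lambda>r. Z r f)) - X p (\<lambda>q. Z q (\<lambda>r. Y r f))
    - Y p (\<lambda>q. Z q (\<lambda>r. X r f)) + Z p (\<lambda>q. Y q (\<lambda>r. X r f))"
proof -
  obtain V where V: "open V" "p \<in> V" "smooth_fun A V f"
    using f unfolding smooth_near_def by blast
  note t = field_tangent[OF assms(3,2)]
  note s = field_smooth_near[OF _ assms(1,2)]
  \<comment> \<open>The inner bracket is 0 by convention on functions that are not smooth, so it may
    be unfolded only on the neighbourhood \<open>V\<close> where \<open>f\<close> is smooth.\<close>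
  have "X p (\<lambda>q. lie_bracket A Y Z q f) = X p (\<lambda>q. Y q (\<lambda>r. Z r f) - Z q (\<lambda>r. Y r f))"
    by (rule tangent_fun_cong[OF t V(1,2)]) (simp add: lie_bracket_def smooth_nearI[OF V(1) _ V(3)])
  also have "\<dots> = X p (\<lambda>q. Y q (\<lambda>r. Z r f)) - X p (\<lambda>q. Z q (\<lambda>r. Y r f))"
    by (rule tangent_fun_diff[OF t s[OF assms(4) s[OF assms(5) f]] s[OF assms(5) s[OF assms(4) f]]])
  finally show ?thesis
    by (simp add: lie_bracket_def s[OF assms(3) f] f)
qed

section \<open>Pointwise rules for affine connections\<close>

context affine_connection
begin

context
  fixes W :: "'m set" and p :: 'm
  assumes W: "open W" and p: "p \<in> W"
begin

lemma conn_tangent: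
  "X \<in> vector_fields A W \<Longrightarrow> Y \<in> vector_fields A W \<Longrightarrow> D X Y p \<in> tangent_space A p"
  by (rule field_tangent[OF conn_field[OF W] p])

lemma conn_cong_right:
  assumes "X \<in> vector_fields A W" "Y \<in> vector_fields A W" "\<And>q. q \<in> W \<Longrightarrow> Y q = Y' q"
  shows "D X Y p = D X Y' p"
  by (rule conn_local[OF W assms(1,2) assms(1) field_cong[OF assms(2,3)] _ p]) (simp_all add: assms(3))

lemma conn_cong_left:
  assumes "X \<in> vector_fields A W" "Y \<in> vector_fields A W" "\<And>q. q \<in> W \<Longrightarrow> X q = X' q"
  shows "D X Y p = D X' Y p"
  by (rule conn_local[OF W assms(1,2) field_cong[OF assms(1,3)] assms(2) _ p]) (simp_all add: assms(3))

lemma conn_sum_right: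
  assumes "X \<in> vector_fields A W" "Y \<in> vector_fields A W" "Z \<in> vector_fields A W"
  shows "D X (\<lambda>q. Y q + Z q) p = D X Y p + D X Z p"
proof -
  have "(\<lambda>q. Y q + Z q) = Y + Z" by (simp add: fun_eq_iff)
  then show ?thesis by (simp only: conn_add_right[OF W assms p])
qed

lemma conn_sum_left:
  assumes "X \<in> vector_fields A W" "Y \<in> vector_fields A W" "Z \<in> vector_fields A W"
  shows "D (\<lambda>q. X q + Y q) Z p = D X Z p + D Y Z p"
proof -
  have "(\<lambda>q. X q + Y q) = X + Y" by (simp add: fun_eq_iff)
  then show ?thesis by (simp only: conn_add_left[OF W assms p])
qed

lemma conn_uminus_right:
  assumes "X \<in> vector_fields A W" "Y \<in> vector_fields A W"
  shows "D X (\<lambda>q. - Y q) p = - D X Y p"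
  using conn_leibniz[OF W smooth_fun_const assms p, of "-1"] tangent_fun_const[OF field_tangent[OF assms(1) p]]
  by (simp add: uminus_scale_tvec)

lemma conn_diff_right:
  assumes "X \<in> vector_fields A W" "Y \<in> vector_fields A W" "Z \<in> vector_fields A W"
  shows "D X (\<lambda>q. Y q - Z q) p = D X Y p - D X Z p"
  using conn_sum_right[OF assms(1,2) field_uminus[OF assms(3)]] conn_uminus_right[OF assms(1,3)] by simp

lemma conn_uminus_left:
  assumes "X \<in> vector_fields A W" "Y \<in> vector_fields A W"
  shows "D (\<lambda>q. - X q) Y p = - D X Y p"
  using conn_scale_left[OF W smooth_fun_const assms p, of "-1"] by (simp add: uminus_scale_tvec)

lemma conn_diff_left:
  assumes "X \<in> vector_fields A W" "Y \<in> vector_fields A W" "Z \<in> vector_fields A W"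
  shows "D (\<lambda>q. X q - Y q) Z p = D X Z p - D Y Z p"
  using conn_sum_left[OF assms(1) field_uminus[OF assms(2)] assms(3)] conn_uminus_left[OF assms(2,3)] by simp

end

end

context levi_civita
begin

text \<open>Torsion-freeness presents the bracket on \<open>W\<close> as a difference of two
  covariant derivatives, which are fields by assumption; no computation in coordinates is
  involved.\<close>

lemma lie_bracket_field:
  assumes "open W" "X \<in> vector_fields A W" "Y \<in> vector_fields A W"
  shows "lie_bracket A X Y \<in> vector_fields A W"
  by (rule field_cong[OF field_diff[OF conn_field[OF assms] conn_field[OF assms(1,3,2)]] torsion_free[OF assms]])

lemma curvature_field:
  assumes "open W" "X \<in> vector_fields A W" "Y \<in> vector_fields A W" "Z \<in> vector_fields A W"
  shows "curvature A D X Y Z \<in> vector_fields A W"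
  by (rule field_cong[OF field_diff[OF field_diff[OF
        conn_field[OF assms(1,2) conn_field[OF assms(1,3,4)]] conn_field[OF assms(1,3) conn_field[OF assms(1,2,4)]]]
        conn_field[OF assms(1) lie_bracket_field[OF assms(1-3)] assms(4)]]])
    (simp add: curvature_def)

section \<open>Linearity of the curvature and the first Bianchi identity\<close>

context
  fixes W :: "'m set" and p :: 'm
  assumes W: "open W" and p: "p \<in> W"
begin

lemma conn_lie_bracket_left:
  assumes "X \<in> vector_fields A W" "Y \<in> vector_fields A W" "Z \<in> vector_fields A W"
  shows "D (lie_bracket A X Y) Z p = D (D X Y) Z p - D (D Y X) Z p"
proof -
  have "D (lie_bracket A X Y) Z p = D (\<lambda>q. D X Y q - D Y X q) Z p"
    by (rule conn_cong_left[OF W p lie_bracket_field[OF W assms(1,2)] assms(3)])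
      (simp add: torsion_free[OF W assms(1,2)])
  then show ?thesis
    using conn_diff_left[OF W p conn_field[OF W assms(1,2)] conn_field[OF W assms(2,1)] assms(3)] by simp
qed

text \<open>With the bracket eliminated by torsion-freeness, locality and linearity in the first
  slot reduce to the axioms of a connection.\<close>

lemma curvature_eq:
  assumes "X \<in> vector_fields A W" "Y \<in> vector_fields A W" "Z \<in> vector_fields A W"
  shows "curvature A D X Y Z p
    = D X (D Y Z) p - D Y (D X Z) p - (D (D X Y) Z p - D (D Y X) Z p)"
  by (simp add: curvature_def conn_lie_bracket_left[OF assms])

lemma curvature_antisym:
  assumes "X \<in> vector_fields A W" "Y \<in> vector_fields A W" "Z \<in> vector_fields A W"
  shows "curvature A D X Y Z p = - curvature A D Y X Z p"
  by (simp add: curvature_eq assms)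

lemma curvature_add_first:
  assumes "X \<in> vector_fields A W" "X' \<in> vector_fields A W" "Y \<in> vector_fields A W" "Z \<in> vector_fields A W"
  shows "curvature A D (X + X') Y Z p = curvature A D X Y Z p + curvature A D X' Y Z p"
proof -
  note f = assms field_plus[OF assms(1,2)] conn_field[OF W]
  have 1: "D (X + X') (D Y Z) p = D X (D Y Z) p + D X' (D Y Z) p"
    by (intro conn_add_left[OF W _ _ _ p] f)
  have "D Y (D (X + X') Z) p = D Y (\<lambda>q. D X Z q + D X' Z q) p"
    by (intro conn_cong_right[OF W p] conn_add_left[OF W] f)
  also have "\<dots> = D Y (D X Z) p + D Y (D X' Z) p"
    by (intro conn_sum_right[OF W p] f)
  finally have 2: "D Y (D (X + X') Z) p = D Y (D X Z) p + D Y (D X' Z) p" .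
  have "D (D (X + X') Y) Z p = D (\<lambda>q. D X Y q + D X' Y q) Z p"
    by (intro conn_cong_left[OF W p] conn_add_left[OF W] f)
  also have "\<dots> = D (D X Y) Z p + D (D X' Y) Z p"
    by (intro conn_sum_left[OF W p] f)
  finally have 3: "D (D (X + X') Y) Z p = D (D X Y) Z p + D (D X' Y) Z p" .
  have "D (D Y (X + X')) Z p = D (\<lambda>q. D Y X q + D Y X' q) Z p"
    by (intro conn_cong_left[OF W p] conn_add_right[OF W] f)
  also have "\<dots> = D (D Y X) Z p + D (D Y X') Z p"
    by (intro conn_sum_left[OF W p] f)
  finally have 4: "D (D Y (X + X')) Z p = D (D Y X) Z p + D (D Y X') Z p" .
  show ?thesis by (simp add: curvature_eq f 1 2 3 4)
qed

text \<open>The derivative of \<open>h\<close> enters twice, as \<open>Y p h\<close> times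
  \<open>D X Z p\<close>: from differentiating \<open>D ?hX Z\<close> and from
  \<open>D (D Y ?hX) Z\<close>. The two contributions cancel.\<close>

lemma curvature_scale_first:
  assumes "smooth_fun A W h" "X \<in> vector_fields A W" "Y \<in> vector_fields A W" "Z \<in> vector_fields A W"
  shows "curvature A D (\<lambda>q. h q *\<^sub>T X q) Y Z p = h p *\<^sub>T curvature A D X Y Z p"
proof -
  let ?hX = "\<lambda>q. h q *\<^sub>T X q"
  note hX = field_scale[OF assms(2,1)]
  note f = assms hX conn_field[OF W]
  note Yh = field_smooth[OF assms(3) W order_refl assms(1)]
  have 1: "D ?hX (D Y Z) p = h p *\<^sub>T D X (D Y Z) p"
    by (intro conn_scale_left[OF W _ _ _ p] f)
  have "D Y (D ?hX Z) p = D Y (\<lambda>q. h q *\<^sub>T D X Z q) p"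
    by (intro conn_cong_right[OF W p] conn_scale_left[OF W] f)
  also have "\<dots> = Y p h *\<^sub>T D X Z p + h p *\<^sub>T D Y (D X Z) p"
    by (intro conn_leibniz[OF W _ _ _ p] f)
  finally have 2: "D Y (D ?hX Z) p = Y p h *\<^sub>T D X Z p + h p *\<^sub>T D Y (D X Z) p" .
  have "D (D ?hX Y) Z p = D (\<lambda>q. h q *\<^sub>T D X Y q) Z p"
    by (intro conn_cong_left[OF W p] conn_scale_left[OF W] f)
  also have "\<dots> = h p *\<^sub>T D (D X Y) Z p"
    by (intro conn_scale_left[OF W _ _ _ p] f)
  finally have 3: "D (D ?hX Y) Z p = h p *\<^sub>T D (D X Y) Z p" .
  have "D (D Y ?hX) Z p = D (\<lambda>q. Y q h *\<^sub>T X q + h q *\<^sub>T D Y X q) Z p"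
    by (intro conn_cong_left[OF W p] conn_leibniz[OF W] f)
  also have "\<dots> = D (\<lambda>q. Y q h *\<^sub>T X q) Z p + D (\<lambda>q. h q *\<^sub>T D Y X q) Z p"
    by (intro conn_sum_left[OF W p] field_scale Yh f)
  also have "\<dots> = Y p h *\<^sub>T D X Z p + h p *\<^sub>T D (D Y X) Z p"
    by (intro arg_cong2[of _ _ _ _ "(+)"] conn_scale_left[OF W _ _ _ p] Yh f)
  finally have 4: "D (D Y ?hX) Z p = Y p h *\<^sub>T D X Z p + h p *\<^sub>T D (D Y X) Z p" .
  show ?thesis
    by (rule ext) (simp add: curvature_eq f 1 2 3 4 algebra_simps)
qed

lemma curvature_add_third:
  assumes "X \<in> vector_fields A W" "Y \<in> vector_fields A W" "Z \<in> vector_fields A W" "Z' \<in> vector_fields A W"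
  shows "curvature A D X Y (Z + Z') p = curvature A D X Y Z p + curvature A D X Y Z' p"
proof -
  note f = assms field_plus[OF assms(3,4)] conn_field[OF W]
  have t: "D U (D V (Z + Z')) p = D U (D V Z) p + D U (D V Z') p"
    if "U \<in> vector_fields A W" "V \<in> vector_fields A W" for U V
  proof -
    have "D U (D V (Z + Z')) p = D U (\<lambda>q. D V Z q + D V Z' q) p"
      by (intro conn_cong_right[OF W p] conn_add_right[OF W] f that)
    also have "\<dots> = D U (D V Z) p + D U (D V Z') p"
      by (intro conn_sum_right[OF W p] f that)
    finally show ?thesis .
  qed
  have s: "D U (Z + Z') p = D U Z p + D U Z' p" if "U \<in> vector_fields A W" for U
    by (intro conn_add_right[OF W _ _ _ p] f that)
  show ?thesis by (simp add: curvature_eq f t s)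
qed

text \<open>The mixed first-order terms are symmetric in \<open>X\<close> and \<open>Y\<close>. The
  second derivatives of \<open>h\<close> combine to the bracket applied to \<open>h\<close>, which
  the last term of the curvature removes; hence the bracket is kept here.\<close>

lemma curvature_scale_third:
  assumes "smooth_fun A W h" "X \<in> vector_fields A W" "Y \<in> vector_fields A W" "Z \<in> vector_fields A W"
  shows "curvature A D X Y (\<lambda>q. h q *\<^sub>T Z q) p = h p *\<^sub>T curvature A D X Y Z p"
proof -
  let ?hZ = "\<lambda>q. h q *\<^sub>T Z q"
  note f = assms(2-4) field_scale[OF assms(4,1)] conn_field[OF W]
  note sm = field_smooth[OF _ W order_refl assms(1)]
  have t: "D U (D V ?hZ) p = U p (\<lambda>q. V q h) *\<^sub>T Z p + V p h *\<^sub>T D U Z p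
      + (U p h *\<^sub>T D V Z p + h p *\<^sub>T D U (D V Z) p)"
    if UV: "U \<in> vector_fields A W" "V \<in> vector_fields A W" for U V
  proof -
    have "D U (D V ?hZ) p = D U (\<lambda>q. V q h *\<^sub>T Z q + h q *\<^sub>T D V Z q) p"
      by (intro conn_cong_right[OF W p] conn_leibniz[OF W] f assms(1) that)
    also have "\<dots> = D U (\<lambda>q. V q h *\<^sub>T Z q) p + D U (\<lambda>q. h q *\<^sub>T D V Z q) p"
      by (intro conn_sum_right[OF W p] field_scale sm f assms(1) that)
    also have "\<dots> = U p (\<lambda>q. V q h) *\<^sub>T Z p + V p h *\<^sub>T D U Z p
      + (U p h *\<^sub>T D V Z p + h p *\<^sub>T D U (D V Z) p)"
      by (intro arg_cong2[of _ _ _ _ "(+)"] conn_leibniz[OF W _ _ _ p] sm f assms(1) that)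
    finally show ?thesis .
  qed
  have "lie_bracket A X Y p h = X p (\<lambda>q. Y q h) - Y p (\<lambda>q. X q h)"
    using smooth_nearI[OF W p assms(1)] by (simp add: lie_bracket_def)
  then have s: "D (lie_bracket A X Y) ?hZ p = (X p (\<lambda>q. Y q h) - Y p (\<lambda>q. X q h)) *\<^sub>T Z p
      + h p *\<^sub>T D (lie_bracket A X Y) Z p"
    using conn_leibniz[OF W assms(1) lie_bracket_field[OF W assms(2,3)] assms(4) p] by simp
  show ?thesis
    by (rule ext) (simp add: curvature_def s t[OF assms(2,3)] t[OF assms(3,2)] algebra_simps)
qed

lemma curvature_cong:
  assumes "X \<in> vector_fields A W" "Y \<in> vector_fields A W" "Z \<in> vector_fields A W"
    and eq: "\<And>q. q \<in> W \<Longrightarrow> X q = X' q" "\<And>q. q \<in> W \<Longrightarrow> Y q = Y' q" "\<And>q. q \<in> W \<Longrightarrow> Z q = Z' q"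
  shows "curvature A D X Y Z p = curvature A D X' Y' Z' p"
proof -
  note f = assms(1-3) field_cong[OF assms(1) eq(1)] field_cong[OF assms(2) eq(2)]
    field_cong[OF assms(3) eq(3)]
  have c: "D U V q = D U' V' q" if "U \<in> vector_fields A W" "V \<in> vector_fields A W"
    "\<And>q. q \<in> W \<Longrightarrow> U q = U' q" "\<And>q. q \<in> W \<Longrightarrow> V q = V' q" "q \<in> W" for U V U' V' q
    by (rule conn_local[OF W that(1,2) field_cong[OF that(1,3)] field_cong[OF that(2,4)] _ that(5)])
      (simp_all add: that(3,4))
  have "D X (D Y Z) p = D X' (D Y' Z') p" "D Y (D X Z) p = D Y' (D X' Z') p"
    "D (D X Y) Z p = D (D X' Y') Z' p" "D (D Y X) Z p = D (D Y' X') Z' p"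
    by (intro c f conn_field[OF W] eq p; assumption)+
  then show ?thesis by (simp add: curvature_eq f)
qed

text \<open>Regrouping the cyclic sum and using torsion-freeness twice turns each pair of second
  covariant derivatives into a double bracket plus a term that the curvature subtracts. What is left
  is the Jacobi identity.\<close>

lemma bianchi_first:
  assumes X: "X \<in> vector_fields A W" and Y: "Y \<in> vector_fields A W" and Z: "Z \<in> vector_fields A W"
  shows "curvature A D X Y Z p + curvature A D Y Z X p + curvature A D Z X Y p = 0"
proof -
  have c: "D U (D V T) p - D U (D T V) p = lie_bracket A U (lie_bracket A V T) p + D (lie_bracket A V T) U p"
    if f: "U \<in> vector_fields A W" "V \<in> vector_fields A W" "T \<in> vector_fields A W" for U V T
  proof -
    have "D U (D V T) p - D U (D T V) p = D U (\<lambda>q. D V T q - D T V q) p"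
      by (rule conn_diff_right[OF W p, symmetric]) (intro conn_field[OF W] f)+
    also have "\<dots> = D U (lie_bracket A V T) p"
      by (rule conn_cong_right[OF W p f(1) field_diff[OF conn_field[OF W f(2,3)] conn_field[OF W f(3,2)]]])
        (rule torsion_free[OF W f(2,3)])
    finally show ?thesis
      using torsion_free[OF W f(1) lie_bracket_field[OF W f(2,3)] p] by (simp add: algebra_simps)
  qed
  have br: "lie_bracket A U V p f = 0" if "\<not> smooth_near A p f" for U V f
    by (simp add: lie_bracket_def that)
  show ?thesis
  proof
    fix f
    have j: "lie_bracket A X (lie_bracket A Y Z) p f + lie_bracket A Y (lie_bracket A Z X) p f
        + lie_bracket A Z (lie_bracket A X Y) p f = 0"
      by (cases "smooth_near A p f") (simp_all add: br lie_bracket_lie_bracket[OF W p] X Y Z)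
    have c': "D U (D V T) p f = D U (D T V) p f + lie_bracket A U (lie_bracket A V T) p f
        + D (lie_bracket A V T) U p f"
      if f: "U \<in> vector_fields A W" "V \<in> vector_fields A W" "T \<in> vector_fields A W" for U V T
      using fun_cong[OF c[OF f], of f] by simp
    show "(curvature A D X Y Z p + curvature A D Y Z X p + curvature A D Z X Y p) f = 0 f"
      using j c'[OF X Y Z] c'[OF Y Z X] c'[OF Z X Y] by (simp add: curvature_def)
  qed
qed

lemma metric_second_derivative:
  assumes X: "X \<in> vector_fields A W" and Y: "Y \<in> vector_fields A W"
    and Z: "Z \<in> vector_fields A W" and U: "U \<in> vector_fields A W"
  shows "X p (\<lambda>q. Y q (\<lambda>r. g r (Z r) (U r))) =
    g p (D X (D Y Z) p) (U p) + g p (D Y Z p) (D X U p)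
    + (g p (D X Z p) (D Y U p) + g p (Z p) (D X (D Y U) p))"
proof -
  note f = conn_field[OF W] X Y Z U
  have sm: "smooth_near A p (\<lambda>q. g q (V q) (V' q))"
    if "V \<in> vector_fields A W" "V' \<in> vector_fields A W" for V V'
    by (rule smooth_nearI[OF W p metric_smooth[OF W that]])
  have "X p (\<lambda>q. Y q (\<lambda>r. g r (Z r) (U r)))
      = X p (\<lambda>q. g q (D Y Z q) (U q) + g q (Z q) (D Y U q))"
    by (rule tangent_fun_cong[OF field_tangent[OF X p] W p metric_compatible[OF W Y Z U]])
  also have "\<dots> = X p (\<lambda>q. g q (D Y Z q) (U q)) + X p (\<lambda>q. g q (Z q) (D Y U q))"
    by (rule tangent_fun_add[OF field_tangent[OF X p]]) (intro sm f)+
  also have "\<dots> = g p (D X (D Y Z) p) (U p) + g p (D Y Z p) (D X U p)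
    + (g p (D X Z p) (D Y U p) + g p (Z p) (D X (D Y U) p))"
    by (intro arg_cong2[of _ _ _ _ "(+)"] metric_compatible[OF W _ _ _ p] f)
  finally show ?thesis .
qed

end

section \<open>Bilinearity of the metric and skewness of the curvature\<close>

lemma metric_add_right:
  "u \<in> tangent_space A p \<Longrightarrow> v \<in> tangent_space A p \<Longrightarrow> w \<in> tangent_space A p \<Longrightarrow>
    g p w (u + v) = g p w u + g p w v"
  using metric_add[of u p v w] by (simp add: metric_sym[of w] tangent_add)

lemma metric_scale_right:
  "u \<in> tangent_space A p \<Longrightarrow> v \<in> tangent_space A p \<Longrightarrow> g p v (a *\<^sub>T u) = a * g p v u"
  using metric_scale[of u p v a] by (simp add: metric_sym[of v] tangent_scale)

lemma metric_uminus: "u \<in> tangent_space A p \<Longrightarrow> v \<in> tangent_space A p \<Longrightarrow> g p (- u) v = - g p u v"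
  by (simp add: uminus_scale_tvec metric_scale)

lemma metric_uminus_right: "u \<in> tangent_space A p \<Longrightarrow> v \<in> tangent_space A p \<Longrightarrow> g p v (- u) = - g p v u"
  by (simp add: uminus_scale_tvec metric_scale_right)

lemma metric_diff:
  "u \<in> tangent_space A p \<Longrightarrow> v \<in> tangent_space A p \<Longrightarrow> w \<in> tangent_space A p \<Longrightarrow>
    g p (u - v) w = g p u w - g p v w"
  using metric_add[of u p "- v" w] by (simp add: metric_uminus tangent_uminus)

lemma metric_diff_right:
  "u \<in> tangent_space A p \<Longrightarrow> v \<in> tangent_space A p \<Longrightarrow> w \<in> tangent_space A p \<Longrightarrow>
    g p w (u - v) = g p w u - g p w v"
  using metric_add_right[of u p "- v" w] by (simp add: metric_uminus_right tangent_uminus)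

lemma metric_eqI:
  assumes "u \<in> tangent_space A p" "v \<in> tangent_space A p"
    and "\<And>w. w \<in> tangent_space A p \<Longrightarrow> g p u w = g p v w"
  shows "u = v"
proof (rule ccontr)
  assume "u \<noteq> v"
  then have "g p (u - v) (u - v) > 0" using assms(1,2) by (intro metric_pos) (auto intro: tangent_diff)
  then show False using assms by (simp add: metric_diff tangent_diff)
qed

text \<open>The bracket of \<open>X\<close> and \<open>Y\<close>, applied to the function g(Z, U),
  is the commutator of two derivatives. Metric compatibility expands all three expressions, and the
  mixed products cancel by symmetry.\<close>

lemma curvature_skew:
  assumes "open W" "p \<in> W" "X \<in> vector_fields A W" "Y \<in> vector_fields A W"
    "Z \<in> vector_fields A W" "U \<in> vector_fields A W"
  shows "g p (curvature A D X Y Z p) (U p) = - g p (Z p) (curvature A D X Y U p)"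
proof -
  note W = assms(1) and p = assms(2) and f = assms(3-6) conn_field[OF assms(1)] lie_bracket_field[OF assms(1)]
  note t = field_tangent[OF _ p]
  have s: "smooth_near A p (\<lambda>r. g r (Z r) (U r))"
    by (rule smooth_nearI[OF W p metric_smooth[OF W f(3,4)]])
  have "lie_bracket A X Y p (\<lambda>r. g r (Z r) (U r))
      = X p (\<lambda>q. Y q (\<lambda>r. g r (Z r) (U r))) - Y p (\<lambda>q. X q (\<lambda>r. g r (Z r) (U r)))"
    by (simp add: lie_bracket_def s)
  moreover have "lie_bracket A X Y p (\<lambda>r. g r (Z r) (U r))
      = g p (D (lie_bracket A X Y) Z p) (U p) + g p (Z p) (D (lie_bracket A X Y) U p)"
    by (intro metric_compatible[OF W _ _ _ p] f)
  ultimately show ?thesis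
    by (simp add: metric_second_derivative[OF W p] curvature_def f t metric_diff metric_diff_right tangent_diff)
qed

text \<open>Evaluated at a fixed \<open>f\<close>, on the part of \<open>W\<close> inside one chart,
  the curvature is a functional to which \<open>tensorial_expand\<close> applies.\<close>

lemma curvature_cong_point_first:
  assumes W: "open W" "p \<in> W" and f: "X \<in> vector_fields A W" "X' \<in> vector_fields A W"
      "Y \<in> vector_fields A W" "Z \<in> vector_fields A W" and eq: "X p = X' p"
  shows "curvature A D X Y Z p = curvature A D X' Y Z p"
proof
  fix f
  let ?\<kappa> = "chart_at A p"
  let ?V = "W \<inter> fst ?\<kappa>"
  have V: "open ?V" "p \<in> ?V" "?V \<subseteq> fst ?\<kappa>" using W chart_at(2)[of p] open_Int[OF W(1) chart_open[OF chart_at(1)[of p]]] by auto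
  note g = f[THEN field_subset[OF _ Int_lower1[of W "fst ?\<kappa>"]]]
  have "curvature A D U Y Z p f
      = (\<Sum>i\<in>UNIV. U p (coord_fun ?\<kappa> i) * curvature A D (coord_field A ?\<kappa> i) Y Z p f)"
    if U: "U \<in> vector_fields A ?V" for U
  proof (rule tensorial_expand[OF chart_at(1) V(1,3,2) _ _ _ U])
    show "curvature A D X Y Z p f = curvature A D X' Y Z p f"
      if "X \<in> vector_fields A ?V" "X' \<in> vector_fields A ?V" "\<And>q. q \<in> ?V \<Longrightarrow> X q = X' q" for X X'
      by (rule fun_cong[OF curvature_cong[OF V(1,2) that(1) g(3,4) that(3) refl refl]])
    show "curvature A D (X + X') Y Z p f = curvature A D X Y Z p f + curvature A D X' Y Z p f"
      if "X \<in> vector_fields A ?V" "X' \<in> vector_fields A ?V" for X X'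
      by (simp only: curvature_add_first[OF V(1,2) that g(3,4)] plus_fun_apply)
    show "curvature A D (\<lambda>q. h q *\<^sub>T X q) Y Z p f = h p * curvature A D X Y Z p f"
      if "smooth_fun A ?V h" "X \<in> vector_fields A ?V" for h X
      by (simp only: curvature_scale_first[OF V(1,2) that g(3,4)] scale_tvec_apply)
  qed
  then show "curvature A D X Y Z p f = curvature A D X' Y Z p f"
    using g(1,2) eq by simp
qed

lemma curvature_cong_point_third:
  assumes W: "open W" "p \<in> W" and f: "Z \<in> vector_fields A W" "Z' \<in> vector_fields A W"
      "X \<in> vector_fields A W" "Y \<in> vector_fields A W" and eq: "Z p = Z' p"
  shows "curvature A D X Y Z p = curvature A D X Y Z' p"
proof
  fix f
  let ?\<kappa> = "chart_at A p"
  let ?V = "W \<inter> fst ?\<kappa>"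
  have V: "open ?V" "p \<in> ?V" "?V \<subseteq> fst ?\<kappa>" using W chart_at(2)[of p] open_Int[OF W(1) chart_open[OF chart_at(1)[of p]]] by auto
  note g = f[THEN field_subset[OF _ Int_lower1[of W "fst ?\<kappa>"]]]
  have "curvature A D X Y U p f
      = (\<Sum>i\<in>UNIV. U p (coord_fun ?\<kappa> i) * curvature A D X Y (coord_field A ?\<kappa> i) p f)"
    if U: "U \<in> vector_fields A ?V" for U
  proof (rule tensorial_expand[OF chart_at(1) V(1,3,2) _ _ _ U])
    show "curvature A D X Y Z p f = curvature A D X Y Z' p f"
      if "Z \<in> vector_fields A ?V" "Z' \<in> vector_fields A ?V" "\<And>q. q \<in> ?V \<Longrightarrow> Z q = Z' q" for Z Z'
      by (rule fun_cong[OF curvature_cong[OF V(1,2) g(3,4) that(1) refl refl that(3)]])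
    show "curvature A D X Y (Z + Z') p f = curvature A D X Y Z p f + curvature A D X Y Z' p f"
      if "Z \<in> vector_fields A ?V" "Z' \<in> vector_fields A ?V" for Z Z'
      by (simp only: curvature_add_third[OF V(1,2) g(3,4) that] plus_fun_apply)
    show "curvature A D X Y (\<lambda>q. h q *\<^sub>T Z q) p f = h p * curvature A D X Y Z p f"
      if "smooth_fun A ?V h" "Z \<in> vector_fields A ?V" for h Z
      by (simp only: curvature_scale_third[OF V(1,2) that(1) g(3,4) that(2)] scale_tvec_apply)
  qed
  then show "curvature A D X Y Z p f = curvature A D X Y Z' p f"
    using g(1,2) eq by simp
qed

text \<open>The extensions are exchanged slot by slot; the second slot is moved to the first by
  antisymmetry. This frees the curvature from fields with constant components, a class that brackets
  with \<xi> do not preserve.\<close>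

lemma curvature_at_eq:
  assumes W: "open W" "p \<in> W" and f: "X \<in> vector_fields A W" "Y \<in> vector_fields A W" "Z \<in> vector_fields A W"
  shows "curvature_at A D p (X p) (Y p) (Z p) = curvature A D X Y Z p"
proof -
  let ?V = "W \<inter> fst (chart_at A p)"
  let ?e = "coord_ext A p"
  have V: "open ?V" "p \<in> ?V" using W chart_at(2)[of p] open_Int[OF W(1) chart_open[OF chart_at(1)[of p]]] by auto
  note g = f[THEN field_subset[OF _ Int_lower1[of W "fst (chart_at A p)"]]]
    coord_ext_field[THEN field_subset[OF _ Int_lower2[of W "fst (chart_at A p)"]]]
  have e: "?e (X p) p = X p" "?e (Y p) p = Y p" "?e (Z p) p = Z p"
    using coord_ext_self field_tangent W(2) f by blast+
  have "curvature A D (?e (X p)) (?e (Y p)) (?e (Z p)) p = curvature A D X (?e (Y p)) (?e (Z p)) p"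
    by (rule curvature_cong_point_first[OF V]) (simp_all add: g e)
  also have "\<dots> = - curvature A D (?e (Y p)) X (?e (Z p)) p"
    by (rule curvature_antisym[OF V]) (simp_all add: g)
  also have "\<dots> = - curvature A D Y X (?e (Z p)) p"
    by (subst curvature_cong_point_first[OF V, of _ Y]) (simp_all add: g e)
  also have "\<dots> = curvature A D X Y (?e (Z p)) p"
    by (rule curvature_antisym[OF V, symmetric]) (simp_all add: g)
  also have "\<dots> = curvature A D X Y Z p"
    by (rule curvature_cong_point_third[OF V]) (simp_all add: g e)
  finally show ?thesis by (simp add: curvature_at_def)
qed

end

section \<open>The curvature as a multilinear map on tangent vectors\<close>

context levi_civita
begin

lemma chart_at_open: "open (fst (chart_at A p))"
  by (rule chart_open[OF chart_at(1)])

lemma curvature_at_tangent: "curvature_at A D p u v w \<in> tangent_space A p"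
  unfolding curvature_at_def
  by (rule field_tangent[OF curvature_field[OF chart_at_open coord_ext_field coord_ext_field coord_ext_field]
        chart_at(2)])

lemma curvature_at_antisym: "curvature_at A D p u v w = - curvature_at A D p v u w"
  unfolding curvature_at_def
  by (rule curvature_antisym[OF chart_at_open chart_at(2)]) (rule coord_ext_field)+

lemma curvature_at_bianchi:
  "curvature_at A D p u v w + curvature_at A D p v w u + curvature_at A D p w u v = 0"
  unfolding curvature_at_def
  by (rule bianchi_first[OF chart_at_open chart_at(2)]) (rule coord_ext_field)+

lemma curvature_at_skew:
  assumes "w \<in> tangent_space A p" "z \<in> tangent_space A p"
  shows "g p (curvature_at A D p u v w) z = - g p w (curvature_at A D p u v z)"
  using curvature_skew[OF chart_at_open chart_at(2) coord_ext_field[of p u] coord_ext_field[of p v]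
      coord_ext_field[of p w] coord_ext_field[of p z]]
  by (simp only: curvature_at_def coord_ext_self assms)

lemma curvature_at_linear_first:
  assumes "v \<in> tangent_space A p" "w \<in> tangent_space A p"
  shows "linear_form p (\<lambda>u. curvature_at A D p u v w f)"
proof (rule linear_formI)
  note o = chart_at_open[of p] chart_at(2)[of p]
  note e = coord_ext_field[of p]
  fix u assume u: "u \<in> tangent_space A p"
  show "curvature_at A D p (u + u') v w f = curvature_at A D p u v w f + curvature_at A D p u' v w f"
    if u': "u' \<in> tangent_space A p" for u'
  proof -
    have "curvature_at A D p ((coord_ext A p u + coord_ext A p u') p) (coord_ext A p v p) (coord_ext A p w p)
        = curvature A D (coord_ext A p u) (coord_ext A p v) (coord_ext A p w) p
          + curvature A D (coord_ext A p u') (coord_ext A p v) (coord_ext A p w) p"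
      by (simp only: curvature_at_eq[OF o field_plus[OF e e] e e] curvature_add_first[OF o e e e e])
    then show ?thesis
      by (simp only: plus_fun_apply coord_ext_self u u' assms curvature_at_def[symmetric])
  qed
  show "curvature_at A D p (a *\<^sub>T u) v w f = a * curvature_at A D p u v w f" for a
  proof -
    have "curvature_at A D p ((\<lambda>q. a *\<^sub>T coord_ext A p u q) p) (coord_ext A p v p) (coord_ext A p w p)
        = a *\<^sub>T curvature A D (coord_ext A p u) (coord_ext A p v) (coord_ext A p w) p"
      by (simp only: curvature_at_eq[OF o field_scale[OF e smooth_fun_const] e e]
          curvature_scale_first[OF o smooth_fun_const e e e])
    then show ?thesis
      by (simp only: scale_tvec_apply coord_ext_self u assms curvature_at_def[symmetric])
  qed
qed

lemma curvature_at_linear_third: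
  assumes "u \<in> tangent_space A p" "v \<in> tangent_space A p"
  shows "linear_form p (\<lambda>w. curvature_at A D p u v w f)"
proof (rule linear_formI)
  note o = chart_at_open[of p] chart_at(2)[of p]
  note e = coord_ext_field[of p]
  fix w assume w: "w \<in> tangent_space A p"
  show "curvature_at A D p u v (w + w') f = curvature_at A D p u v w f + curvature_at A D p u v w' f"
    if w': "w' \<in> tangent_space A p" for w'
  proof -
    have "curvature_at A D p (coord_ext A p u p) (coord_ext A p v p) ((coord_ext A p w + coord_ext A p w') p)
        = curvature A D (coord_ext A p u) (coord_ext A p v) (coord_ext A p w) p
          + curvature A D (coord_ext A p u) (coord_ext A p v) (coord_ext A p w') p"
      by (simp only: curvature_at_eq[OF o e e field_plus[OF e e]] curvature_add_third[OF o e e e e])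
    then show ?thesis
      by (simp only: plus_fun_apply coord_ext_self w w' assms curvature_at_def[symmetric])
  qed
  show "curvature_at A D p u v (a *\<^sub>T w) f = a * curvature_at A D p u v w f" for a
  proof -
    have "curvature_at A D p (coord_ext A p u p) (coord_ext A p v p) ((\<lambda>q. a *\<^sub>T coord_ext A p w q) p)
        = a *\<^sub>T curvature A D (coord_ext A p u) (coord_ext A p v) (coord_ext A p w) p"
      by (simp only: curvature_at_eq[OF o e e field_scale[OF e smooth_fun_const]]
          curvature_scale_third[OF o smooth_fun_const e e e])
    then show ?thesis
      by (simp only: scale_tvec_apply coord_ext_self w assms curvature_at_def[symmetric])
  qed
qed

end

section \<open>Para-Sasakian manifolds\<close>

context para_sasakian
begin

lemma xi_tangent: "\<xi> p \<in> tangent_space A p"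
  by (rule field_tangent[OF xi_field UNIV_I])

lemma xi_field_on: "\<xi> \<in> vector_fields A W"
  by (rule field_subset[OF xi_field subset_UNIV])

lemma metric_xi_left: "v \<in> tangent_space A p \<Longrightarrow> g p (\<xi> p) v = \<eta> p v"
  using metric_xi metric_sym xi_tangent by metis

lemma one_form_uminus: "v \<in> tangent_space A p \<Longrightarrow> \<eta> p (- v) = - \<eta> p v"
  by (simp add: uminus_scale_tvec one_form_scale)

lemma one_form_diff:
  "u \<in> tangent_space A p \<Longrightarrow> v \<in> tangent_space A p \<Longrightarrow> \<eta> p (u - v) = \<eta> p u - \<eta> p v"
  using one_form_add[of u p "- v"] by (simp add: one_form_uminus tangent_uminus)

lemma endo_uminus: "v \<in> tangent_space A p \<Longrightarrow> \<phi> p (- v) = - \<phi> p v"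
  by (simp add: uminus_scale_tvec endo_scale)

lemma endo_diff:
  "u \<in> tangent_space A p \<Longrightarrow> v \<in> tangent_space A p \<Longrightarrow> \<phi> p (u - v) = \<phi> p u - \<phi> p v"
  using endo_add[of u p "- v"] by (simp add: endo_uminus tangent_uminus)

text \<open>Replacing \<open>u\<close> by \<phi> u in \<open>metric_phi_phi\<close> leaves g(\<phi>
  \<phi> u, \<phi> v) = g(\<phi> u, v), and on the left \<phi> \<phi> u differs from
  \<open>u\<close> by a multiple of \<xi>, which is orthogonal to \<phi> v.\<close>

lemma phi_symmetric:
  assumes u: "u \<in> tangent_space A p" and v: "v \<in> tangent_space A p"
  shows "g p (\<phi> p u) v = g p u (\<phi> p v)"
proof -
  note t = endo_tangent[OF u] endo_tangent[OF v]
  have "g p (\<phi> p (\<phi> p u)) (\<phi> p v) = g p (\<phi> p u) v"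
    using metric_phi_phi[OF t(1) v] eta_phi[OF u] by simp
  then show ?thesis
    by (simp add: phi_phi u metric_diff metric_scale metric_xi_left t tangent_scale xi_tangent eta_phi v)
qed

lemma metric_phi_sym:
  assumes "u \<in> tangent_space A p" "v \<in> tangent_space A p"
  shows "g p (\<phi> p u) v = g p (\<phi> p v) u"
  using phi_symmetric[OF assms] metric_sym[OF assms(1) endo_tangent[OF assms(2)]] by simp

lemma linear_form_eta: "linear_form p (\<eta> p)"
  by (rule linear_formI) (simp_all add: one_form_add one_form_scale)

lemma linear_form_metric: "w \<in> tangent_space A p \<Longrightarrow> linear_form p (\<lambda>u. g p u w)"
  by (rule linear_formI) (simp_all add: metric_add metric_scale)

lemma linear_form_metric_phi: "w \<in> tangent_space A p \<Longrightarrow> linear_form p (\<lambda>u. g p (\<phi> p u) w)"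
  by (rule linear_formI) (simp_all add: endo_add endo_scale endo_tangent metric_add metric_scale)

lemma linear_form_phi: "linear_form p (\<lambda>u. \<phi> p u f)"
  by (rule linear_formI) (simp_all add: endo_add endo_scale)

section \<open>Curvature with \<xi> as an argument\<close>

context
  fixes W :: "'m set" and p :: 'm
  assumes W: "open W" and p: "p \<in> W"
begin

text \<open>Since \<eta> is the pairing with \<xi>, metric compatibility and D_X \<xi> = \<phi> X
  differentiate it.\<close>

lemma derivative_eta:
  assumes "X \<in> vector_fields A W" "Z \<in> vector_fields A W"
  shows "X p (\<lambda>q. \<eta> q (Z q)) = \<eta> p (D X Z p) + g p (\<phi> p (X p)) (Z p)"
proof -
  note t = field_tangent[OF assms(1) p] field_tangent[OF assms(2) p]
  have "X p (\<lambda>q. \<eta> q (Z q)) = X p (\<lambda>q. g q (Z q) (\<xi> q))"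
    by (rule tangent_fun_cong[OF t(1) W p]) (simp add: metric_xi field_tangent[OF assms(2)])
  also have "\<dots> = g p (D X Z p) (\<xi> p) + g p (Z p) (D X \<xi> p)"
    by (rule metric_compatible[OF W assms xi_field_on p])
  finally show ?thesis
    by (simp add: metric_xi conn_tangent[OF W p assms] nabla_xi[OF W assms(1) p] metric_sym[OF t(2) endo_tangent[OF t(1)]])
qed

lemma conn_phi:
  assumes "X \<in> vector_fields A W" "Y \<in> vector_fields A W"
  shows "D X (\<lambda>q. \<phi> q (Y q)) p = \<phi> p (D X Y p) + ((- g p (X p) (Y p)) *\<^sub>T \<xi> p
    - \<eta> p (Y p) *\<^sub>T X p + (2 * \<eta> p (X p) * \<eta> p (Y p)) *\<^sub>T \<xi> p)"
  using nabla_phi[OF W assms p] by (metis add.commute diff_add_cancel)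

lemma conn_conn_xi:
  assumes "X \<in> vector_fields A W" "Y \<in> vector_fields A W"
  shows "D X (D Y \<xi>) p = D X (\<lambda>q. \<phi> q (Y q)) p"
  by (rule conn_cong_right[OF W p assms(1) conn_field[OF W assms(2) xi_field_on] nabla_xi[OF W assms(2)]])

text \<open>As D_Y \<xi> = \<phi> Y, the left side is (D_X \<phi>) Y - (D_Y \<phi>) X, and the
  \<xi>-components of \<open>nabla_phi\<close> are symmetric in \<open>X\<close> and
  \<open>Y\<close>.\<close>

lemma curvature_xi:
  assumes "X \<in> vector_fields A W" "Y \<in> vector_fields A W"
  shows "curvature A D X Y \<xi> p = \<eta> p (X p) *\<^sub>T Y p - \<eta> p (Y p) *\<^sub>T X p"
proof -
  note t = field_tangent[OF assms(1) p] field_tangent[OF assms(2) p]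
  have "curvature A D X Y \<xi> p = D X (\<lambda>q. \<phi> q (Y q)) p - D Y (\<lambda>q. \<phi> q (X q)) p
      - (\<phi> p (D X Y p) - \<phi> p (D Y X p))"
    using nabla_xi[OF W conn_field[OF W assms] p] nabla_xi[OF W conn_field[OF W assms(2,1)] p]
    by (simp add: curvature_eq[OF W p assms xi_field_on] conn_conn_xi assms)
  then show ?thesis
    by (simp add: conn_phi assms fun_eq_iff metric_sym[OF t] algebra_simps)
qed

end

lemma curvature_at_xi:
  assumes "u \<in> tangent_space A p" "v \<in> tangent_space A p"
  shows "curvature_at A D p u v (\<xi> p) = \<eta> p u *\<^sub>T v - \<eta> p v *\<^sub>T u"
proof -
  have "curvature_at A D p (coord_ext A p u p) (coord_ext A p v p) (\<xi> p)
      = curvature A D (coord_ext A p u) (coord_ext A p v) \<xi> p"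
    by (rule curvature_at_eq[OF chart_at_open chart_at(2) coord_ext_field coord_ext_field xi_field_on])
  then show ?thesis
    using curvature_xi[OF chart_at_open chart_at(2) coord_ext_field coord_ext_field, of p u v]
    by (simp only: coord_ext_self assms)
qed

text \<open>The trilinear form \<open>T y z w = g (R(\<xi>, y) z) w\<close> is skew in \<open>z, w\<close>, and the first Bianchi
  identity gives its skew part in \<open>y, z\<close>; as in the Koszul formula, this determines it.\<close>

lemma curvature_at_xi_left:
  assumes v: "v \<in> tangent_space A p" and w: "w \<in> tangent_space A p"
  shows "curvature_at A D p (\<xi> p) v w = \<eta> p w *\<^sub>T v - g p v w *\<^sub>T \<xi> p"
proof (rule metric_eqI)
  note x = xi_tangent[of p]
  define T where "T y z w = g p (curvature_at A D p (\<xi> p) y z) w" for y z w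
  have skew: "T y z w = - T y w z" if "z \<in> tangent_space A p" "w \<in> tangent_space A p" for y z w
    unfolding T_def curvature_at_skew[OF that]
    by (simp add: metric_sym[OF that(1) curvature_at_tangent])
  have b: "T y z w = T z y w + \<eta> p z * g p y w - \<eta> p y * g p z w"
    if t: "y \<in> tangent_space A p" "z \<in> tangent_space A p" "w \<in> tangent_space A p" for y z w
  proof -
    have "curvature_at A D p (\<xi> p) y z = curvature_at A D p (\<xi> p) z y - curvature_at A D p y z (\<xi> p)"
      using curvature_at_bianchi[of p "\<xi> p" y z] curvature_at_antisym[of p z "\<xi> p" y]
      by (simp add: add_eq_0_iff algebra_simps)
    also have "\<dots> = curvature_at A D p (\<xi> p) z y - (\<eta> p y *\<^sub>T z - \<eta> p z *\<^sub>T y)"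
      by (simp only: curvature_at_xi[OF t(1,2)])
    finally show ?thesis
      unfolding T_def
      by (simp add: metric_diff metric_scale curvature_at_tangent tangent_diff tangent_scale t)
  qed
  show "curvature_at A D p (\<xi> p) v w \<in> tangent_space A p" by (rule curvature_at_tangent)
  show "\<eta> p w *\<^sub>T v - g p v w *\<^sub>T \<xi> p \<in> tangent_space A p"
    by (intro tangent_diff tangent_scale v x)
  fix z assume z: "z \<in> tangent_space A p"
  have "T v w z = \<eta> p w * g p v z - g p v w * \<eta> p z"
    using skew[OF w z, of v] skew[OF v z, of w] skew[OF v w, of z]
      b[OF v w z] b[OF v z w] b[OF w z v] metric_sym[OF v w] metric_sym[OF v z] metric_sym[OF w z]
    by (simp add: algebra_simps)
  then show "g p (curvature_at A D p (\<xi> p) v w) z = g p (\<eta> p w *\<^sub>T v - g p v w *\<^sub>T \<xi> p) z"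
    by (simp add: T_def metric_diff metric_scale tangent_scale v x z metric_xi_left)
qed

end

section \<open>The Ricci tensor of the quarter-symmetric metric connection\<close>

context para_sasakian
begin

abbreviation qconn :: "'m field \<Rightarrow> 'm field \<Rightarrow> 'm field" where
  "qconn \<equiv> quarter_symmetric_connection \<phi> \<xi> \<eta> g D"

lemma qconn_apply: "qconn X Y p
    = D X Y p + \<eta> p (Y p) *\<^sub>T \<phi> p (X p) - g p (\<phi> p (X p)) (Y p) *\<^sub>T \<xi> p"
  by (simp add: quarter_symmetric_connection_def)

lemma phi_field: "open W \<Longrightarrow> X \<in> vector_fields A W \<Longrightarrow> (\<lambda>q. \<phi> q (X q)) \<in> vector_fields A W"
  by (rule endo_smooth)

context
  fixes W :: "'m set" and p :: 'm
  assumes W: "open W" and p: "p \<in> W"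
begin

lemma derivative_metric_phi:
  assumes "X \<in> vector_fields A W" "Y \<in> vector_fields A W" "Z \<in> vector_fields A W"
  shows "X p (\<lambda>q. g q (\<phi> q (Y q)) (Z q))
    = g p (D X (\<lambda>q. \<phi> q (Y q)) p) (Z p) + g p (\<phi> p (Y p)) (D X Z p)"
  by (rule metric_compatible[OF W assms(1) phi_field[OF W assms(2)] assms(3) p])

lemma conn_qconn:
  assumes "X \<in> vector_fields A W" "Y \<in> vector_fields A W" "Z \<in> vector_fields A W"
  shows "D X (qconn Y Z) p = D X (D Y Z) p
    + (X p (\<lambda>q. \<eta> q (Z q)) *\<^sub>T \<phi> p (Y p) + \<eta> p (Z p) *\<^sub>T D X (\<lambda>q. \<phi> q (Y q)) p)
    - (X p (\<lambda>q. g q (\<phi> q (Y q)) (Z q)) *\<^sub>T \<xi> p + g p (\<phi> p (Y p)) (Z p) *\<^sub>T \<phi> p (X p))"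
proof -
  note s = one_form_smooth[OF W assms(3)] metric_smooth[OF W phi_field[OF W assms(2)] assms(3)]
  note f = conn_field[OF W assms(2,3)] phi_field[OF W assms(2)]
  have 1: "D X (qconn Y Z) p = D X (\<lambda>q. D Y Z q + \<eta> q (Z q) *\<^sub>T \<phi> q (Y q)) p
      - D X (\<lambda>q. g q (\<phi> q (Y q)) (Z q) *\<^sub>T \<xi> q) p"
    unfolding quarter_symmetric_connection_def
    by (rule conn_diff_right[OF W p assms(1) field_add[OF f(1) field_scale[OF f(2) s(1)]]
        field_scale[OF xi_field_on s(2)]])
  have 2: "D X (\<lambda>q. D Y Z q + \<eta> q (Z q) *\<^sub>T \<phi> q (Y q)) p
      = D X (D Y Z) p + D X (\<lambda>q. \<eta> q (Z q) *\<^sub>T \<phi> q (Y q)) p"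
    by (rule conn_sum_right[OF W p assms(1) f(1) field_scale[OF f(2) s(1)]])
  have 3: "D X (\<lambda>q. \<eta> q (Z q) *\<^sub>T \<phi> q (Y q)) p
      = X p (\<lambda>q. \<eta> q (Z q)) *\<^sub>T \<phi> p (Y p) + \<eta> p (Z p) *\<^sub>T D X (\<lambda>q. \<phi> q (Y q)) p"
    by (rule conn_leibniz[OF W s(1) assms(1) f(2) p])
  have 4: "D X (\<lambda>q. g q (\<phi> q (Y q)) (Z q) *\<^sub>T \<xi> q) p
      = X p (\<lambda>q. g q (\<phi> q (Y q)) (Z q)) *\<^sub>T \<xi> p + g p (\<phi> p (Y p)) (Z p) *\<^sub>T \<phi> p (X p)"
    using conn_leibniz[OF W s(2) assms(1) xi_field_on p] by (simp only: nabla_xi[OF W assms(1) p])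
  show ?thesis by (simp only: 1 2 3 4)
qed

lemma qconn_qconn:
  assumes X: "X \<in> vector_fields A W" and Y: "Y \<in> vector_fields A W" and Z: "Z \<in> vector_fields A W"
  shows "qconn X (qconn Y Z) p f = D X (D Y Z) p f
    + (\<eta> p (D X Z p) + g p (\<phi> p (X p)) (Z p)) * \<phi> p (Y p) f
    + \<eta> p (Z p) * (\<phi> p (D X Y p) f - g p (X p) (Y p) * \<xi> p f - \<eta> p (Y p) * X p f
      + 2 * \<eta> p (X p) * \<eta> p (Y p) * \<xi> p f)
    - (g p (\<phi> p (D X Y p)) (Z p) - g p (X p) (Y p) * \<eta> p (Z p) - \<eta> p (Y p) * g p (X p) (Z p)
      + 2 * \<eta> p (X p) * \<eta> p (Y p) * \<eta> p (Z p) + g p (\<phi> p (Y p)) (D X Z p)) * \<xi> p f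
    - g p (\<phi> p (Y p)) (Z p) * \<phi> p (X p) f
    + (\<eta> p (D Y Z p) - g p (\<phi> p (Y p)) (Z p)) * \<phi> p (X p) f
    - (g p (\<phi> p (X p)) (D Y Z p) + \<eta> p (Z p) * (g p (X p) (Y p) - \<eta> p (X p) * \<eta> p (Y p))) * \<xi> p f"
proof -
  note t = field_tangent[OF X p] field_tangent[OF Y p] field_tangent[OF Z p]
    conn_tangent[OF W p X Y] conn_tangent[OF W p X Z] conn_tangent[OF W p Y Z] xi_tangent[of p]
  note tt = t endo_tangent[OF t(1)] endo_tangent[OF t(2)] endo_tangent[OF t(4)]
  have e: "\<eta> p (qconn Y Z p) = \<eta> p (D Y Z p) - g p (\<phi> p (Y p)) (Z p)"
    by (simp add: qconn_apply one_form_diff one_form_add one_form_scale tt tangent_add tangent_scale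
        eta_phi eta_xi)
  have h: "g p (\<phi> p (X p)) (qconn Y Z p)
      = g p (\<phi> p (X p)) (D Y Z p) + \<eta> p (Z p) * (g p (X p) (Y p) - \<eta> p (X p) * \<eta> p (Y p))"
    by (simp add: qconn_apply metric_diff_right metric_add_right metric_scale_right tt tangent_add
        tangent_scale metric_phi_phi metric_xi eta_phi)
  have k: "g p (D X (\<lambda>q. \<phi> q (Y q)) p) (Z p) = g p (\<phi> p (D X Y p)) (Z p)
      - g p (X p) (Y p) * \<eta> p (Z p) - \<eta> p (Y p) * g p (X p) (Z p)
      + 2 * \<eta> p (X p) * \<eta> p (Y p) * \<eta> p (Z p)"
    by (simp add: conn_phi[OF W p X Y] metric_diff metric_add metric_scale tt tangent_add tangent_diff
        tangent_scale metric_xi_left metric_uminus)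
  have c: "D X (\<lambda>q. \<phi> q (Y q)) p f = \<phi> p (D X Y p) f - g p (X p) (Y p) * \<xi> p f
      - \<eta> p (Y p) * X p f + 2 * \<eta> p (X p) * \<eta> p (Y p) * \<xi> p f"
    by (simp add: conn_phi[OF W p X Y])
  have q: "qconn X (qconn Y Z) p f = D X (qconn Y Z) p f + \<eta> p (qconn Y Z p) * \<phi> p (X p) f
      - g p (\<phi> p (X p)) (qconn Y Z p) * \<xi> p f"
    by (simp only: qconn_apply[of X "qconn Y Z"] plus_fun_apply minus_apply scale_tvec_apply)
  show ?thesis
    by (simp only: q e h conn_qconn[OF X Y Z] derivative_metric_phi[OF X Y Z] k derivative_eta[OF W p X Z]
        plus_fun_apply minus_apply scale_tvec_apply c)
qed

text \<open>Terms with \<open>D X Z\<close> and \<open>D Y Z\<close> are symmetric in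
  \<open>X\<close> and \<open>Y\<close>; those with \<open>D X Y\<close> are absorbed by the
  bracket. The 3 is 1 + 2: g(\<phi> X, Z) \<phi> Y arises once, from differentiating \<eta>(Z), and
  -g(\<phi> Y, Z) \<phi> X twice, from D_X \<xi> = \<phi> X and from the \<xi>-part of
  \<open>qconn Y Z\<close> under \<eta>.\<close>

lemma curvature_qconn:
  assumes X: "X \<in> vector_fields A W" and Y: "Y \<in> vector_fields A W" and Z: "Z \<in> vector_fields A W"
  shows "curvature A qconn X Y Z p = curvature A D X Y Z p
    + (3 * g p (\<phi> p (X p)) (Z p)) *\<^sub>T \<phi> p (Y p) - (3 * g p (\<phi> p (Y p)) (Z p)) *\<^sub>T \<phi> p (X p)
    + (\<eta> p (X p) * \<eta> p (Z p)) *\<^sub>T Y p - (\<eta> p (Y p) * \<eta> p (Z p)) *\<^sub>T X p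
    + (\<eta> p (Y p) * g p (X p) (Z p)) *\<^sub>T \<xi> p - (\<eta> p (X p) * g p (Y p) (Z p)) *\<^sub>T \<xi> p"
proof
  fix f
  note t = field_tangent[OF X p] field_tangent[OF Y p] field_tangent[OF Z p]
    conn_tangent[OF W p X Y] conn_tangent[OF W p Y X]
  have br: "lie_bracket A X Y p = D X Y p - D Y X p"
    by (rule torsion_free[OF W X Y p, symmetric])
  have "qconn (lie_bracket A X Y) Z p f = D (lie_bracket A X Y) Z p f
      + \<eta> p (Z p) * (\<phi> p (D X Y p) f - \<phi> p (D Y X p) f)
      - (g p (\<phi> p (D X Y p)) (Z p) - g p (\<phi> p (D Y X p)) (Z p)) * \<xi> p f"
    by (simp add: qconn_apply br endo_diff metric_diff endo_tangent t)
  then show "curvature A qconn X Y Z p f = (curvature A D X Y Z p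
    + (3 * g p (\<phi> p (X p)) (Z p)) *\<^sub>T \<phi> p (Y p) - (3 * g p (\<phi> p (Y p)) (Z p)) *\<^sub>T \<phi> p (X p)
    + (\<eta> p (X p) * \<eta> p (Z p)) *\<^sub>T Y p - (\<eta> p (Y p) * \<eta> p (Z p)) *\<^sub>T X p
    + (\<eta> p (Y p) * g p (X p) (Z p)) *\<^sub>T \<xi> p - (\<eta> p (X p) * g p (Y p) (Z p)) *\<^sub>T \<xi> p) f"
    by (simp add: curvature_def qconn_qconn[OF X Y Z] qconn_qconn[OF Y X Z] metric_sym[OF t(2,1)] algebra_simps)
qed

end

text \<open>Both curvatures are evaluated on the same coordinate extensions and differ by a
  pointwise expression, so tensoriality passes from \<open>D\<close> to
  \<open>qconn\<close>.\<close>

lemma curvature_at_qconn: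
  assumes "u \<in> tangent_space A p" "v \<in> tangent_space A p" "w \<in> tangent_space A p"
  shows "curvature_at A qconn p u v w = curvature_at A D p u v w
    + (3 * g p (\<phi> p u) w) *\<^sub>T \<phi> p v - (3 * g p (\<phi> p v) w) *\<^sub>T \<phi> p u
    + (\<eta> p u * \<eta> p w) *\<^sub>T v - (\<eta> p v * \<eta> p w) *\<^sub>T u
    + (\<eta> p v * g p u w) *\<^sub>T \<xi> p - (\<eta> p u * g p v w) *\<^sub>T \<xi> p"
  using curvature_qconn[OF chart_at_open chart_at(2) coord_ext_field[of p u] coord_ext_field[of p v]
      coord_ext_field[of p w]]
  by (simp only: curvature_at_def coord_ext_self assms)

text \<open>The terms with \<phi> vanish because \<eta> annihilates its image; the curvature of
  \<open>D\<close> and the correction contribute one equal copy each. This doubling is the source of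
  the value -2 for \<open>L\<close>.\<close>

lemma curvature_at_qconn_xi:
  assumes "u \<in> tangent_space A p" "v \<in> tangent_space A p"
  shows "curvature_at A qconn p u v (\<xi> p) = 2 *\<^sub>T (\<eta> p u *\<^sub>T v - \<eta> p v *\<^sub>T u)"
  by (simp add: curvature_at_qconn assms xi_tangent curvature_at_xi metric_xi endo_tangent eta_phi eta_xi
      fun_eq_iff algebra_simps)

lemma curvature_at_qconn_xi_left:
  assumes "v \<in> tangent_space A p" "w \<in> tangent_space A p"
  shows "curvature_at A qconn p (\<xi> p) v w = 2 *\<^sub>T (\<eta> p w *\<^sub>T v - g p v w *\<^sub>T \<xi> p)"
proof -
  \<comment> \<open>The identity \<phi> \<xi> = 0 leaves a zero vector in the metric, whose value
    follows from homogeneity on the tangent space.\<close>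
  have "g p 0 w = 0" using metric_scale[OF tangent_zero assms(2), of 0] by simp
  then show ?thesis
    by (simp add: curvature_at_qconn assms xi_tangent curvature_at_xi_left metric_xi_left phi_xi eta_xi
        fun_eq_iff algebra_simps)
qed

text \<open>The coefficient 2 of g is 3 - 1, from 3 g(\<phi> \<phi> v, w) and the last \<xi>-term;
  that of \<eta> \<otimes> \<eta> is -3 + 1 - n + 1.\<close>

lemma ricci_qconn:
  assumes v: "v \<in> tangent_space A p" and w: "w \<in> tangent_space A p"
  shows "ricci A qconn p v w = ricci A D p v w + 2 * g p v w
    - 3 * trace_at A p (\<phi> p) * g p (\<phi> p v) w - (real CARD('n) + 1) * \<eta> p v * \<eta> p w"
proof -
  note x = xi_tangent[of p] endo_tangent[OF v]
  \<comment> \<open>The scalars are regrouped so that each correction is a multiple of the identity,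
    of \<phi>, or of a rank-one map, whose traces are known.\<close>
  have "ricci A qconn p v w = trace_at A p (\<lambda>u. curvature_at A D p u v w
    + 3 *\<^sub>T g p (\<phi> p u) w *\<^sub>T \<phi> p v - (3 * g p (\<phi> p v) w) *\<^sub>T \<phi> p u
    + \<eta> p w *\<^sub>T \<eta> p u *\<^sub>T v - (\<eta> p v * \<eta> p w) *\<^sub>T u
    + \<eta> p v *\<^sub>T g p u w *\<^sub>T \<xi> p - g p v w *\<^sub>T \<eta> p u *\<^sub>T \<xi> p)"
    unfolding ricci_def by (rule trace_at_cong) (simp add: curvature_at_qconn v w fun_eq_iff)
  also have "\<dots> = ricci A D p v w + 3 * g p (\<phi> p (\<phi> p v)) w
    - 3 * g p (\<phi> p v) w * trace_at A p (\<phi> p) + \<eta> p w * \<eta> p v - \<eta> p v * \<eta> p w * CARD('n)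
    + \<eta> p v * g p (\<xi> p) w - g p v w * \<eta> p (\<xi> p)"
    by (simp only: trace_at_add trace_at_diff trace_at_scale trace_at_id ricci_def
        trace_at_rank_one[OF linear_form_metric_phi[OF w] x(2)] trace_at_rank_one[OF linear_form_eta v]
        trace_at_rank_one[OF linear_form_metric[OF w] x(1)] trace_at_rank_one[OF linear_form_eta x(1)])
  also have "g p (\<phi> p (\<phi> p v)) w = g p v w - \<eta> p v * \<eta> p w"
    by (simp add: phi_phi v w x metric_diff metric_scale tangent_scale metric_xi_left)
  finally show ?thesis by (simp add: metric_xi_left w eta_xi algebra_simps)
qed

lemma linear_form_ricci:
  assumes "v \<in> tangent_space A p"
  shows "linear_form p (\<lambda>w. ricci A D p v w)"
proof -
  have c: "linear_form p (\<lambda>w. curvature_at A D p (coord_field A (chart_at A p) i p) v w f)" for i f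
    by (rule curvature_at_linear_third[OF coord_field_tangent[OF chart_at] assms])
  show ?thesis
    using c unfolding linear_form_def ricci_def trace_at_eq
    by (simp add: sum.distrib sum_distrib_left)
qed

text \<open>Linearity is recorded in the second slot: later the first slot is varied only against
  \<xi>, where \<open>ricci_qconn_xi\<close> gives a multiple of \<eta>.\<close>

lemma linear_form_ricci_qconn:
  assumes v: "v \<in> tangent_space A p"
  shows "linear_form p (\<lambda>w. ricci A qconn p v w)"
  using linear_form_ricci[OF v] v unfolding linear_form_def
  by (simp add: ricci_qconn tangent_add tangent_scale metric_add_right metric_scale_right endo_tangent
      one_form_add one_form_scale algebra_simps)

text \<open>The trace is taken of twice a rank-one map minus a multiple of the identity. The factor
  found here is the only possible Einstein constant, and for n >= 2 it makes the Ricci tensor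
  nonzero at every point.\<close>

lemma ricci_qconn_xi:
  assumes v: "v \<in> tangent_space A p"
  shows "ricci A qconn p v (\<xi> p) = - 2 * (real CARD('n) - 1) * \<eta> p v"
proof -
  have "ricci A qconn p v (\<xi> p) = trace_at A p (\<lambda>u. 2 *\<^sub>T (\<eta> p u *\<^sub>T v - \<eta> p v *\<^sub>T u))"
    unfolding ricci_def by (rule trace_at_cong) (simp add: curvature_at_qconn_xi v)
  also have "\<dots> = 2 * (\<eta> p v - \<eta> p v * CARD('n))"
    by (simp only: trace_at_scale trace_at_diff trace_at_id trace_at_rank_one[OF linear_form_eta v])
  finally show ?thesis by (simp add: algebra_simps)
qed

text \<open>As \<open>curvature_at A qconn p (\<xi> p) y\<close> equals \<open>-2\<close> times \<open>\<xi> p \<and>\<^sub>g y\<close>, the condition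
  for \<open>X = \<xi>\<close> and \<open>W = \<xi>\<close> determines the Ricci tensor unless \<open>L p = -2\<close>.\<close>

lemma ricci_qconn_of_pseudosymmetric:
  assumes ps: "ricci_pseudosymmetric A g qconn L" and p: "p \<in> ricci_support A qconn" and L: "L p \<noteq> - 2"
    and y: "y \<in> tangent_space A p" and z: "z \<in> tangent_space A p"
  shows "ricci A qconn p z y = - 2 * (real CARD('n) - 1) * g p z y"
proof -
  note x = xi_tangent[of p]
  let ?S = "ricci A qconn p"
  define c where "c = - 2 * (real CARD('n) - 1)"
  note Sx = ricci_qconn_xi[folded c_def]
  have S2: "?S z (a *\<^sub>T \<xi> p - b *\<^sub>T y) = a * ?S z (\<xi> p) - b * ?S z y" for a b
  proof -
    have 1: "a *\<^sub>T \<xi> p - b *\<^sub>T y = a *\<^sub>T \<xi> p + (- b) *\<^sub>T y" by (simp add: fun_eq_iff)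
    have 2: "?S z (a *\<^sub>T \<xi> p + (- b) *\<^sub>T y) = a * ?S z (\<xi> p) + (- b) * ?S z y"
      using linear_form_ricci_qconn[OF z] x y tangent_scale unfolding linear_form_def by metis
    show ?thesis unfolding 1 2 by simp
  qed
  have e: "\<eta> p (a *\<^sub>T \<xi> p - b *\<^sub>T y) = a - b * \<eta> p y" for a b
    by (simp add: one_form_diff one_form_scale tangent_scale x y eta_xi)
  have tg: "a *\<^sub>T \<xi> p - b *\<^sub>T y \<in> tangent_space A p" for a b
    by (intro tangent_diff tangent_scale x y)
  have R1: "curvature_at A qconn p (\<xi> p) y z = (- 2 * g p y z) *\<^sub>T \<xi> p - (- 2 * \<eta> p z) *\<^sub>T y"
    by (simp add: curvature_at_qconn_xi_left y z fun_eq_iff algebra_simps)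
  have R2: "curvature_at A qconn p (\<xi> p) y (\<xi> p) = (- 2 * \<eta> p y) *\<^sub>T \<xi> p - (- 2) *\<^sub>T y"
    by (simp add: curvature_at_qconn_xi x y eta_xi fun_eq_iff algebra_simps)
  \<comment> \<open>The scalar 1 stays explicit so that \<open>S2\<close> matches this vector as
    well.\<close>
  have W: "wedge (g p) (\<xi> p) y z = g p y z *\<^sub>T \<xi> p - \<eta> p z *\<^sub>T y"
    "wedge (g p) (\<xi> p) y (\<xi> p) = \<eta> p y *\<^sub>T \<xi> p - 1 *\<^sub>T y"
    by (simp_all only: wedge_def metric_xi_left[OF z] metric_xi[OF y] metric_xi[OF x] eta_xi)
  have "derivation_action (curvature_at A qconn p (\<xi> p) y) ?S z (\<xi> p)
      = L p * derivation_action (wedge (g p) (\<xi> p) y) ?S z (\<xi> p)"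
    using ps p x y z unfolding ricci_pseudosymmetric_def by blast
  then have "- (c * (- 2 * g p y z - (- 2 * \<eta> p z) * \<eta> p y)) - ((- 2 * \<eta> p y) * (c * \<eta> p z) - (- 2) * ?S z y)
      = L p * (- (c * (g p y z - \<eta> p z * \<eta> p y)) - (\<eta> p y * (c * \<eta> p z) - 1 * ?S z y))"
    by (simp only: derivation_action_def R1 R2 W S2 Sx[OF tg] e Sx[OF z])
  then have "(L p + 2) * (?S z y - c * g p y z) = 0"
    by (simp add: algebra_simps)
  then show ?thesis using L by (simp add: c_def metric_sym[OF y z] add_eq_0_iff2)
qed

end

section \<open>The Lie derivative of the Ricci tensor along \<open>\<xi>\<close>\<close>

context levi_civita
begin

context
  fixes W :: "'m set" and p :: 'm
  assumes W: "open W" and p: "p \<in> W"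
begin

lemma lie_bracket_antisym: "lie_bracket A X Y p f = - lie_bracket A Y X p f"
  by (simp add: lie_bracket_def)

text \<open>In this derivation form the Jacobi identity moves \<open>lie_xi\<close> inside the
  bracket that occurs in the curvature.\<close>

lemma lie_bracket_jacobi:
  assumes "X \<in> vector_fields A W" "Y \<in> vector_fields A W" "Z \<in> vector_fields A W"
  shows "lie_bracket A X (lie_bracket A Y Z) p
    = lie_bracket A (lie_bracket A X Y) Z p + lie_bracket A Y (lie_bracket A X Z) p"
proof
  fix f
  show "lie_bracket A X (lie_bracket A Y Z) p f
    = (lie_bracket A (lie_bracket A X Y) Z p + lie_bracket A Y (lie_bracket A X Z) p) f"
  proof (cases "smooth_near A p f")
    case True
    then show ?thesis
      using lie_bracket_antisym[of "lie_bracket A X Y" Z f]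
      by (simp add: lie_bracket_lie_bracket[OF W p] assms)
  qed (simp add: lie_bracket_def)
qed

lemma lie_bracket_diff_right:
  assumes "X \<in> vector_fields A W" "Y \<in> vector_fields A W" "Z \<in> vector_fields A W"
  shows "lie_bracket A X (\<lambda>q. Y q - Z q) p = lie_bracket A X Y p - lie_bracket A X Z p"
proof -
  have "lie_bracket A X (\<lambda>q. Y q - Z q) p = D X (\<lambda>q. Y q - Z q) p - D (\<lambda>q. Y q - Z q) X p"
    by (rule torsion_free[OF W assms(1) field_diff[OF assms(2,3)] p, symmetric])
  also have "\<dots> = (D X Y p - D Y X p) - (D X Z p - D Z X p)"
    by (simp add: conn_diff_right[OF W p assms] conn_diff_left[OF W p assms(2,3,1)])
  finally show ?thesis
    by (simp only: torsion_free[OF W assms(1,2) p] torsion_free[OF W assms(1,3) p])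
qed

end

end

context para_sasakian
begin

abbreviation lie_xi :: "'m field \<Rightarrow> 'm field" where
  "lie_xi \<equiv> lie_bracket A \<xi>"

text \<open>By \<open>metric_phi_phi\<close> this is g(\<phi> u, \<phi> v): the metric of the
  distribution orthogonal to \<xi>, extended by 0 along \<xi>.\<close>

abbreviation transverse_metric :: "'m \<Rightarrow> 'm tvec \<Rightarrow> 'm tvec \<Rightarrow> real" where
  "transverse_metric p u v \<equiv> g p u v - \<eta> p u * \<eta> p v"

lemma lie_xi_field: "open W \<Longrightarrow> X \<in> vector_fields A W \<Longrightarrow> lie_xi X \<in> vector_fields A W"
  by (rule lie_bracket_field[OF _ xi_field_on])

context
  fixes W :: "'m set" and p :: 'm
  assumes W: "open W" and p: "p \<in> W"
begin

lemma lie_xi_apply: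
  assumes "X \<in> vector_fields A W"
  shows "lie_xi X p = D \<xi> X p - \<phi> p (X p)"
  using torsion_free[OF W xi_field_on assms p] by (simp add: nabla_xi[OF W assms p])

text \<open>Along \<xi> the coefficients -1, -1 and 2 of \<open>nabla_phi\<close> cancel. As \<phi>
  also commutes with itself, \<open>lie_xi_apply\<close> then shows that \<phi> is invariant along
  \<xi>.\<close>

lemma conn_xi_phi:
  assumes "X \<in> vector_fields A W"
  shows "D \<xi> (\<lambda>q. \<phi> q (X q)) p = \<phi> p (D \<xi> X p)"
  using conn_phi[OF W p xi_field_on assms] field_tangent[OF assms p]
  by (simp add: metric_xi_left eta_xi fun_eq_iff)

lemma lie_xi_phi:
  assumes "X \<in> vector_fields A W"
  shows "lie_xi (\<lambda>q. \<phi> q (X q)) p = \<phi> p (lie_xi X p)"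
  by (simp add: lie_xi_apply phi_field W assms conn_xi_phi endo_diff
      conn_tangent[OF W p xi_field_on assms] endo_tangent field_tangent[OF assms p])

text \<open>The Lie derivative of the connection at (X, Y) is the second covariant derivative of
  \<xi>, here (D_X \<phi>) Y, plus R(\<xi>, X) Y. The terms \<eta>(Y) X cancel, and the
  \<xi>-components add up to -2 times the transverse metric.\<close>

lemma lie_xi_conn:
  assumes "X \<in> vector_fields A W" "Y \<in> vector_fields A W"
  shows "lie_xi (D X Y) p = D (lie_xi X) Y p + D X (lie_xi Y) p
    - (2 * transverse_metric p (X p) (Y p)) *\<^sub>T \<xi> p"
proof
  fix f
  note x = xi_field_on[of W]
  note t = field_tangent[OF assms(1) p] field_tangent[OF assms(2) p]
  have 1: "lie_xi (D X Y) p f = D \<xi> (D X Y) p f - \<phi> p (D X Y p) f"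
    by (simp add: lie_xi_apply conn_field[OF W assms])
  have 2: "D (lie_xi X) Y p f = D (D \<xi> X) Y p f - D (D X \<xi>) Y p f"
    by (simp add: conn_lie_bracket_left[OF W p x assms])
  have "D X (lie_xi Y) p = D X (\<lambda>q. D \<xi> Y q - D Y \<xi> q) p"
    by (rule conn_cong_right[OF W p assms(1) lie_xi_field[OF W assms(2)]
        torsion_free[OF W x assms(2), symmetric]])
  also have "\<dots> = D X (D \<xi> Y) p - D X (\<lambda>q. \<phi> q (Y q)) p"
    by (simp only: conn_diff_right[OF W p assms(1) conn_field[OF W x assms(2)] conn_field[OF W assms(2) x]]
        conn_conn_xi[OF W p assms])
  finally have 3: "D X (lie_xi Y) p f = D X (D \<xi> Y) p f - D X (\<lambda>q. \<phi> q (Y q)) p f" by simp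
  have "curvature A D \<xi> X Y p = \<eta> p (Y p) *\<^sub>T X p - g p (X p) (Y p) *\<^sub>T \<xi> p"
    using curvature_at_eq[OF W p x assms] curvature_at_xi_left[OF t] by simp
  then have 4: "D \<xi> (D X Y) p f = D X (D \<xi> Y) p f + (D (D \<xi> X) Y p f - D (D X \<xi>) Y p f)
      + \<eta> p (Y p) * X p f - g p (X p) (Y p) * \<xi> p f"
    by (simp add: curvature_eq[OF W p x assms] fun_eq_iff algebra_simps)
  show "lie_xi (D X Y) p f = (D (lie_xi X) Y p + D X (lie_xi Y) p
    - (2 * transverse_metric p (X p) (Y p)) *\<^sub>T \<xi> p) f"
    by (simp add: 1 2 3 4 conn_phi[OF W p assms] algebra_simps)
qed

lemma derivative_transverse_metric:
  assumes "X \<in> vector_fields A W" "Y \<in> vector_fields A W" "Z \<in> vector_fields A W"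
  shows "X p (\<lambda>q. 2 * transverse_metric q (Y q) (Z q)) = 2 * (g p (D X Y p) (Z p) + g p (Y p) (D X Z p)
    - \<eta> p (Y p) * (\<eta> p (D X Z p) + g p (\<phi> p (X p)) (Z p))
    - (\<eta> p (D X Y p) + g p (\<phi> p (X p)) (Y p)) * \<eta> p (Z p))"
proof -
  note t = field_tangent[OF assms(1) p]
  note s = smooth_nearI[OF W p metric_smooth[OF W assms(2,3)]]
    smooth_nearI[OF W p one_form_smooth[OF W assms(2)]] smooth_nearI[OF W p one_form_smooth[OF W assms(3)]]
  have sh: "smooth_near A p (\<lambda>q. transverse_metric q (Y q) (Z q))"
    by (intro smooth_nearI[OF W p] smooth_fun_diff smooth_fun_mult W metric_smooth one_form_smooth assms)
  have "X p (\<lambda>q. 2 * transverse_metric q (Y q) (Z q)) = 2 * X p (\<lambda>q. transverse_metric q (Y q) (Z q))"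
    using tangent_fun_mult[OF t smooth_near_const sh] by (simp only: tangent_fun_const[OF t])
  also have "X p (\<lambda>q. transverse_metric q (Y q) (Z q))
      = X p (\<lambda>q. g q (Y q) (Z q)) - X p (\<lambda>q. \<eta> q (Y q) * \<eta> q (Z q))"
    by (rule tangent_fun_diff[OF t s(1) smooth_near_mult[OF s(2,3)]])
  finally show ?thesis
    by (simp add: tangent_fun_mult[OF t s(2,3)] metric_compatible[OF W assms p]
        derivative_eta[OF W p assms(1,2)] derivative_eta[OF W p assms(1,3)])
qed

end

context
  fixes W :: "'m set" and p :: 'm
  assumes W: "open W" and p: "p \<in> W"
begin

text \<open>Two applications of \<open>lie_xi_conn\<close>: the inner correction is a function times
  \<xi>, so the outer derivative acts on both factors.\<close>

lemma lie_xi_conn_conn: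
  assumes "X \<in> vector_fields A W" "Y \<in> vector_fields A W" "Z \<in> vector_fields A W"
  shows "lie_xi (D X (D Y Z)) p f = D (lie_xi X) (D Y Z) p f
    + D X (D (lie_xi Y) Z) p f + D X (D Y (lie_xi Z)) p f
    - X p (\<lambda>q. 2 * transverse_metric q (Y q) (Z q)) * \<xi> p f
    - 2 * transverse_metric p (Y p) (Z p) * \<phi> p (X p) f
    - 2 * transverse_metric p (X p) (D Y Z p) * \<xi> p f"
proof -
  let ?h = "\<lambda>q. 2 * transverse_metric q (Y q) (Z q)"
  note l = lie_xi_field[OF W assms(2)] lie_xi_field[OF W assms(3)]
  note f = conn_field[OF W l(1) assms(3)] conn_field[OF W assms(2) l(2)]
  have s: "smooth_fun A W ?h"
    by (intro smooth_fun_diff smooth_fun_mult smooth_fun_const W metric_smooth one_form_smooth assms)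
  have "D X (lie_xi (D Y Z)) p = D X (\<lambda>q. D (lie_xi Y) Z q + D Y (lie_xi Z) q - ?h q *\<^sub>T \<xi> q) p"
    by (rule conn_cong_right[OF W p assms(1) lie_xi_field[OF W conn_field[OF W assms(2,3)]]])
      (rule lie_xi_conn[OF W _ assms(2,3)])
  also have "\<dots> = D X (D (lie_xi Y) Z) p + D X (D Y (lie_xi Z)) p
      - (X p ?h *\<^sub>T \<xi> p + ?h p *\<^sub>T D X \<xi> p)"
    by (simp only: conn_diff_right[OF W p assms(1) field_add[OF f] field_scale[OF xi_field_on s]]
        conn_sum_right[OF W p assms(1) f] conn_leibniz[OF W s assms(1) xi_field_on p])
  finally show ?thesis
    by (simp add: lie_xi_conn[OF W p assms(1) conn_field[OF W assms(2,3)]] nabla_xi[OF W assms(1) p])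
qed

text \<open>A variation T of the connection changes the curvature by (D_X T)(Y, Z) - (D_Y T)(X, Z).
  Here T is -2 times the transverse metric times \<xi>; differentiating the metric factor gives the
  \<xi>-terms, and D \<xi> = \<phi> the others.\<close>

lemma lie_xi_curvature:
  assumes X: "X \<in> vector_fields A W" and Y: "Y \<in> vector_fields A W" and Z: "Z \<in> vector_fields A W"
  shows "lie_xi (curvature A D X Y Z) p f = curvature A D (lie_xi X) Y Z p f
    + curvature A D X (lie_xi Y) Z p f + curvature A D X Y (lie_xi Z) p f
    - 2 * ((g p (\<phi> p (Y p)) (Z p) * \<eta> p (X p) - g p (\<phi> p (X p)) (Z p) * \<eta> p (Y p)) * \<xi> p f
      + transverse_metric p (Y p) (Z p) * \<phi> p (X p) f - transverse_metric p (X p) (Z p) * \<phi> p (Y p) f)"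
proof -
  let ?B = "lie_bracket A X Y"
  note t = field_tangent[OF X p] field_tangent[OF Y p] field_tangent[OF Z p]
    conn_tangent[OF W p X Y] conn_tangent[OF W p Y X]
  note x = xi_field_on[of W]
  note B = lie_bracket_field[OF W X Y]
  note l = lie_xi_field[OF W X] lie_xi_field[OF W Y]
  note lB = lie_bracket_field[OF W l(1) Y] lie_bracket_field[OF W X l(2)]
  have c: "curvature A D X Y Z = (\<lambda>q. D X (D Y Z) q - D Y (D X Z) q - D ?B Z q)"
    by (simp add: curvature_def fun_eq_iff)
  note f = conn_field[OF W X conn_field[OF W Y Z]] conn_field[OF W Y conn_field[OF W X Z]]
    conn_field[OF W B Z]
  have 1: "lie_xi (curvature A D X Y Z) p f
      = lie_xi (D X (D Y Z)) p f - lie_xi (D Y (D X Z)) p f - lie_xi (D ?B Z) p f"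
    unfolding c
    by (simp only: lie_bracket_diff_right[OF W p x field_diff[OF f(1,2)] f(3)]
        lie_bracket_diff_right[OF W p x f(1,2)] minus_apply)
  have "D (lie_xi ?B) Z p = D (\<lambda>q. lie_bracket A (lie_xi X) Y q + lie_bracket A X (lie_xi Y) q) Z p"
    by (rule conn_cong_left[OF W p lie_xi_field[OF W B] Z lie_bracket_jacobi[OF W _ x X Y]])
  also have "\<dots> = D (lie_bracket A (lie_xi X) Y) Z p + D (lie_bracket A X (lie_xi Y)) Z p"
    by (rule conn_sum_left[OF W p lB Z])
  finally have 2: "lie_xi (D ?B Z) p f = D (lie_bracket A (lie_xi X) Y) Z p f
      + D (lie_bracket A X (lie_xi Y)) Z p f + D ?B (lie_xi Z) p f
      - 2 * transverse_metric p (?B p) (Z p) * \<xi> p f"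
    by (simp add: lie_xi_conn[OF W p B Z])
  have "?B p = D X Y p - D Y X p" by (rule torsion_free[OF W X Y p, symmetric])
  then have 3: "transverse_metric p (?B p) (Z p)
      = g p (D X Y p) (Z p) - g p (D Y X p) (Z p) - (\<eta> p (D X Y p) - \<eta> p (D Y X p)) * \<eta> p (Z p)"
    by (simp add: metric_diff one_form_diff t)
  show ?thesis
    by (simp only: 1 2 3 lie_xi_conn_conn[OF X Y Z] lie_xi_conn_conn[OF Y X Z]
        curvature_def[of A D "lie_xi X"] curvature_def[of A D X "lie_xi Y"] curvature_def[of A D X Y "lie_xi Z"]
        derivative_transverse_metric[OF W p X Y Z] derivative_transverse_metric[OF W p Y X Z]
        minus_apply metric_phi_sym[OF t(1,2)])
      (simp add: algebra_simps)
qed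

end

section \<open>Derivatives of traces along \<xi>\<close>

lemma ricci_chart:
  assumes "\<kappa> \<in> A" "open W" "p \<in> W" "W \<subseteq> fst \<kappa>" and Y: "Y \<in> vector_fields A W" and Z: "Z \<in> vector_fields A W"
  shows "ricci A D p (Y p) (Z p)
    = (\<Sum>i\<in>UNIV. curvature A D (coord_field A \<kappa> i) Y Z p (coord_fun \<kappa> i))"
proof -
  have pk: "p \<in> fst \<kappa>" using assms by blast
  note E = field_subset[OF coord_field_field[OF assms(1)] assms(4)]
  have "ricci A D p (Y p) (Z p)
      = (\<Sum>i\<in>UNIV. curvature_at A D p (coord_field A \<kappa> i p) (Y p) (Z p) (coord_fun \<kappa> i))"
    unfolding ricci_def
    by (rule trace_at_chart[OF curvature_at_linear_first[OF field_tangent[OF Y assms(3)]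
            field_tangent[OF Z assms(3)]] curvature_at_tangent assms(1) pk])
  then show ?thesis by (simp only: curvature_at_eq[OF assms(2,3) E Y Z])
qed

lemma trace_phi_chart:
  assumes "\<kappa> \<in> A" "p \<in> fst \<kappa>"
  shows "trace_at A p (\<phi> p) = (\<Sum>i\<in>UNIV. \<phi> p (coord_field A \<kappa> i p) (coord_fun \<kappa> i))"
  by (rule trace_at_chart[OF linear_form_phi endo_tangent assms])

lemma trace_phi_smooth_near: "smooth_near A p (\<lambda>q. trace_at A q (\<phi> q))"
proof -
  let ?\<kappa> = "chart_at A p"
  have "smooth_near A p (\<lambda>q. \<Sum>i\<in>UNIV. \<phi> q (coord_field A ?\<kappa> i q) (coord_fun ?\<kappa> i))"
    by (intro smooth_nearI[OF chart_at_open chart_at(2)] smooth_fun_sum chart_at_open finite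
        field_smooth[OF phi_field[OF chart_at_open coord_field_field[OF chart_at(1)]]] order_refl
        smooth_fun_coord_fun chart_at(1))
  then show ?thesis
    by (rule smooth_near_cong[OF _ chart_at_open chart_at(2)]) (simp add: trace_phi_chart[OF chart_at(1)])
qed

text \<open>Traces commute with Lie derivatives, and \<phi> is invariant along \<xi> by
  \<open>lie_xi_phi\<close>.\<close>

lemma xi_trace_phi: "\<xi> p (\<lambda>q. trace_at A q (\<phi> q)) = 0"
proof -
  let ?\<kappa> = "chart_at A p"
  let ?E = "coord_field A ?\<kappa>" and ?x = "coord_fun ?\<kappa>"
  let ?V = "fst ?\<kappa>"
  note V = chart_at_open[of p] chart_at(2)[of p]
  note E = coord_field_field[OF chart_at(1), of p]
  note lt = field_tangent[OF lie_xi_field[OF V(1) E] V(2)]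
  have "\<xi> p (\<lambda>q. trace_at A q (\<phi> q)) = \<xi> p (\<lambda>q. \<Sum>i\<in>UNIV. \<phi> q (?E i q) (?x i))"
    by (rule tangent_fun_cong[OF xi_tangent V]) (rule trace_phi_chart[OF chart_at(1)])
  also have "\<dots> = (\<Sum>i\<in>UNIV. lie_xi (\<lambda>q. \<phi> q (?E i q)) p (?x i)
      - (\<Sum>j\<in>UNIV. lie_xi (?E i) p (?x j) * \<phi> p (?E j p) (?x i)))"
    by (rule lie_derivative_trace[OF chart_at(1) V(1) order_refl V(2) xi_field_on phi_field[OF V(1) E]])
  also have "\<dots> = 0"
    by (simp only: lie_xi_phi[OF V E] linear_form_expand[OF linear_form_phi chart_at lt, symmetric])
      simp
  finally show ?thesis .
qed

text \<open>This is \<open>lie_xi_curvature\<close> traced over the first argument: the two copies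
  of g(\<phi> Y, Z) cancel, \<phi> \<xi> = 0 and the vanishing of \<eta> on images of \<phi> remove
  two more terms, and only the trace of \<phi> survives.\<close>

lemma xi_ricci:
  assumes W: "open W" "p \<in> W" and YW: "Y \<in> vector_fields A W" and ZW: "Z \<in> vector_fields A W"
  shows "\<xi> p (\<lambda>q. ricci A D q (Y q) (Z q)) = ricci A D p (lie_xi Y p) (Z p) + ricci A D p (Y p) (lie_xi Z p)
    - 2 * trace_at A p (\<phi> p) * transverse_metric p (Y p) (Z p)"
proof -
  let ?\<kappa> = "chart_at A p"
  let ?E = "coord_field A ?\<kappa>" and ?x = "coord_fun ?\<kappa>"
  let ?V = "W \<inter> fst ?\<kappa>"
  have V: "open ?V" "p \<in> ?V" "?V \<subseteq> fst ?\<kappa>"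
    using W chart_at(2)[of p] open_Int[OF W(1) chart_at_open[of p]] by auto
  note Y = field_subset[OF YW Int_lower1[of W "fst ?\<kappa>"]] and Z = field_subset[OF ZW Int_lower1[of W "fst ?\<kappa>"]]
  note E = field_subset[OF coord_field_field[OF chart_at(1)] V(3)]
  note l = lie_xi_field[OF V(1) Y] lie_xi_field[OF V(1) Z] lie_xi_field[OF V(1) E]
  note t = field_tangent[OF Y V(2)] field_tangent[OF Z V(2)] xi_tangent[of p]
  note lt = field_tangent[OF l(3) V(2)]
  let ?h = "transverse_metric p"
  \<comment> \<open>The correction in \<open>lie_xi_curvature\<close> as a function of its first
    argument, split into rank-one maps and a multiple of \<phi>; for this the transverse metric of
    \<open>u\<close> and \<open>Z p\<close> is separated into its g- and \<eta>-parts.\<close>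
  let ?C = "\<lambda>u. g p (\<phi> p (Y p)) (Z p) *\<^sub>T \<eta> p u *\<^sub>T \<xi> p - \<eta> p (Y p) *\<^sub>T g p (\<phi> p u) (Z p) *\<^sub>T \<xi> p
      + ?h (Y p) (Z p) *\<^sub>T \<phi> p u - (g p u (Z p) *\<^sub>T \<phi> p (Y p) - \<eta> p (Z p) *\<^sub>T \<eta> p u *\<^sub>T \<phi> p (Y p))"
  have C: "lie_xi (curvature A D (?E i) Y Z) p (?x i)
      - (\<Sum>j\<in>UNIV. lie_xi (?E i) p (?x j) * curvature A D (?E j) Y Z p (?x i))
      = curvature A D (?E i) (lie_xi Y) Z p (?x i) + curvature A D (?E i) Y (lie_xi Z) p (?x i)
        - 2 * ?C (?E i p) (?x i)" for i
  proof -
    \<comment> \<open>Expanding \<open>lie_xi (?E i)\<close> in the frame reproduces the sum over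
      \<open>j\<close>, so differentiating the frame contributes nothing to the trace.\<close>
    have "curvature A D (lie_xi (?E i)) Y Z p (?x i)
        = curvature_at A D p (lie_xi (?E i) p) (Y p) (Z p) (?x i)"
      by (simp only: curvature_at_eq[OF V(1,2) l(3) Y Z])
    also have "\<dots> = (\<Sum>j\<in>UNIV. lie_xi (?E i) p (?x j) * curvature_at A D p (?E j p) (Y p) (Z p) (?x i))"
      by (rule linear_form_expand[OF curvature_at_linear_first[OF t(1,2)] chart_at lt])
    finally show ?thesis
      by (simp add: lie_xi_curvature[OF V(1,2) E Y Z] curvature_at_eq[OF V(1,2) E Y Z] algebra_simps)
  qed
  have "\<xi> p (\<lambda>q. ricci A D q (Y q) (Z q)) = \<xi> p (\<lambda>q. \<Sum>i\<in>UNIV. curvature A D (?E i) Y Z q (?x i))"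
    by (rule tangent_fun_cong[OF xi_tangent V(1,2)]) (rule ricci_chart[OF chart_at(1) V(1) _ V(3) Y Z])
  also have "\<dots> = (\<Sum>i\<in>UNIV. lie_xi (curvature A D (?E i) Y Z) p (?x i)
      - (\<Sum>j\<in>UNIV. lie_xi (?E i) p (?x j) * curvature A D (?E j) Y Z p (?x i)))"
    by (rule lie_derivative_trace[OF chart_at(1) V(1,3,2) xi_field_on curvature_field[OF V(1) E Y Z]])
  also have "\<dots> = ricci A D p (lie_xi Y p) (Z p) + ricci A D p (Y p) (lie_xi Z p) - 2 * trace_at A p ?C"
    by (simp only: C ricci_chart[OF chart_at(1) V l(1) Z] ricci_chart[OF chart_at(1) V Y l(2)]
        trace_at_eq[of p ?C] sum.distrib sum_subtractf sum_distrib_left)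
  also have "trace_at A p ?C = g p (\<phi> p (Y p)) (Z p) * \<eta> p (\<xi> p) - \<eta> p (Y p) * g p (\<phi> p (\<xi> p)) (Z p)
      + ?h (Y p) (Z p) * trace_at A p (\<phi> p) - (g p (\<phi> p (Y p)) (Z p) - \<eta> p (Z p) * \<eta> p (\<phi> p (Y p)))"
    by (simp only: trace_at_add trace_at_diff trace_at_scale trace_at_rank_one[OF linear_form_eta t(3)]
        trace_at_rank_one[OF linear_form_metric_phi[OF t(2)] t(3)]
        trace_at_rank_one[OF linear_form_metric[OF t(2)] endo_tangent[OF t(1)]]
        trace_at_rank_one[OF linear_form_eta endo_tangent[OF t(1)]])
  also have "\<dots> = trace_at A p (\<phi> p) * ?h (Y p) (Z p)"
    using metric_scale[OF tangent_zero t(2), of 0] by (simp add: eta_xi phi_xi eta_phi t)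
  finally show ?thesis by simp
qed

end

section \<open>Ricci-pseudosymmetry\<close>

context para_sasakian
begin

section \<open>Dimension at most two\<close>

lemma linear_form_combination:
  assumes "linear_form p \<alpha>" "u \<in> tangent_space A p" "v \<in> tangent_space A p"
  shows "\<alpha> (a *\<^sub>T u + b *\<^sub>T v) = a * \<alpha> u + b * \<alpha> v"
  using assms tangent_scale unfolding linear_form_def by metis

text \<open>The vector \<open>e\<close> is the component orthogonal to \<xi> of any vector off the
  line of \<xi>; if there is none, \<open>e\<close> is 0.\<close>

lemma tangent_span_two:
  assumes dim: "CARD('n) \<le> 2"
  obtains e where "e \<in> tangent_space A p"
    "\<And>v. v \<in> tangent_space A p \<Longrightarrow> \<exists>b. v = \<eta> p v *\<^sub>T \<xi> p + b *\<^sub>T e"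
proof (cases "\<forall>v\<in>tangent_space A p. v = \<eta> p v *\<^sub>T \<xi> p")
  case True
  have "\<exists>b. v = \<eta> p v *\<^sub>T \<xi> p + b *\<^sub>T 0" if "v \<in> tangent_space A p" for v
  proof
    show "v = \<eta> p v *\<^sub>T \<xi> p + 0 *\<^sub>T 0"
      using bspec[OF True that] by (simp only: scale_tvec_simps add_0_right)
  qed
  with that[OF tangent_zero] show ?thesis by blast
next
  case False
  then obtain u where u: "u \<in> tangent_space A p" "u \<noteq> \<eta> p u *\<^sub>T \<xi> p" by blast
  define e where "e = u - \<eta> p u *\<^sub>T \<xi> p"
  have e: "e \<in> tangent_space A p" "e \<noteq> 0" "\<eta> p e = 0"
    using u by (simp_all add: e_def tangent_diff tangent_scale xi_tangent one_form_diff one_form_scale eta_xi)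
  let ?k = "chart_at A p"
  \<comment> \<open>Components in a chart transfer independence and span to \<open>real^'n\<close>,
    where dimensions can be counted.\<close>
  define c :: "'m tvec \<Rightarrow> real^'n" where "c v = (\<chi> i. v (coord_fun ?k i))" for v
  have recover: "v = coord_vec A ?k p (c v)" if "v \<in> tangent_space A p" for v
    unfolding c_def by (rule tangent_expand_coord_vec[OF chart_at that])
  note lin = coord_vec_linear[OF chart_at]
  have c_nonzero: "c e \<noteq> 0"
  proof
    assume "c e = 0"
    then have "e = coord_vec A ?k p (0 *\<^sub>R 0)" using recover[OF e(1)] by simp
    then show False using e(2) by (simp only: lin scale_tvec_simps)
  qed
  have nsp: "c (\<xi> p) \<notin> span {c e}"
  proof
    assume "c (\<xi> p) \<in> span {c e}"
    then obtain m where "c (\<xi> p) = m *\<^sub>R c e" by (auto simp: span_singleton)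
    then have "\<xi> p = m *\<^sub>T e" by (metis recover e(1) lin(2) xi_tangent)
    then have "\<eta> p (\<xi> p) = m * \<eta> p e" by (simp only: one_form_scale[OF e(1)])
    then show False by (simp add: eta_xi e(3))
  qed
  then have ne: "c (\<xi> p) \<noteq> c e" using span_base[of "c e" "{c e}"] by auto
  have "independent {c (\<xi> p), c e}" using nsp c_nonzero by (simp add: independent_insert)
  then have "UNIV \<subseteq> span {c (\<xi> p), c e}"
    by (rule card_ge_dim_independent[OF subset_UNIV]) (use dim ne in simp)
  have "\<exists>b. v = \<eta> p v *\<^sub>T \<xi> p + b *\<^sub>T e" if v: "v \<in> tangent_space A p" for v
  proof -
    have "c v \<in> span {c (\<xi> p), c e}" using \<open>UNIV \<subseteq> _\<close> by blast
    then obtain k m where "c v - k *\<^sub>R c (\<xi> p) = m *\<^sub>R c e"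
      by (auto simp: span_breakdown_eq span_singleton)
    then have "c v = k *\<^sub>R c (\<xi> p) + m *\<^sub>R c e" by (simp add: algebra_simps)
    then have eq: "v = k *\<^sub>T \<xi> p + m *\<^sub>T e"
      using recover[OF v] recover[OF xi_tangent] recover[OF e(1)] lin by metis
    have "\<eta> p v = k * \<eta> p (\<xi> p) + m * \<eta> p e"
      unfolding eq by (rule linear_form_combination[OF linear_form_eta xi_tangent e(1)])
    with eq show ?thesis by (auto simp: eta_xi e(3))
  qed
  then show ?thesis using that e(1) by blast
qed

text \<open>The deviation \<open>K\<close> from constant curvature -2 is alternating in its two
  arguments and vanishes when one of them is \<xi>, which leaves nothing on a space spanned by \<xi>
  and one more vector.\<close>

lemma ricci_qconn_dim_le_two:
  assumes dim: "CARD('n) \<le> 2" and v: "v \<in> tangent_space A p" and w: "w \<in> tangent_space A p"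
  shows "ricci A qconn p v w = - 2 * (real CARD('n) - 1) * g p v w"
proof -
  obtain e where e: "e \<in> tangent_space A p"
    and dec: "\<And>v. v \<in> tangent_space A p \<Longrightarrow> \<exists>b. v = \<eta> p v *\<^sub>T \<xi> p + b *\<^sub>T e"
    using tangent_span_two[OF dim] by blast
  note x = xi_tangent[of p]
  have R: "curvature_at A qconn p y z w = 2 *\<^sub>T (g p y w *\<^sub>T z - g p z w *\<^sub>T y)"
    if y: "y \<in> tangent_space A p" and z: "z \<in> tangent_space A p" for y z
  proof
    fix f
    define K where "K y z = curvature_at A qconn p y z w f - 2 * (g p y w * z f - g p z w * y f)" for y z
    have lin: "linear_form p (\<lambda>y. K y z)" if z: "z \<in> tangent_space A p" for z
      using curvature_at_linear_first[OF z w, of f] unfolding linear_form_def K_def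
      by (simp add: curvature_at_qconn z w tangent_add tangent_scale endo_add endo_scale endo_tangent
          metric_add metric_scale one_form_add one_form_scale algebra_simps)
    have anti: "K y z = - K z y" if "y \<in> tangent_space A p" "z \<in> tangent_space A p" for y z
      using curvature_at_antisym[of p y z w] by (simp add: K_def curvature_at_qconn that w)
    have Kx: "K (\<xi> p) z = 0" if "z \<in> tangent_space A p" for z
      by (simp add: K_def curvature_at_qconn_xi_left that w metric_xi_left)
    have Kee: "K e e = 0" using anti[OF e e] by simp
    have red: "\<exists>b. K y z = b * K e z" if yz: "y \<in> tangent_space A p" "z \<in> tangent_space A p" for y z
    proof -
      obtain b where b: "y = \<eta> p y *\<^sub>T \<xi> p + b *\<^sub>T e" by (rule exE[OF dec[OF yz(1)]])
      have "K y z = K (\<eta> p y *\<^sub>T \<xi> p + b *\<^sub>T e) z"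
        by (rule arg_cong[OF b, of "\<lambda>y. K y z"])
      also have "\<dots> = \<eta> p y * K (\<xi> p) z + b * K e z"
        by (rule linear_form_combination[OF lin[OF yz(2)] x e])
      finally show ?thesis using Kx[OF yz(2)] by auto
    qed
    \<comment> \<open>Reducing the first argument twice, with an exchange in between, leads from
      \<open>K y z\<close> to the vanishing \<open>K e e\<close>.\<close>
    have "K z e = 0" using red[OF z e] Kee by auto
    then have "K y z = 0" using red[OF y z] anti[OF e z] by auto
    then show "curvature_at A qconn p y z w f = (2 *\<^sub>T (g p y w *\<^sub>T z - g p z w *\<^sub>T y)) f"
      by (simp add: K_def)
  qed
  have "ricci A qconn p v w = trace_at A p (\<lambda>u. 2 *\<^sub>T (g p u w *\<^sub>T v - g p v w *\<^sub>T u))"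
    unfolding ricci_def by (rule trace_at_cong) (rule R[OF _ v])
  also have "\<dots> = 2 * (g p v w - g p v w * CARD('n))"
    by (simp only: trace_at_scale trace_at_diff trace_at_id trace_at_rank_one[OF linear_form_metric[OF w] v])
  finally show ?thesis by (simp add: algebra_simps)
qed

text \<open>Substituting the explicit Ricci tensor into \<open>xi_ricci\<close> gives
  \<open>n g (\<phi> v) w = 2 tr \<phi> (g v w - \<eta> v \<eta> w)\<close>, and taking the trace forces \<open>\<phi> = 0\<close> for \<open>n \<ge> 3\<close>.\<close>

lemma ricci_qconn_not_einstein_on_open:
  assumes dim: "CARD('n) \<ge> 3" and W: "open W" "p \<in> W"
    and ric: "\<And>q v w. q \<in> W \<Longrightarrow> v \<in> tangent_space A q \<Longrightarrow> w \<in> tangent_space A q \<Longrightarrow>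
      ricci A qconn q v w = - 2 * (real CARD('n) - 1) * g q v w"
  shows False
proof -
  let ?n = "real CARD('n)"
  let ?\<psi> = "\<lambda>q. trace_at A q (\<phi> q)"
  let ?V = "W \<inter> fst (chart_at A p)"
  note x = xi_tangent[of p] and xf = xi_field_on[of ?V]
  have V: "open ?V" "p \<in> ?V" using W chart_at(2)[of p] open_Int[OF W(1) chart_at_open[of p]] by auto
  \<comment> \<open>Solving \<open>ricci_qconn\<close> for the Ricci tensor of \<open>D\<close>; the
    coefficient of g is -2 (n - 1) - 2.\<close>
  have S: "ricci A D q v w = - 2 * ?n * g q v w + 3 * ?\<psi> q * g q (\<phi> q v) w + (?n + 1) * (\<eta> q v * \<eta> q w)"
    if "q \<in> W" "v \<in> tangent_space A q" "w \<in> tangent_space A q" for q v w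
    using ric[OF that] ricci_qconn[OF that(2,3)] by (simp add: algebra_simps)
  have key: "?n * g p (\<phi> p v) w = 2 * ?\<psi> p * transverse_metric p v w"
    if v: "v \<in> tangent_space A p" and w: "w \<in> tangent_space A p" for v w
  proof -
    define Y where "Y = coord_ext A p v"
    define Z where "Z = coord_ext A p w"
    have Y: "Y \<in> vector_fields A ?V" and Z: "Z \<in> vector_fields A ?V"
      unfolding Y_def Z_def by (rule field_subset[OF coord_ext_field Int_lower2])+
    have Yp: "Y p = v" and Zp: "Z p = w" by (simp_all add: Y_def Z_def coord_ext_self v w)
    define y where "y = D \<xi> Y p"
    define z where "z = D \<xi> Z p"
    have t: "y \<in> tangent_space A p" "z \<in> tangent_space A p"
      unfolding y_def z_def by (rule conn_tangent[OF V xf Y], rule conn_tangent[OF V xf Z])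
    note te = endo_tangent[OF v] endo_tangent[OF w] endo_tangent[OF t(1)] endo_tangent[OF t(2)]
      endo_tangent[OF endo_tangent[OF v]]
    let ?G = "\<lambda>q. g q (Y q) (Z q)" and ?F = "\<lambda>q. g q (\<phi> q (Y q)) (Z q)"
      and ?H = "\<lambda>q. \<eta> q (Y q) * \<eta> q (Z q)"
    note c = smooth_near_const
    note s = smooth_nearI[OF V metric_smooth[OF V(1) Y Z]] trace_phi_smooth_near[of p]
      smooth_nearI[OF V metric_smooth[OF V(1) phi_field[OF V(1) Y] Z]]
      smooth_nearI[OF V one_form_smooth[OF V(1) Y]] smooth_nearI[OF V one_form_smooth[OF V(1) Z]]
    note sF = smooth_near_mult[OF smooth_near_mult[OF c s(2)] s(3)]
    note sH = smooth_near_mult[OF s(4,5)]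
    have dG: "\<xi> p ?G = g p y w + g p v z"
      using metric_compatible[OF V(1) xf Y Z V(2)] by (simp only: y_def z_def Yp Zp)
    have d\<eta>: "\<xi> p (\<lambda>q. \<eta> q (Y q)) = \<eta> p y" "\<xi> p (\<lambda>q. \<eta> q (Z q)) = \<eta> p z"
      using derivative_eta[OF V xf Y] derivative_eta[OF V xf Z] metric_scale[OF tangent_zero v, of 0]
        metric_scale[OF tangent_zero w, of 0]
      by (simp_all add: y_def z_def Yp Zp phi_xi)
    have dF: "\<xi> p ?F = g p (\<phi> p y) w + g p (\<phi> p v) z"
      using derivative_metric_phi[OF V xf Y Z] by (simp only: conn_xi_phi[OF V Y] y_def z_def Yp Zp)
    have dH: "\<xi> p ?H = \<eta> p v * \<eta> p z + \<eta> p y * \<eta> p w"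
      by (simp only: tangent_fun_mult[OF x s(4,5)] d\<eta> Yp Zp)
    have "\<xi> p (\<lambda>q. ricci A D q (Y q) (Z q))
        = \<xi> p (\<lambda>q. (- 2 * ?n) * ?G q + (3 * ?\<psi> q) * ?F q + (?n + 1) * ?H q)"
      by (rule tangent_fun_cong[OF x V]) (use S field_tangent[OF Y] field_tangent[OF Z] in auto)
    also have "\<dots> = (- 2 * ?n) * \<xi> p ?G + (3 * ?\<psi> p) * \<xi> p ?F + (?n + 1) * \<xi> p ?H"
      by (simp only: tangent_fun_add[OF x smooth_near_add[OF smooth_near_mult[OF c s(1)] sF] smooth_near_mult[OF c sH]]
          tangent_fun_add[OF x smooth_near_mult[OF c s(1)] sF]
          tangent_fun_mult[OF x c s(1)] tangent_fun_mult[OF x c sH]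
          tangent_fun_mult[OF x smooth_near_mult[OF c s(2)] s(3)] tangent_fun_mult[OF x c s(2)]
          tangent_fun_const[OF x] xi_trace_phi) simp
    finally have L: "\<xi> p (\<lambda>q. ricci A D q (Y q) (Z q)) = (- 2 * ?n) * (g p y w + g p v z)
        + (3 * ?\<psi> p) * (g p (\<phi> p y) w + g p (\<phi> p v) z) + (?n + 1) * (\<eta> p v * \<eta> p z + \<eta> p y * \<eta> p w)"
      by (simp only: dG dF dH)
    have Rt: "\<xi> p (\<lambda>q. ricci A D q (Y q) (Z q)) = ricci A D p (y - \<phi> p v) w + ricci A D p v (z - \<phi> p w)
        - 2 * ?\<psi> p * transverse_metric p v w"
      using xi_ricci[OF V Y Z] by (simp only: lie_xi_apply[OF V Y] lie_xi_apply[OF V Z] y_def z_def Yp Zp)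
    have pp: "g p (\<phi> p (\<phi> p v)) w = transverse_metric p v w"
      by (simp add: phi_phi v metric_diff metric_scale tangent_scale x w metric_xi_left)
    \<comment> \<open>The covariant derivatives \<open>y\<close> and \<open>z\<close> drop out. With
      h the transverse metric and \<psi> the trace of \<phi>, there remains 4 n g(\<phi> v, w) = (6
      + 2) \<psi> h(v, w).\<close>
    show ?thesis
      using L[unfolded Rt] W(2) phi_symmetric[OF v w]
      by (simp add: S tangent_diff t te v w endo_diff metric_diff metric_diff_right one_form_diff eta_phi pp
          metric_phi_phi algebra_simps)
  qed
  have phi: "?n *\<^sub>T \<phi> p v = (2 * ?\<psi> p) *\<^sub>T (v - \<eta> p v *\<^sub>T \<xi> p)" if v: "v \<in> tangent_space A p" for v
  proof (rule metric_eqI)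
    note t = endo_tangent[OF v] tangent_diff[OF v tangent_scale[OF x, of "\<eta> p v"]]
    show "?n *\<^sub>T \<phi> p v \<in> tangent_space A p" "(2 * ?\<psi> p) *\<^sub>T (v - \<eta> p v *\<^sub>T \<xi> p) \<in> tangent_space A p"
      by (intro tangent_scale t)+
    show "g p (?n *\<^sub>T \<phi> p v) w = g p ((2 * ?\<psi> p) *\<^sub>T (v - \<eta> p v *\<^sub>T \<xi> p)) w" if w: "w \<in> tangent_space A p" for w
      by (simp add: metric_scale[OF t(1) w] metric_scale[OF t(2) w] key[OF v w] metric_diff v w tangent_scale x
          metric_scale metric_xi_left)
  qed
  have "?n * ?\<psi> p = trace_at A p (\<lambda>v. ?n *\<^sub>T \<phi> p v)" by (simp only: trace_at_scale)
  also have "\<dots> = trace_at A p (\<lambda>v. (2 * ?\<psi> p) *\<^sub>T (v - \<eta> p v *\<^sub>T \<xi> p))"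
    by (rule trace_at_cong) (rule phi)
  also have "\<dots> = 2 * ?\<psi> p * (?n - 1)"
    by (simp only: trace_at_scale trace_at_diff trace_at_id trace_at_rank_one[OF linear_form_eta x] eta_xi)
  \<comment> \<open>The projection off \<xi> has trace n - 1, so n \<psi> = 2 \<psi> (n - 1), which
    says nothing exactly when n = 2.\<close>
  finally have "?\<psi> p * (?n - 2) = 0" by (simp add: algebra_simps)
  then have \<psi>: "?\<psi> p = 0" using dim by auto
  have "\<phi> p v = 0" if "v \<in> tangent_space A p" for v
  proof
    fix f
    have "?n * \<phi> p v f = 0" using fun_cong[OF phi[OF that], of f] by (simp add: \<psi>)
    then show "\<phi> p v f = 0 f" by simp
  qed
  \<comment> \<open>With \<phi> = 0, the equation for its square leaves only multiples of \<xi>, so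
    the identity has trace 1 instead of n.\<close>
  then have "v = \<eta> p v *\<^sub>T \<xi> p" if "v \<in> tangent_space A p" for v
    using phi_phi[OF that] endo_tangent[OF that] that by (metis eq_iff_diff_eq_0)
  then have "trace_at A p (\<lambda>v. v) = trace_at A p (\<lambda>v. \<eta> p v *\<^sub>T \<xi> p)"
    by (rule trace_at_cong)
  then have "?n = 1" by (simp only: trace_at_id trace_at_rank_one[OF linear_form_eta x] eta_xi)
  then show False using dim by simp
qed

end

theorem theorem2:
  fixes A :: "('m::{t2_space, second_countable_topology}, 'n::finite) chart set"
    and \<phi> :: "'m \<Rightarrow> 'm tvec \<Rightarrow> 'm tvec"
    and \<xi> :: "'m field"
    and \<eta> :: "'m \<Rightarrow> 'm tvec \<Rightarrow> real"
    and g :: "'m \<Rightarrow> 'm tvec \<Rightarrow> 'm tvec \<Rightarrow> real"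
    and D D' :: "'m field \<Rightarrow> 'm field \<Rightarrow> 'm field"
    and L :: "'m \<Rightarrow> real"
  assumes "para_sasakian A \<phi> \<xi> \<eta> g D"
    and "D' = quarter_symmetric_connection \<phi> \<xi> \<eta> g D"
    and "continuous_on (ricci_support A D') L"
    and "ricci_pseudosymmetric A g D' L"
  shows "einstein A g D' \<or> (\<forall>x\<in>ricci_support A D'. L x = - 2)"
proof (rule disjCI)
  interpret para_sasakian A \<phi> \<xi> \<eta> g D by (rule assms(1))
  let ?c = "- 2 * (real CARD('n) - 1)"
  note ps = assms(4)[unfolded assms(2)]
  assume "\<not> (\<forall>x\<in>ricci_support A D'. L x = - 2)"
  then obtain p where p: "p \<in> ricci_support A qconn" "L p \<noteq> - 2" unfolding assms(2) by blast
  \<comment> \<open>In dimension one the constant -2 (n - 1) is 0, and the Ricci tensor would vanish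
    at a point of its own support.\<close>
  have "CARD('n) \<noteq> 1"
    using p(1) ricci_qconn_of_pseudosymmetric[OF ps p] unfolding ricci_support_def by auto
  then have n: "CARD('n) \<ge> 2" using zero_less_card_finite[where 'a = 'n] by linarith
  show "einstein A g D'"
  proof (cases "CARD('n) = 2")
    case True
    then show ?thesis
      unfolding einstein_def assms(2) by (intro exI[of _ ?c] allI ballI ricci_qconn_dim_le_two) simp_all
  next
    case False
    then have n3: "CARD('n) \<ge> 3" using n by simp
    \<comment> \<open>The value -2 (n - 1) at (\<xi>, \<xi>) puts every point into the support, so
      \<open>L\<close> is continuous on the whole manifold.\<close>
    have "ricci A qconn q (\<xi> q) (\<xi> q) \<noteq> 0" for q
      using n by (simp add: ricci_qconn_xi[OF xi_tangent] eta_xi)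
    then have supp: "ricci_support A qconn = UNIV"
      unfolding ricci_support_def using xi_tangent by blast
    then have "continuous_on UNIV L" using assms(2,3) by simp
    then have "open (L -` (- {- 2}))" by (rule open_vimage[rotated]) (simp add: open_Compl)
    then have False
      by (rule ricci_qconn_not_einstein_on_open[OF n3, of _ p])
        (use p(2) ricci_qconn_of_pseudosymmetric[OF ps] supp in auto)
    then show ?thesis ..
  qed
qed

end
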